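(* Let $U$ be uniformly distributed on $S^2$. For $n_1,n_2\in S^2$ the quantity $I_2(n_1,n_2)=\mathbb{E}\left(|U\cdot n_1||U\cdot n_2|\right)$ depends only on $\rho=|n_1\cdot n_2|\in[0,1]$, and, written $I_2(\rho)$, it is $$I_2(\rho)=\frac{2}{3\pi}\left(\sqrt{1-\rho^2}+\rho\arcsin\rho\right),\qquad I_2'(\rho)=\frac{2}{3\pi}\arcsin\rho.$$ Hence $I_2$ is strictly increasing and maps $[0,1]$ bijectively onto $[2/(3\pi),1/3]$. Define $k_2(\rho)=I_2(\rho)-\frac14$. If $Z\subset\mathbb{R}^3$ is a zonoid with unique even generating measure $\mu_Z$, and $K\subset\mathbb{R}^3$ is a convex body with surface-area measure $S_K$, then, with $W_Z=w_Z(U)$ and $B_K=b_K(U)$, $$\operatorname{Var}W_Z=\int_{S^2}\int_{S^2}k_2(|n\cdot n'|)\,d\mu_Z(n)\,d\mu_Z(n'),\qquad\operatorname{Var}B_K=\frac14\int_{S^2}\int_{S^2}k_2(|n\cdot n'|)\,dS_K(n)\,dS_K(n').$$ For a polyhedron (convex polytope) $P\subset\mathbb{R}^3$ with facets $F$ of area $A_F$ and outward unit normal $n_F$ and surface area $S(P)$, the second identity becomes $$\operatorname{Var}B_P=\frac14\sum_{F,F'}A_FA_{F'}I_2(|n_F\cdot n_{F'}|)-\frac{S(P)^2}{16}.$$ The kernel $(n,n')\mapsto k_2(|n\cdot n'|)$ is positive semidefinite on unoriented directions, although it takes negative values. Moreover, among full-dimensional zonoids, $\operatorname{Var}W_Z=0$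 if and only if $Z$ is a Euclidean ball up to translation, while $\operatorname{Var}B_K=0$ if and only if $K$ has constant brightness.
   Context: For a compact convex body $K\subset\mathbb{R}^3$ and $u\in S^2$: $h_K(u)=\max_{x\in K}u\cdot x$, the width is $w_K(u)=h_K(u)+h_K(-u)$, and the brightness $b_K(u)$ is the area of the orthogonal projection of $K$ onto $u^{\perp}$. The even generating measure of a zonoid $Z$ is normalized as the unique finite even positive Borel measure $\mu_Z$ on $S^2$ with $w_Z(u)=\int_{S^2}|u\cdot n|\,d\mu_Z(n)$ for all $u$. The surface-area measure $S_K$ is normalized so that $b_K(u)=\frac12\int_{S^2}|u\cdot n|\,dS_K(n)$; for a polytope $P$, $S_P=\sum_FA_F\delta_{n_F}$. "Unoriented directions" means unit vectors identified up to sign. Constant brightness means that $b_K$ is constant on $S^2$. *)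

theory Defs
  imports "HOL-Probability.Probability"
begin

section \<open>Uniform directions\<close>

text \<open>The uniform distribution on the unit sphere as the cone measure: a set of directions is
  weighted by the share of the unit ball that it sweeps out radially. The origin, where
  \<^const>\<open>sgn\<close> is not a direction, is a null set.\<close>

definition sphere_law :: "(real^3) measure" where
  "sphere_law = distr (uniform_measure lborel (cball 0 1)) borel sgn"

definition uniform_on_sphere :: "'a measure \<Rightarrow> ('a \<Rightarrow> real^3) \<Rightarrow> bool" where
  "uniform_on_sphere M U \<longleftrightarrow>
     U \<in> M \<rightarrow>\<^sub>M restrict_space borel (sphere 0 1) \<and> distr M borel U = sphere_law"

text \<open>\<open>I2 \<rho>\<close> is the common value of the mixed moment over all pairs of unit vectors with
  \<open>\<bar>n1 \<bullet> n2\<bar> = \<rho>\<close>; it is meaningful for \<open>0 \<le> \<rho> \<le> 1\<close> only.\<close>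

definition I2 :: "real \<Rightarrow> real" where
  "I2 \<rho> = (THE r. \<forall>n1\<in>sphere 0 1. \<forall>n2\<in>sphere 0 1. \<bar>n1 \<bullet> n2\<bar> = \<rho> \<longrightarrow>
                  (\<integral>u. \<bar>u \<bullet> n1\<bar> * \<bar>u \<bullet> n2\<bar> \<partial>sphere_law) = r)"

definition k2 :: "real \<Rightarrow> real" where
  "k2 \<rho> = I2 \<rho> - 1/4"


section \<open>Convex bodies, width and brightness\<close>

text \<open>Lower-dimensional bodies are admitted.\<close>

definition convex_body :: "(real^3) set \<Rightarrow> bool" where
  "convex_body K \<longleftrightarrow> compact K \<and> convex K \<and> K \<noteq> {}"

definition support_fun :: "(real^3) set \<Rightarrow> real^3 \<Rightarrow> real" where
  "support_fun K u = (SUP x\<in>K. u \<bullet> x)"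

definition width :: "(real^3) set \<Rightarrow> real^3 \<Rightarrow> real" where
  "width K u = support_fun K u + support_fun K (- u)"

definition plane_frame :: "real^3 \<Rightarrow> (real^3) \<times> (real^3) \<Rightarrow> bool" where
  "plane_frame u = (\<lambda>(e1, e2). norm e1 = 1 \<and> norm e2 = 1 \<and> e1 \<bullet> e2 = 0 \<and> e1 \<bullet> u = 0 \<and> e2 \<bullet> u = 0)"

text \<open>Area of a set contained in a plane orthogonal to the unit vector \<open>u\<close>: its two-dimensional
  Lebesgue measure in orthonormal coordinates of that plane. The choice of the frame is
  immaterial, since Lebesgue measure is invariant under orthogonal maps.\<close>

definition plane_area :: "real^3 \<Rightarrow> (real^3) set \<Rightarrow> real" where
  "plane_area u A = (let (e1, e2) = (SOME e. plane_frame u e)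
                     in measure lebesgue ((\<lambda>x. vector [x \<bullet> e1, x \<bullet> e2] :: real^2) ` A))"

definition orth_projection :: "real^3 \<Rightarrow> real^3 \<Rightarrow> real^3" where
  "orth_projection u x = x - (x \<bullet> u) *\<^sub>R u"

definition brightness :: "(real^3) set \<Rightarrow> real^3 \<Rightarrow> real" where
  "brightness K u = plane_area u (orth_projection u ` K)"

definition constant_brightness :: "(real^3) set \<Rightarrow> bool" where
  "constant_brightness K \<longleftrightarrow> (\<exists>c. \<forall>u\<in>sphere 0 1. brightness K u = c)"


section \<open>Zonoids and generating measures\<close>

text \<open>The sum is the Minkowski sum of sets.\<close>

definition zonotope :: "(real^3) set \<Rightarrow> bool" where
  "zonotope Z \<longleftrightarrow> (\<exists>(m::nat) a b. Z = (\<Sum>i<m. closed_segment (a i) (b i)))"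

text \<open>Zonoids are the limits of zonotopes in the Hausdorff metric.\<close>

definition zonoid :: "(real^3) set \<Rightarrow> bool" where
  "zonoid Z \<longleftrightarrow> convex_body Z \<and>
     (\<forall>\<epsilon>>0. \<exists>P. zonotope P \<and> Z \<subseteq> P + cball 0 \<epsilon> \<and> P \<subseteq> Z + cball 0 \<epsilon>)"

definition finite_sphere_measure :: "(real^3) measure \<Rightarrow> bool" where
  "finite_sphere_measure \<mu> \<longleftrightarrow>
     finite_measure \<mu> \<and> sets \<mu> = sets (restrict_space borel (sphere 0 1))"

definition even_generating_measure :: "(real^3) set \<Rightarrow> (real^3) measure \<Rightarrow> bool" where
  "even_generating_measure Z \<mu> \<longleftrightarrow> finite_sphere_measure \<mu> \<and>
     (\<forall>A\<in>sets \<mu>. measure \<mu> (uminus ` A) = measure \<mu> A) \<and>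
     (\<forall>u\<in>sphere 0 1. width Z u = (\<integral>n. \<bar>u \<bullet> n\<bar> \<partial>\<mu>))"


section \<open>Surface area measure\<close>

text \<open>Points outside \<open>K\<close> at distance at most \<open>\<epsilon>\<close> whose direction from their nearest point in
  \<open>K\<close> lies in \<open>\<omega>\<close>.\<close>

definition local_parallel_set :: "(real^3) set \<Rightarrow> real \<Rightarrow> (real^3) set \<Rightarrow> (real^3) set" where
  "local_parallel_set K \<epsilon> \<omega> =
     {x. x \<notin> K \<and> infdist x K \<le> \<epsilon> \<and> sgn (x - closest_point K x) \<in> \<omega>}"

text \<open>The surface area measure is the linear coefficient in the local Steiner formula,
  \<open>vol (local_parallel_set K \<epsilon> \<omega>) = \<epsilon> S(\<omega>) + O(\<epsilon>\<^sup>2)\<close>. Every facet of a polytope contributes its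
  area at its outward normal, and a planar body contributes its area at both normals, so that
  \<open>brightness K u = 1/2 \<integral> \<bar>u \<bullet> n\<bar> dS(n)\<close>.\<close>

definition surface_area_measure :: "(real^3) set \<Rightarrow> (real^3) measure \<Rightarrow> bool" where
  "surface_area_measure K S \<longleftrightarrow> finite_sphere_measure S \<and>
     (\<forall>\<omega>\<in>sets S. ((\<lambda>\<epsilon>. measure lebesgue (local_parallel_set K \<epsilon> \<omega>) / \<epsilon>)
                      \<longlongrightarrow> measure S \<omega>) (at_right 0))"


section \<open>Polytopes\<close>

definition facets :: "(real^3) set \<Rightarrow> (real^3) set set" where
  "facets P = {F. F facet_of P}"

text \<open>Unique for a facet \<open>F\<close> of a full-dimensional polytope \<open>P\<close>.\<close>

definition facet_normal :: "(real^3) set \<Rightarrow> (real^3) set \<Rightarrow> real^3" where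
  "facet_normal P F = (THE n. norm n = 1 \<and> (\<forall>x\<in>F. \<forall>y\<in>P. n \<bullet> y \<le> n \<bullet> x))"

definition facet_area :: "(real^3) set \<Rightarrow> (real^3) set \<Rightarrow> real" where
  "facet_area P F = plane_area (facet_normal P F) F"

definition surface_area :: "(real^3) set \<Rightarrow> real" where
  "surface_area P = (\<Sum>F\<in>facets P. facet_area P F)"


section \<open>Unoriented directions and positive semidefinite kernels\<close>

definition unoriented_directions :: "(real^3) set set" where
  "unoriented_directions = (\<lambda>n. {n, - n}) ` sphere 0 1"

text \<open>\<open>k2 \<bar>n \<bullet> n'\<bar>\<close> does not depend on the representatives \<open>n \<in> d\<close>, \<open>n' \<in> d'\<close>, so that the set of
  its values is a singleton.\<close>

definition k2_kernel :: "(real^3) set \<Rightarrow> (real^3) set \<Rightarrow> real" where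
  "k2_kernel d d' = the_elem ((\<lambda>(n, n'). k2 \<bar>n \<bullet> n'\<bar>) ` (d \<times> d'))"

definition psd_kernel_on :: "'b set \<Rightarrow> ('b \<Rightarrow> 'b \<Rightarrow> real) \<Rightarrow> bool" where
  "psd_kernel_on X \<kappa> \<longleftrightarrow> (\<forall>x\<in>X. \<forall>y\<in>X. \<kappa> x y = \<kappa> y x) \<and>
     (\<forall>S c. finite S \<and> S \<subseteq> X \<longrightarrow> 0 \<le> (\<Sum>x\<in>S. \<Sum>y\<in>S. c x * c y * \<kappa> x y))"

end

theory Submission
  imports Defs "HOL-Real_Asymp.Real_Asymp"
begin

text \<open>The gnomonic projection to a plane \<open>e1 \<bullet> x = 1\<close> turns spherical means of even functions into
  integrals over the plane with density \<open>(1 + t\<^sup>2 + s\<^sup>2)\<close> to the power \<open>- 3/2\<close>. With \<open>n1 = e1\<close> and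
  \<open>n2\<close> in the span of \<open>e1\<close> and \<open>e2\<close> the mixed moment becomes a one-dimensional integral. The kernel
  \<open>k2\<close> is the covariance of \<open>\<bar>U \<bullet> n\<bar>\<close> and \<open>\<bar>U \<bullet> n'\<bar>\<close>, which gives the variance formulas by
  Fubini's theorem and makes the kernel positive semidefinite.

  For the brightness of a general body, the distance function to \<open>K\<close> is convex, its gradient off \<open>K\<close> is the
  outer normal \<open>N\<close>, and along a line in direction \<open>u\<close> that hits \<open>K\<close> its variation in the shell
  \<open>0 < dist \<le> \<epsilon>\<close> is exactly \<open>2 \<epsilon>\<close>. Hence the integral of \<open>\<bar>u \<bullet> N\<bar>\<close> over the shell, divided by \<open>\<epsilon>\<close>,
  tends to \<open>2 b(u)\<close>. This yields Cauchy's projection formula for the surface area measure of the local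
  Steiner formula, and also Lipschitz continuity of the brightness, so that zero variance forces
  constancy on the whole sphere.

  The odd part of the support function of a zonoid is a limit of linear functions, hence linear. So a
  zonoid of constant width has the support function of a ball.\<close>

section \<open>Lebesgue measure in orthonormal frames\<close>

text \<open>The 1/4 in \<open>k2\<close> is a product of two means:
  \<open>\<bar>U \<bullet> n\<bar>\<close> has expectation 1/2, so subtracting 1/2 before
  integrating turns a second moment into a covariance. The surface area measure enters only as a
  hypothesis, through one limit for each Borel set of normals. The characterization of vanishing
  brightness variance is claimed for every convex body, with no such measure given; hence the
  continuity of the brightness is drawn from the shells themselves and not from an integral
  representation. The polytope formula takes a separate road as well: facets are counted along lines
  in direction \<open>u\<close>, a discrete form of the projection formula. Lines that miss
  \<open>K\<close> but meet the shell spoil the exact variation. They only contribute to an upper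
  bound, by the shadow of the parallel body, and that shadow shrinks to the shadow of
  \<open>K\<close>. At \<open>\<rho> = 1\<close> the two summands of the closed form of
  \<open>I2\<close> have infinite slopes of opposite sign, although their sum has a finite one; the
  derivative on the closed interval therefore comes from an integral of
  \<open>arcsin\<close>.\<close>

lemma vector3_eq: "(vector [a, b, c] :: real^3) = a *\<^sub>R axis 1 1 + b *\<^sub>R axis 2 1 + c *\<^sub>R axis 3 1"
  by (simp add: vec_eq_iff forall_3 axis_def)

lemma vector2_eq: "(vector [a, b] :: real^2) = a *\<^sub>R axis 1 1 + b *\<^sub>R axis 2 1"
  by (simp add: vec_eq_iff forall_2 axis_def)

lemma prod_Basis_cart: "(\<Prod>b\<in>Basis. (v :: real^'n) \<bullet> b) = (\<Prod>i\<in>UNIV. v $ i)"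
proof -
  have *: "(Basis :: (real^'n) set) = range (\<lambda>i. axis i 1)"
    by (auto simp: Basis_vec_def)
  show ?thesis
    unfolding * by (subst prod.reindex) (auto simp: inj_on_def axis_eq_axis inner_axis)
qed

lemma prod_UNIV_3: "(\<Prod>i\<in>UNIV. f i) = f 1 * f 2 * f (3::3)"
  unfolding UNIV_3 by (simp add: ac_simps)

text \<open>A measure on \<open>real^2\<close> that gives every box its volume is
  \<open>lborel\<close>; this carries Fubini's theorem over from pairs of reals to vectors.\<close>

lemma distr_vector2: "distr lborel borel (\<lambda>(a, b). vector [a, b] :: real^2) = lborel"
proof (rule lborel_eqI[symmetric])
  have m [measurable]: "(\<lambda>(a, b). vector [a, b] :: real^2) \<in> borel_measurable borel"
    unfolding vector2_eq borel_prod[symmetric] by measurable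
  fix l u :: "real^2" assume le: "\<And>b. b \<in> Basis \<Longrightarrow> l \<bullet> b \<le> u \<bullet> b"
  have le': "l $ i \<le> u $ i" for i using le[of "axis i 1"] by (simp add: inner_axis)
  have "emeasure (distr lborel borel (\<lambda>(a, b). vector [a, b] :: real^2)) (box l u)
      = emeasure lborel ((\<lambda>(a, b). vector [a, b] :: real^2) -` box l u)"
    by (subst emeasure_distr) auto
  also have "(\<lambda>(a, b). vector [a, b] :: real^2) -` box l u = {l$1<..<u$1} \<times> {l$2<..<u$2}"
    by (auto simp: mem_box_cart forall_2)
  also have "emeasure lborel \<dots> = ennreal (u$1 - l$1) * ennreal (u$2 - l$2)"
    by (subst lborel_prod[symmetric], subst lborel.emeasure_pair_measure_Times) (auto simp: le')
  also have "\<dots> = (\<Prod>b\<in>Basis. (u - l) \<bullet> b)"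
    by (simp add: prod_Basis_cart UNIV_2 le' ennreal_mult)
  finally show "emeasure (distr lborel borel (\<lambda>(a, b). vector [a, b] :: real^2)) (box l u)
      = (\<Prod>b\<in>Basis. (u - l) \<bullet> b)" .
qed simp

lemma emeasure_lborel_rectangle:
  fixes a b c d :: real
  assumes "a \<le> b" "c \<le> d"
  shows "emeasure lborel ({a<..<b} \<times> {c<..<d}) = ennreal (b - a) * ennreal (d - c)"
  by (subst lborel_prod[symmetric], subst lborel.emeasure_pair_measure_Times) (auto simp: assms)

lemma distr_vector3: "distr lborel borel (\<lambda>(a, b, c). vector [a, b, c] :: real^3) = lborel"
proof (rule lborel_eqI[symmetric])
  have m [measurable]: "(\<lambda>(a, b, c). vector [a, b, c] :: real^3) \<in> borel_measurable borel"
    unfolding vector3_eq borel_prod[symmetric] by measurable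
  fix l u :: "real^3" assume le: "\<And>b. b \<in> Basis \<Longrightarrow> l \<bullet> b \<le> u \<bullet> b"
  have le': "l $ i \<le> u $ i" for i using le[of "axis i 1"] by (simp add: inner_axis)
  have "emeasure (distr lborel borel (\<lambda>(a, b, c). vector [a, b, c] :: real^3)) (box l u)
      = emeasure lborel ((\<lambda>(a, b, c). vector [a, b, c] :: real^3) -` box l u)"
    by (subst emeasure_distr) auto
  also have "(\<lambda>(a, b, c). vector [a, b, c] :: real^3) -` box l u
      = {l$1<..<u$1} \<times> {l$2<..<u$2} \<times> {l$3<..<u$3}"
    by (auto simp: mem_box_cart forall_3)
  also have "emeasure lborel \<dots> = ennreal (u$1 - l$1) * (ennreal (u$2 - l$2) * ennreal (u$3 - l$3))"
    by (subst lborel_prod[symmetric], subst lborel.emeasure_pair_measure_Times)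
      (auto simp: le' emeasure_lborel_rectangle intro!: borel_open open_Times)
  also have "\<dots> = (\<Prod>b\<in>Basis. (u - l) \<bullet> b)"
    unfolding prod_Basis_cart prod_UNIV_3 vector_minus_component mult.assoc
    using le'[of 1] le'[of 2] le'[of 3] by (simp only: ennreal_mult diff_ge_0_iff_ge mult_nonneg_nonneg)
  finally show "emeasure (distr lborel borel (\<lambda>(a, b, c). vector [a, b, c] :: real^3)) (box l u)
      = (\<Prod>b\<in>Basis. (u - l) \<bullet> b)" .
qed simp

text \<open>The preimage of a box is a rotated box, whose volume is known from the invariance of
  \<open>lebesgue\<close>; on Borel sets the two measures agree.\<close>

lemma distr_orthogonal_transformation:
  fixes f :: "real^3 \<Rightarrow> real^3"
  assumes f: "orthogonal_transformation f"
  shows "distr lborel borel f = lborel"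
proof (rule lborel_eqI[symmetric])
  fix l u :: "real^3" assume le: "\<And>b. b \<in> Basis \<Longrightarrow> l \<bullet> b \<le> u \<bullet> b"
  let ?g = "inv f"
  have g: "orthogonal_transformation ?g"
    using f by (rule orthogonal_transformation_inv)
  have m [measurable]: "f \<in> borel_measurable borel"
    by (intro borel_measurable_continuous_onI linear_continuous_on
        orthogonal_transformation_linear[OF f, THEN linear_conv_bounded_linear[THEN iffD1]])
  have "f -` box l u = ?g ` box l u"
    by (rule bij_vimage_eq_inv_image[OF orthogonal_transformation_bij[OF f]])
  then have *: "measure lebesgue (f -` box l u) = measure lebesgue (box l u)"
      "f -` box l u \<in> lmeasurable"
    using measure_orthogonal_image[OF g, of "box l u"] measurable_orthogonal_image[OF g, of "box l u"]
    by simp_all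
  have b: "f -` box l u \<in> sets borel"
    using measurable_sets[OF m, of "box l u"] by simp
  have "emeasure (distr lborel borel f) (box l u) = emeasure lborel (f -` box l u)"
    by (subst emeasure_distr) auto
  also have "\<dots> = emeasure lebesgue (f -` box l u)" using b by simp
  also have "\<dots> = measure lebesgue (f -` box l u)"
    using *(2) by (simp add: emeasure_eq_measure2)
  also have "\<dots> = measure lebesgue (box l u)" by (simp add: *(1))
  also have "\<dots> = (\<Prod>b\<in>Basis. (u - l) \<bullet> b)"
    using le by (simp add: measure_lborel_box_eq)
  finally show "emeasure (distr lborel borel f) (box l u) = (\<Prod>b\<in>Basis. (u - l) \<bullet> b)" .
qed simp

lemma nn_integral_vector2:
  assumes [measurable]: "G \<in> borel_measurable borel"
  shows "(\<integral>\<^sup>+x. G x \<partial>lborel) = (\<integral>\<^sup>+a. \<integral>\<^sup>+b. G (vector [a, b] :: real^2) \<partial>lborel \<partial>lborel)"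
proof -
  have m [measurable]: "(\<lambda>(a, b). vector [a, b] :: real^2) \<in> borel_measurable (borel \<Otimes>\<^sub>M borel)"
    unfolding vector2_eq by measurable
  have "(\<integral>\<^sup>+x. G x \<partial>lborel) = (\<integral>\<^sup>+x. G x \<partial>distr lborel borel (\<lambda>(a, b). vector [a, b] :: real^2))"
    by (simp add: distr_vector2)
  also have "\<dots> = (\<integral>\<^sup>+z. G (case z of (a, b) \<Rightarrow> vector [a, b]) \<partial>(lborel \<Otimes>\<^sub>M lborel))"
    by (subst lborel_prod[symmetric], subst nn_integral_distr) auto
  also have "\<dots> = (\<integral>\<^sup>+a. \<integral>\<^sup>+b. G (vector [a, b] :: real^2) \<partial>lborel \<partial>lborel)"
    by (subst lborel.nn_integral_fst[symmetric]) auto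
  finally show ?thesis .
qed

lemma nn_integral_vector3:
  assumes [measurable]: "G \<in> borel_measurable borel"
  shows "(\<integral>\<^sup>+x. G x \<partial>lborel) =
    (\<integral>\<^sup>+a. \<integral>\<^sup>+b. \<integral>\<^sup>+c. G (vector [a, b, c] :: real^3) \<partial>lborel \<partial>lborel \<partial>lborel)"
proof -
  have m [measurable]: "(\<lambda>(a, b, c). vector [a, b, c] :: real^3) \<in> borel_measurable (lborel \<Otimes>\<^sub>M lborel)"
    unfolding measurable_lborel2 lborel_prod borel_prod[symmetric] vector3_eq by measurable
  have m' [measurable]: "(\<lambda>b. vector [a, fst b, snd b] :: real^3) \<in> borel_measurable (borel \<Otimes>\<^sub>M borel)" for a
    unfolding vector3_eq by measurable
  have "(\<integral>\<^sup>+x. G x \<partial>lborel) = (\<integral>\<^sup>+x. G x \<partial>distr lborel borel (\<lambda>(a, b, c). vector [a, b, c] :: real^3))"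
    by (simp add: distr_vector3)
  also have "\<dots> = (\<integral>\<^sup>+z. G (case z of (a, b, c) \<Rightarrow> vector [a, b, c]) \<partial>(lborel \<Otimes>\<^sub>M lborel))"
    by (subst lborel_prod[symmetric], subst nn_integral_distr[OF m]) auto
  also have "\<dots> = (\<integral>\<^sup>+a. \<integral>\<^sup>+b. G (vector [a, fst b, snd b] :: real^3) \<partial>lborel \<partial>lborel)"
    by (subst lborel.nn_integral_fst[OF measurable_compose[OF m assms], symmetric])
      (simp add: case_prod_beta')
  also have "\<dots> = (\<integral>\<^sup>+a. \<integral>\<^sup>+b. \<integral>\<^sup>+c. G (vector [a, b, c] :: real^3) \<partial>lborel \<partial>lborel \<partial>lborel)"
    by (rule nn_integral_cong, subst lborel_prod[symmetric], subst lborel.nn_integral_fst[symmetric]) auto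
  finally show ?thesis .
qed

definition orthonormal_frame :: "real^3 \<Rightarrow> real^3 \<Rightarrow> real^3 \<Rightarrow> bool" where
  "orthonormal_frame e1 e2 e3 \<longleftrightarrow> e1 \<bullet> e1 = 1 \<and> e2 \<bullet> e2 = 1 \<and> e3 \<bullet> e3 = 1 \<and>
     e1 \<bullet> e2 = 0 \<and> e1 \<bullet> e3 = 0 \<and> e2 \<bullet> e3 = 0"

lemma orthonormal_frameD:
  assumes "orthonormal_frame e1 e2 e3"
  shows "e1 \<bullet> e1 = 1" "e2 \<bullet> e2 = 1" "e3 \<bullet> e3 = 1" "e1 \<bullet> e2 = 0" "e1 \<bullet> e3 = 0" "e2 \<bullet> e3 = 0"
    "e2 \<bullet> e1 = 0" "e3 \<bullet> e1 = 0" "e3 \<bullet> e2 = 0"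
  using assms by (auto simp: orthonormal_frame_def inner_commute)

lemma inner_frame_combination:
  assumes "orthonormal_frame e1 e2 e3"
  shows "(a *\<^sub>R e1 + b *\<^sub>R e2 + c *\<^sub>R e3) \<bullet> e1 = a" "(a *\<^sub>R e1 + b *\<^sub>R e2 + c *\<^sub>R e3) \<bullet> e2 = b"
    "(a *\<^sub>R e1 + b *\<^sub>R e2 + c *\<^sub>R e3) \<bullet> e3 = c"
  by (simp_all add: inner_add_left orthonormal_frameD[OF assms])

lemma norm_frame_combination:
  assumes "orthonormal_frame e1 e2 e3"
  shows "norm (a *\<^sub>R e1 + b *\<^sub>R e2 + c *\<^sub>R e3) = sqrt (a\<^sup>2 + b\<^sup>2 + c\<^sup>2)"
proof -
  have "(a *\<^sub>R e1 + b *\<^sub>R e2 + c *\<^sub>R e3) \<bullet> (a *\<^sub>R e1 + b *\<^sub>R e2 + c *\<^sub>R e3) = a * a + b * b + c * c"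
    by (simp add: inner_add_left inner_add_right orthonormal_frameD[OF assms])
  then show ?thesis
    by (simp add: norm_eq_sqrt_inner power2_eq_square)
qed

lemma orthogonal_transformation_frame:
  assumes "orthonormal_frame e1 e2 e3"
  shows "orthogonal_transformation (\<lambda>x::real^3. x$1 *\<^sub>R e1 + x$2 *\<^sub>R e2 + x$3 *\<^sub>R e3)"
proof -
  have "linear (\<lambda>x::real^3. x$1 *\<^sub>R e1 + x$2 *\<^sub>R e2 + x$3 *\<^sub>R e3)"
    by (rule linearI) (simp_all add: scaleR_add_left scaleR_add_right)
  moreover have "norm x = sqrt ((x$1)\<^sup>2 + (x$2)\<^sup>2 + (x$3)\<^sup>2)" for x :: "real^3"
    by (simp add: norm_vec_def L2_set_def sum_3)
  ultimately show ?thesis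
    unfolding orthogonal_transformation norm_frame_combination[OF assms] by simp
qed

text \<open>Lets the frame follow the integrand: later its first axis is a given normal, or its last
  axis is the direction of projection.\<close>

lemma nn_integral_frame:
  assumes [measurable]: "G \<in> borel_measurable borel" and f: "orthonormal_frame e1 e2 e3"
  shows "(\<integral>\<^sup>+x. G x \<partial>lborel) =
    (\<integral>\<^sup>+a. \<integral>\<^sup>+b. \<integral>\<^sup>+c. G (a *\<^sub>R e1 + b *\<^sub>R e2 + c *\<^sub>R e3) \<partial>lborel \<partial>lborel \<partial>lborel)"
proof -
  let ?f = "\<lambda>x::real^3. x$1 *\<^sub>R e1 + x$2 *\<^sub>R e2 + x$3 *\<^sub>R e3"
  have "(\<integral>\<^sup>+x. G x \<partial>lborel) = (\<integral>\<^sup>+x. G x \<partial>distr lborel borel ?f)"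
    by (simp add: distr_orthogonal_transformation orthogonal_transformation_frame[OF f])
  also have "\<dots> = (\<integral>\<^sup>+x. G (?f x) \<partial>lborel)"
    by (subst nn_integral_distr) auto
  also have "\<dots> = (\<integral>\<^sup>+a. \<integral>\<^sup>+b. \<integral>\<^sup>+c. G (a *\<^sub>R e1 + b *\<^sub>R e2 + c *\<^sub>R e3) \<partial>lborel \<partial>lborel \<partial>lborel)"
    by (subst nn_integral_vector3) auto
  finally show ?thesis .
qed

lemma frame_representation:
  assumes f: "orthonormal_frame e1 e2 e3"
  shows "x = (x \<bullet> e1) *\<^sub>R e1 + (x \<bullet> e2) *\<^sub>R e2 + (x \<bullet> e3) *\<^sub>R e3"
proof -
  \<comment> \<open>That the frame spans the space is the surjectivity of an orthogonal map.\<close>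
  obtain y where "x = (\<lambda>x::real^3. x$1 *\<^sub>R e1 + x$2 *\<^sub>R e2 + x$3 *\<^sub>R e3) y"
    using orthogonal_transformation_surj[OF orthogonal_transformation_frame[OF f]] by (rule surjE)
  then have x: "x = y$1 *\<^sub>R e1 + y$2 *\<^sub>R e2 + y$3 *\<^sub>R e3" .
  show ?thesis
    unfolding x inner_frame_combination[OF f] ..
qed

lemma orthonormal_frame_cross3:
  assumes "norm e1 = 1" "norm e2 = 1" "e1 \<bullet> e2 = 0"
  shows "orthonormal_frame e1 e2 (cross3 e1 e2)"
proof -
  have "(norm (cross3 e1 e2))\<^sup>2 = 1"
    using norm_cross_dot[of e1 e2] assms by simp
  then have "cross3 e1 e2 \<bullet> cross3 e1 e2 = 1"
    by (simp only: power2_norm_eq_inner)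
  with assms show ?thesis
    unfolding orthonormal_frame_def norm_eq_1 by (simp only: dot_cross_self simp_thms)
qed

lemma exists_orthonormal_frame:
  assumes "norm (u :: real^3) = 1"
  obtains e1 e2 where "orthonormal_frame e1 e2 u"
proof -
  obtain y where y: "y \<noteq> 0" "orthogonal u y"
    using orthogonal_to_vector_exists[of u] by auto
  have "norm (sgn y) = 1" "u \<bullet> sgn y = 0"
    using y by (auto simp: norm_sgn sgn_div_norm orthogonal_def)
  then have "orthonormal_frame u (sgn y) (cross3 u (sgn y))"
    using assms by (intro orthonormal_frame_cross3)
  then have "orthonormal_frame (sgn y) (cross3 u (sgn y)) u"
    unfolding orthonormal_frame_def by (simp only: inner_commute simp_thms)
  then show ?thesis by (rule that)
qed

section \<open>Integrals over the sphere\<close>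

lemma nn_integral_FTC_atMost:
  fixes f :: "real \<Rightarrow> real"
  assumes f [measurable]: "f \<in> borel_measurable borel"
    and F: "\<And>x. x \<le> a \<Longrightarrow> DERIV F x :> f x" and nonneg: "\<And>x. x \<le> a \<Longrightarrow> 0 \<le> f x"
    and lim: "(F \<longlongrightarrow> B) at_bot"
  shows "(\<integral>\<^sup>+x. ennreal (f x) * indicator {..a} x \<partial>lborel) = ennreal (F a - B)"
proof -
  have "(\<integral>\<^sup>+x. ennreal (f x) * indicator {..a} x \<partial>lborel)
      = (\<integral>\<^sup>+x. ennreal (f (- x)) * indicator {-a..} x \<partial>lborel)"
    by (subst nn_integral_real_affine[where c = "-1" and t = 0])
      (auto intro!: nn_integral_cong simp: indicator_def)
  also have "\<dots> = ennreal ((- B) - (- F (- (- a))))"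
  proof (rule nn_integral_FTC_atLeast)
    fix x assume "- a \<le> x"
    then have "DERIV F (- x) :> f (- x)" by (intro F) auto
    then have "((\<lambda>x. F (- x)) has_real_derivative - f (- x)) (at x)"
      by (subst (asm) DERIV_mirror) auto
    then have "((\<lambda>x. - F (- x)) has_real_derivative - (- f (- x))) (at x)"
      by (rule DERIV_minus)
    then show "((\<lambda>x. - F (- x)) has_real_derivative f (- x)) (at x)" by simp
    show "0 \<le> f (- x)" using \<open>- a \<le> x\<close> by (intro nonneg) auto
  next
    show "((\<lambda>x. - F (- x)) \<longlongrightarrow> - B) at_top"
      by (intro tendsto_minus filterlim_compose[OF lim] filterlim_uminus_at_bot_at_top)
  qed auto
  finally show ?thesis by (simp add: algebra_simps)
qed

lemma nn_integral_split_at: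
  fixes a :: real
  assumes [measurable]: "f \<in> borel_measurable borel"
  shows "(\<integral>\<^sup>+x. f x \<partial>lborel)
    = (\<integral>\<^sup>+x. f x * indicator {..a} x \<partial>lborel) + (\<integral>\<^sup>+x. f x * indicator {a..} x \<partial>lborel)"
proof -
  have "(\<integral>\<^sup>+x. f x \<partial>lborel) = (\<integral>\<^sup>+x. f x * indicator {..a} x + f x * indicator {a..} x \<partial>lborel)"
    by (intro nn_integral_cong_AE eventually_mono[OF AE_lborel_singleton[of a]]) (auto simp: indicator_def)
  then show ?thesis by (simp add: nn_integral_add)
qed

lemma nn_integral_FTC_UNIV:
  fixes f :: "real \<Rightarrow> real"
  assumes f [measurable]: "f \<in> borel_measurable borel"
    and F: "\<And>x. DERIV F x :> f x" and nonneg: "\<And>x. 0 \<le> f x"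
    and lim: "(F \<longlongrightarrow> B) at_bot" "(F \<longlongrightarrow> T) at_top"
  shows "(\<integral>\<^sup>+x. ennreal (f x) \<partial>lborel) = ennreal (T - B)"
proof -
  have mono: "F x \<le> F y" if "x \<le> y" for x y
    using that F nonneg by (metis DERIV_nonneg_imp_nondecreasing)
  have "F 0 \<le> T"
    by (rule tendsto_lowerbound[OF lim(2)]) (auto intro!: eventually_at_top_linorderI mono)
  moreover have "B \<le> F 0"
    by (rule tendsto_upperbound[OF lim(1)]) (auto simp: eventually_at_bot_linorder intro!: exI[of _ 0] mono)
  ultimately have "ennreal (F 0 - B) + ennreal (T - F 0) = ennreal (T - B)"
    by (subst ennreal_plus[symmetric]) auto
  then show ?thesis
    by (subst nn_integral_split_at[where a = 0])
      (auto simp: nn_integral_FTC_atMost[OF f F nonneg lim(1)] nn_integral_FTC_atLeast[OF f F nonneg lim(2)])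
qed

lemma one_plus_square_pos [simp]: "0 < 1 + (x::real)\<^sup>2"
  by (simp add: add_pos_nonneg)

text \<open>Under \<open>w = tan \<theta>\<close> the function is \<open>sin \<theta>\<close> and
  its derivative in \<open>w\<close> is the cube of \<open>cos \<theta>\<close>; the same
  substitution suggests the primitives for the exponents 4 and 5.\<close>

lemma DERIV_div_sqrt:
  "((\<lambda>w. w / sqrt (1 + w\<^sup>2)) has_real_derivative 1 / sqrt (1 + w\<^sup>2) ^ 3) (at w)"
proof -
  define q where "q = sqrt (1 + w\<^sup>2)"
  have q: "q > 0" "q * q = 1 + w * w"
    by (auto simp: q_def) (simp add: power2_eq_square)
  have "((\<lambda>w. 1 + w\<^sup>2) has_real_derivative 2 * w) (at w)"
    by (rule derivative_eq_intros refl | simp)+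
  then have d: "((\<lambda>w. sqrt (1 + w\<^sup>2)) has_real_derivative inverse q / 2 * (2 * w)) (at w)"
    unfolding q_def by (rule DERIV_chain2[OF DERIV_real_sqrt, rotated]) simp
  have "sqrt (1 + w\<^sup>2) \<noteq> 0" using q(1) by (simp only: q_def)
  from DERIV_divide[OF DERIV_ident d this, folded q_def]
  have "((\<lambda>w. w / sqrt (1 + w\<^sup>2)) has_real_derivative (1 * q - w * (inverse q / 2 * (2 * w))) / (q * q)) (at w)" .
  also have "1 * q - w * (inverse q / 2 * (2 * w)) = 1 / q"
    using q by (simp add: field_simps)
  also have "1 / q / (q * q) = 1 / q ^ 3"
    by (simp add: power3_eq_cube)
  finally show ?thesis by (simp add: q_def)
qed

lemma nn_integral_inverse_sqrt_3: "(\<integral>\<^sup>+w. ennreal (1 / sqrt (1 + w\<^sup>2) ^ 3) \<partial>lborel) = ennreal 2"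
proof -
  have "(\<integral>\<^sup>+w. ennreal (1 / sqrt (1 + w\<^sup>2) ^ 3) \<partial>lborel) = ennreal (1 - (-1))"
  proof (rule nn_integral_FTC_UNIV[OF _ DERIV_div_sqrt])
    show "((\<lambda>w::real. w / sqrt (1 + w\<^sup>2)) \<longlongrightarrow> -1) at_bot" by real_asymp
    show "((\<lambda>w::real. w / sqrt (1 + w\<^sup>2)) \<longlongrightarrow> 1) at_top" by real_asymp
  qed (auto simp: add_nonneg_nonneg)
  then show ?thesis by simp
qed

lemma nn_integral_inverse_sqrt_5: "(\<integral>\<^sup>+w. ennreal (1 / sqrt (1 + w\<^sup>2) ^ 5) \<partial>lborel) = ennreal (4/3)"
proof -
  \<comment> \<open>With \<open>w = tan \<theta>\<close> the integral is that of the cube of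
    \<open>cos \<theta>\<close>, whose primitive is \<open>sin \<theta>\<close> minus a third of its
    cube.\<close>
  let ?F = "\<lambda>w::real. w / sqrt (1 + w\<^sup>2) - (w / sqrt (1 + w\<^sup>2)) ^ 3 / 3"
  have "(\<integral>\<^sup>+w. ennreal (1 / sqrt (1 + w\<^sup>2) ^ 5) \<partial>lborel) = ennreal (2/3 - (-2/3))"
  proof (rule nn_integral_FTC_UNIV)
    fix w :: real
    have s: "sqrt (1 + w\<^sup>2) > 0" "sqrt (1 + w\<^sup>2) ^ 2 = 1 + w\<^sup>2" by auto
    have "(?F has_real_derivative (1 / sqrt (1 + w\<^sup>2) ^ 3
        - (of_nat 3 * (1 / sqrt (1 + w\<^sup>2) ^ 3 * (w / sqrt (1 + w\<^sup>2)) ^ (3 - Suc 0))) / 3)) (at w)"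
      by (intro DERIV_diff DERIV_cdivide DERIV_power DERIV_div_sqrt)
    also have "1 / sqrt (1 + w\<^sup>2) ^ 3
        - (of_nat 3 * (1 / sqrt (1 + w\<^sup>2) ^ 3 * (w / sqrt (1 + w\<^sup>2)) ^ (3 - Suc 0))) / 3
        = 1 / sqrt (1 + w\<^sup>2) ^ 3 * (1 - w\<^sup>2 / sqrt (1 + w\<^sup>2) ^ 2)"
      by (simp add: power_divide right_diff_distrib numeral_2_eq_2)
    also have "1 - w\<^sup>2 / sqrt (1 + w\<^sup>2) ^ 2 = 1 / sqrt (1 + w\<^sup>2) ^ 2"
      unfolding s(2) by (simp add: field_simps add_nonneg_eq_0_iff)
    also have "1 / sqrt (1 + w\<^sup>2) ^ 3 * \<dots> = 1 / sqrt (1 + w\<^sup>2) ^ 5"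
      by (simp add: power_add[symmetric] del: real_sqrt_pow2)
    finally show "(?F has_real_derivative 1 / sqrt (1 + w\<^sup>2) ^ 5) (at w)" .
    show "(?F \<longlongrightarrow> -2/3) at_bot" by real_asymp
    show "(?F \<longlongrightarrow> 2/3) at_top" by real_asymp
  qed (auto simp: add_nonneg_nonneg)
  then show ?thesis by simp
qed

text \<open>With \<open>w = tan \<theta>\<close> this is the primitive
  \<open>(\<theta> + sin \<theta> * cos \<theta>) / 2\<close> of the square of
  \<open>cos \<theta>\<close>.\<close>

lemma DERIV_arctan_rational:
  "((\<lambda>w. (arctan w + w / (1 + w\<^sup>2)) / 2) has_real_derivative 1 / (1 + w\<^sup>2)\<^sup>2) (at w)"
proof -
  have s: "1 + w\<^sup>2 > 0" "1 + w\<^sup>2 \<noteq> 0" by (auto simp: add_nonneg_eq_0_iff)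
  show ?thesis
    apply (rule derivative_eq_intros refl | simp add: s)+
    using s by (simp add: divide_simps power2_eq_square)
qed

lemma sqrt_one_plus_square_pow4: "sqrt (1 + (w::real)\<^sup>2) ^ 4 = (1 + w\<^sup>2)\<^sup>2"
proof -
  have "sqrt (1 + w\<^sup>2) ^ 4 = (sqrt (1 + w\<^sup>2) ^ 2) ^ 2" by (simp add: power_mult[symmetric] del: real_sqrt_pow2)
  then show ?thesis by simp
qed

lemma nn_integral_inverse_sqrt_4: "(\<integral>\<^sup>+w. ennreal (1 / sqrt (1 + w\<^sup>2) ^ 4) \<partial>lborel) = ennreal (pi/2)"
proof -
  have "(\<integral>\<^sup>+w. ennreal (1 / (1 + w\<^sup>2)\<^sup>2) \<partial>lborel) = ennreal (pi/4 - (-pi/4))"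
  proof (rule nn_integral_FTC_UNIV[OF _ DERIV_arctan_rational])
    show "((\<lambda>w::real. (arctan w + w / (1 + w\<^sup>2)) / 2) \<longlongrightarrow> -pi/4) at_bot" by real_asymp
    show "((\<lambda>w::real. (arctan w + w / (1 + w\<^sup>2)) / 2) \<longlongrightarrow> pi/4) at_top" by real_asymp
  qed auto
  then show ?thesis by (simp add: sqrt_one_plus_square_pow4)
qed

text \<open>The substitution \<open>s = sqrt p * w\<close> contributes one factor
  \<open>sqrt p\<close>, which lowers the exponent by one; hence the form with
  \<open>Suc k\<close>.\<close>

lemma nn_integral_inverse_sqrt_scaled:
  assumes p: "0 < p"
  shows "(\<integral>\<^sup>+s. ennreal (1 / sqrt (p + s\<^sup>2) ^ Suc k) \<partial>lborel)
    = ennreal (1 / sqrt p ^ k) * (\<integral>\<^sup>+w. ennreal (1 / sqrt (1 + w\<^sup>2) ^ Suc k) \<partial>lborel)"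
proof -
  have "(\<integral>\<^sup>+s. ennreal (1 / sqrt (p + s\<^sup>2) ^ Suc k) \<partial>lborel)
      = ennreal \<bar>sqrt p\<bar> * (\<integral>\<^sup>+w. ennreal (1 / sqrt (p + (0 + sqrt p * w)\<^sup>2) ^ Suc k) \<partial>lborel)"
    using p by (intro nn_integral_real_affine) auto
  also have "\<dots> = (\<integral>\<^sup>+w. ennreal (sqrt p) * ennreal (1 / sqrt (p + (sqrt p * w)\<^sup>2) ^ Suc k) \<partial>lborel)"
    using p by (simp add: nn_integral_cmult)
  also have "\<dots> = (\<integral>\<^sup>+w. ennreal (1 / sqrt p ^ k) * ennreal (1 / sqrt (1 + w\<^sup>2) ^ Suc k) \<partial>lborel)"
  proof (rule nn_integral_cong)
    fix w :: real
    have "p + (sqrt p * w)\<^sup>2 = p * (1 + w\<^sup>2)" using p by (simp add: power_mult_distrib algebra_simps)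
    then have "sqrt p * (1 / sqrt (p + (sqrt p * w)\<^sup>2) ^ Suc k) = 1 / sqrt p ^ k * (1 / sqrt (1 + w\<^sup>2) ^ Suc k)"
      using p by (simp add: real_sqrt_mult power_mult_distrib)
    then show "ennreal (sqrt p) * ennreal (1 / sqrt (p + (sqrt p * w)\<^sup>2) ^ Suc k)
       = ennreal (1 / sqrt p ^ k) * ennreal (1 / sqrt (1 + w\<^sup>2) ^ Suc k)"
      using p by (subst (1 2) ennreal_mult[symmetric]) (auto simp: add_nonneg_nonneg)
  qed
  also have "\<dots> = ennreal (1 / sqrt p ^ k) * (\<integral>\<^sup>+w. ennreal (1 / sqrt (1 + w\<^sup>2) ^ Suc k) \<partial>lborel)"
    by (rule nn_integral_cmult) auto
  finally show ?thesis .
qed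

text \<open>For \<open>\<rho> < 1\<close> put \<open>\<rho> = sin \<alpha>\<close> and
  \<open>t = tan \<theta>\<close>: the integrand becomes
  \<open>\<bar>sin (\<alpha> + \<theta>)\<bar> * cos \<theta>\<close>, and the angle
  \<open>arcsin \<rho>\<close> enters through its single change of sign at
  \<open>\<theta> = - \<alpha>\<close>.\<close>

lemma nn_integral_abs_linear:
  assumes "0 \<le> \<rho>" "\<rho> \<le> 1"
  shows "(\<integral>\<^sup>+t. ennreal (\<bar>\<rho> + sqrt (1 - \<rho>\<^sup>2) * t\<bar> / sqrt (1 + t\<^sup>2) ^ 4) \<partial>lborel)
    = ennreal (sqrt (1 - \<rho>\<^sup>2) + \<rho> * arcsin \<rho>)"
proof (cases "\<rho> = 1")
  case True
  then show ?thesis using nn_integral_inverse_sqrt_4 by simp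
next
  case False
  define \<sigma> where "\<sigma> = sqrt (1 - \<rho>\<^sup>2)"
  have r1: "\<rho> < 1" "\<rho>\<^sup>2 < 1" using False assms by (auto simp: power_less_one_iff)
  then have \<sigma>: "\<sigma> > 0" "\<sigma>\<^sup>2 = 1 - \<rho>\<^sup>2" by (auto simp: \<sigma>_def)
  define t0 where "t0 = - \<rho> / \<sigma>"
  \<comment> \<open>A primitive for the integrand without absolute value. Its limits at the two ends
    are opposite, so they cancel when the halves on either side of \<open>t0\<close> are added, and
    only \<open>- 2 * P t0\<close> is left.\<close>
  define P where "P t = \<rho> * ((arctan t + t / (1 + t\<^sup>2)) / 2) - \<sigma> / 2 * (1 / (1 + t\<^sup>2))" for t
  define f where "f t = \<bar>\<rho> + \<sigma> * t\<bar> / (1 + t\<^sup>2)\<^sup>2" for t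
  have t0: "1 + t0\<^sup>2 = 1 / \<sigma>\<^sup>2" using \<sigma>(1) \<sigma>(2) by (simp add: t0_def power_divide field_simps)
  have at: "arctan t0 = - arcsin \<rho>"
  proof -
    have "\<rho> / sqrt (1 - \<rho>\<^sup>2) = tan (arcsin \<rho>)" using assms r1 by (simp add: tan_def cos_arcsin)
    moreover have "- (pi/2) < arcsin \<rho>" "arcsin \<rho> < pi/2" using arcsin_lt_bounded[of \<rho>] assms r1 by auto
    ultimately have "arctan (\<rho> / \<sigma>) = arcsin \<rho>" by (simp add: \<sigma>_def arctan_tan)
    then show ?thesis unfolding t0_def by (simp add: arctan_minus)
  qed
  have P: "(P has_real_derivative (\<rho> + \<sigma> * t) / (1 + t\<^sup>2)\<^sup>2) (at t)" for t
  proof -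
    have s: "1 + t\<^sup>2 > 0" "1 + t\<^sup>2 \<noteq> 0" by (auto simp: add_nonneg_eq_0_iff)
    have "((\<lambda>t. 1 / (1 + t\<^sup>2)) has_real_derivative - (2 * t) / (1 + t\<^sup>2)\<^sup>2) (at t)"
      by (rule derivative_eq_intros refl | simp add: s)+ (use s in \<open>simp add: power2_eq_square\<close>)
    then have "(P has_real_derivative \<rho> * (1 / (1 + t\<^sup>2)\<^sup>2) - \<sigma> / 2 * (- (2 * t) / (1 + t\<^sup>2)\<^sup>2)) (at t)"
      unfolding P_def by (intro DERIV_diff DERIV_cmult DERIV_arctan_rational)
    then show ?thesis by (simp add: add_divide_distrib)
  qed
  have Pt0: "P t0 = - (\<sigma> + \<rho> * arcsin \<rho>) / 2"
  proof -
    have "\<sigma>\<^sup>2 + \<rho>\<^sup>2 = 1" using \<sigma> by simp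
    moreover have "P t0 = - (\<sigma> * (\<sigma>\<^sup>2 + \<rho>\<^sup>2) + \<rho> * arcsin \<rho>) / 2"
      unfolding P_def t0 at using \<sigma>(1) by (simp add: t0_def field_simps power2_eq_square)
    ultimately show ?thesis by simp
  qed
  have [measurable]: "f \<in> borel_measurable borel" unfolding f_def by measurable
  have lt: "(P \<longlongrightarrow> \<rho> * pi / 4) at_top" "(P \<longlongrightarrow> - \<rho> * pi / 4) at_bot"
    unfolding P_def by real_asymp+
  have "(\<integral>\<^sup>+t. ennreal (f t) * indicator {t0..} t \<partial>lborel) = ennreal (\<rho> * pi / 4 - P t0)"
  proof (rule nn_integral_FTC_atLeast[OF _ _ _ lt(1)])
    fix t assume "t0 \<le> t"
    then have "0 \<le> \<rho> + \<sigma> * t" using \<sigma>(1) by (simp add: t0_def field_simps)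
    then show "(P has_real_derivative f t) (at t)" using P[of t] by (simp add: f_def)
  qed (auto simp: f_def)
  moreover have "(\<integral>\<^sup>+t. ennreal (f t) * indicator {..t0} t \<partial>lborel) = ennreal (- P t0 - \<rho> * pi / 4)"
  proof -
    have "(\<integral>\<^sup>+t. ennreal (f t) * indicator {..t0} t \<partial>lborel) = ennreal ((\<lambda>t. - P t) t0 - (- (- \<rho> * pi / 4)))"
    proof (rule nn_integral_FTC_atMost[OF _ _ _ tendsto_minus[OF lt(2)]])
      fix t assume "t \<le> t0"
      then have "\<rho> + \<sigma> * t \<le> 0" using \<sigma>(1) by (simp add: t0_def field_simps)
      then show "((\<lambda>t. - P t) has_real_derivative f t) (at t)" using DERIV_minus[OF P[of t]] unfolding f_def
        by (simp only: abs_of_nonpos minus_divide_left)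
    qed (auto simp: f_def)
    then show ?thesis by simp
  qed
  \<comment> \<open>Each half is the \<open>ennreal\<close> of a difference; this bound and the next
    show that both differences are nonnegative, so that they add as reals.\<close>
  moreover have "P t0 \<le> \<rho> * pi / 4"
  proof -
    have "0 \<le> \<rho> * arcsin \<rho>" using assms by (simp add: arcsin_nonneg)
    moreover have "0 \<le> \<rho> * pi / 4" using assms by simp
    moreover have "P t0 \<le> 0" using calculation(1) \<sigma>(1) unfolding Pt0 by simp
    ultimately show ?thesis by linarith
  qed
  moreover have "\<rho> * pi / 4 \<le> - P t0"
  proof -
    have mono: "(\<lambda>t. - P t) t0 \<ge> \<rho> * pi / 4"
    proof (rule tendsto_upperbound)
      show "((\<lambda>t. - P t) \<longlongrightarrow> \<rho> * pi / 4) at_bot" using tendsto_minus[OF lt(2)] by simp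
      show "\<forall>\<^sub>F t in at_bot. - P t \<le> (\<lambda>t. - P t) t0"
        unfolding eventually_at_bot_linorder
      proof (intro exI[of _ t0] allI impI)
        fix t assume "t \<le> t0"
        then show "- P t \<le> (\<lambda>t. - P t) t0"
        proof (rule DERIV_nonneg_imp_nondecreasing)
          fix x assume "t \<le> x" "x \<le> t0"
          then have "\<rho> + \<sigma> * x \<le> 0" using \<sigma>(1) by (simp add: t0_def field_simps)
          then show "\<exists>y. ((\<lambda>t. - P t) has_real_derivative y) (at x) \<and> 0 \<le> y"
            using DERIV_minus[OF P[of x]]
            by (intro exI[of _ "- ((\<rho> + \<sigma> * x) / (1 + x\<^sup>2)\<^sup>2)"] conjI)
              (simp_all add: divide_nonpos_nonneg)
        qed
      qed
    qed simp
    then show ?thesis by simp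
  qed
  ultimately have "(\<integral>\<^sup>+t. ennreal (f t) \<partial>lborel) = ennreal (\<sigma> + \<rho> * arcsin \<rho>)"
    by (subst nn_integral_split_at[where a = t0]) (auto simp: ennreal_plus[symmetric] Pt0 add.commute simp del: ennreal_plus)
  then show ?thesis unfolding f_def \<sigma>_def sqrt_one_plus_square_pow4 .
qed

section \<open>Gnomonic coordinates\<close>

lemma nn_integral_power2_ball:
  assumes q: "0 < (q::real)"
  shows "(\<integral>\<^sup>+a. ennreal (a\<^sup>2) * indicator {a. a\<^sup>2 * q \<le> 1} a \<partial>lborel) = ennreal (2/3 * (1 / sqrt q ^ 3))"
proof -
  \<comment> \<open>With \<open>q = 1 + t\<^sup>2 + s\<^sup>2\<close> the values of \<open>a\<close>
    run over the part inside the unit ball of a line through the origin, and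
    \<open>a\<^sup>2\<close> is the Jacobian; the exponent 3/2 of the density arises here.\<close>
  define r where "r = 1 / sqrt q"
  have r: "r \<ge> 0" using q by (simp add: r_def)
  have "{a. a\<^sup>2 * q \<le> 1} = {-r..r}"
  proof -
    have "a\<^sup>2 * q \<le> 1 \<longleftrightarrow> \<bar>a\<bar> \<le> r" for a
    proof -
      have "a\<^sup>2 * q \<le> 1 \<longleftrightarrow> a\<^sup>2 \<le> r\<^sup>2" using q by (simp add: r_def power_divide field_simps)
      also have "\<dots> \<longleftrightarrow> \<bar>a\<bar> \<le> r" using r abs_le_square_iff[of a r] by simp
      finally show ?thesis .
    qed
    then have "{a. a\<^sup>2 * q \<le> 1} = {a. \<bar>a\<bar> \<le> r}" by (simp only:)
    also have "\<dots> = {-r..r}" by (auto simp: abs_le_iff)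
    finally show ?thesis .
  qed
  then have "(\<integral>\<^sup>+a. ennreal (a\<^sup>2) * indicator {a. a\<^sup>2 * q \<le> 1} a \<partial>lborel)
      = (\<integral>\<^sup>+a. ennreal (a\<^sup>2) * indicator {-r..r} a \<partial>lborel)" by simp
  also have "\<dots> = ennreal (r ^ 3 / 3 - (- r) ^ 3 / 3)"
  proof (rule nn_integral_FTC_Icc)
    show "((\<lambda>x. x ^ 3 / 3) has_real_derivative x\<^sup>2) (at x)" for x :: real
      by (rule derivative_eq_intros refl | simp)+
  qed (use r in auto)
  also have "r ^ 3 / 3 - (- r) ^ 3 / 3 = 2/3 * (1 / sqrt q ^ 3)"
    by (simp add: r_def power_divide power3_eq_cube)
  finally show ?thesis .
qed

lemma nn_integral_scale_both:
  fixes h :: "real \<Rightarrow> real \<Rightarrow> ennreal"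
  assumes [measurable]: "(\<lambda>(b, c). h b c) \<in> borel_measurable (borel \<Otimes>\<^sub>M borel)" and a: "a \<noteq> 0"
  shows "(\<integral>\<^sup>+b. \<integral>\<^sup>+c. h b c \<partial>lborel \<partial>lborel)
    = (\<integral>\<^sup>+t. \<integral>\<^sup>+s. ennreal (a\<^sup>2) * h (a * t) (a * s) \<partial>lborel \<partial>lborel)"
proof -
  have "(\<integral>\<^sup>+b. \<integral>\<^sup>+c. h b c \<partial>lborel \<partial>lborel)
      = ennreal \<bar>a\<bar> * (\<integral>\<^sup>+t. \<integral>\<^sup>+c. h (0 + a * t) c \<partial>lborel \<partial>lborel)"
    using a by (intro nn_integral_real_affine) measurable
  also have "\<dots> = ennreal \<bar>a\<bar> * (\<integral>\<^sup>+t. ennreal \<bar>a\<bar> * (\<integral>\<^sup>+s. h (0 + a * t) (0 + a * s) \<partial>lborel) \<partial>lborel)"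
    using a by (intro arg_cong2[where f = "(*)"] nn_integral_cong nn_integral_real_affine refl) measurable
  also have "\<dots> = (\<integral>\<^sup>+t. \<integral>\<^sup>+s. ennreal \<bar>a\<bar> * (ennreal \<bar>a\<bar> * h (a * t) (a * s)) \<partial>lborel \<partial>lborel)"
    by (simp add: nn_integral_cmult)
  also have "\<dots> = (\<integral>\<^sup>+t. \<integral>\<^sup>+s. ennreal (a\<^sup>2) * h (a * t) (a * s) \<partial>lborel \<partial>lborel)"
    by (simp add: mult.assoc[symmetric] ennreal_mult[symmetric] power2_eq_square)
  finally show ?thesis .
qed

text \<open>The hypothesis on \<open>G\<close> covers both signs of \<open>a\<close>, so it
  expresses evenness together with homogeneity of degree 0. Then the plane alone carries the whole
  integral; the slice \<open>a = 0\<close> is null.\<close>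

lemma nn_integral_gnomonic:
  fixes \<phi> :: "real \<Rightarrow> real \<Rightarrow> ennreal" and G :: "real^3 \<Rightarrow> ennreal"
  assumes \<phi> [measurable]: "(\<lambda>(t, s). \<phi> t s) \<in> borel_measurable (borel \<Otimes>\<^sub>M borel)"
    and G [measurable]: "G \<in> borel_measurable borel"
    and f: "orthonormal_frame e1 e2 e3"
    and eq: "\<And>a t s. a \<noteq> 0 \<Longrightarrow> G (a *\<^sub>R e1 + (a * t) *\<^sub>R e2 + (a * s) *\<^sub>R e3) = \<phi> t s"
  shows "(\<integral>\<^sup>+x. G x * indicator (cball 0 1) x \<partial>lborel)
    = (\<integral>\<^sup>+t. \<integral>\<^sup>+s. \<phi> t s * ennreal (2/3 * (1 / sqrt (1 + t\<^sup>2 + s\<^sup>2) ^ 3)) \<partial>lborel \<partial>lborel)"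
proof -
  define B where "B = {(a::real, q::real). a\<^sup>2 * q \<le> 1}"
  have C [measurable]: "(cball 0 1 :: (real^3) set) \<in> sets borel" by simp
  have B [measurable]: "B \<in> sets (borel \<Otimes>\<^sub>M borel)"
    unfolding B_def borel_prod by (intro borel_closed closed_Collect_le continuous_intros) (auto simp: case_prod_beta' intro!: closed_Collect_le continuous_intros)
  have "(\<integral>\<^sup>+x. G x * indicator (cball 0 1) x \<partial>lborel)
    = (\<integral>\<^sup>+a. \<integral>\<^sup>+b. \<integral>\<^sup>+c. G (a *\<^sub>R e1 + b *\<^sub>R e2 + c *\<^sub>R e3) *
          indicator (cball 0 1) (a *\<^sub>R e1 + b *\<^sub>R e2 + c *\<^sub>R e3) \<partial>lborel \<partial>lborel \<partial>lborel)"
    by (rule nn_integral_frame[OF _ f]) measurable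
  also have "\<dots> = (\<integral>\<^sup>+a. \<integral>\<^sup>+t. \<integral>\<^sup>+s. ennreal (a\<^sup>2) * (\<phi> t s * indicator B (a, 1 + t\<^sup>2 + s\<^sup>2)) \<partial>lborel \<partial>lborel \<partial>lborel)"
  proof (rule nn_integral_cong_AE, rule eventually_mono[OF AE_lborel_singleton[of 0]])
    fix a :: real assume a: "a \<noteq> 0"
    have ind: "indicator (cball 0 1) (a *\<^sub>R e1 + (a * t) *\<^sub>R e2 + (a * s) *\<^sub>R e3) = (indicator B (a, 1 + t\<^sup>2 + s\<^sup>2) :: ennreal)" for t s
    proof -
      have "a\<^sup>2 + (a * t)\<^sup>2 + (a * s)\<^sup>2 = a\<^sup>2 * (1 + t\<^sup>2 + s\<^sup>2)"
        by (simp add: power_mult_distrib algebra_simps)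
      then show ?thesis by (simp add: indicator_def B_def norm_frame_combination[OF f])
    qed
    show "(\<integral>\<^sup>+b. \<integral>\<^sup>+c. G (a *\<^sub>R e1 + b *\<^sub>R e2 + c *\<^sub>R e3) *
          indicator (cball 0 1) (a *\<^sub>R e1 + b *\<^sub>R e2 + c *\<^sub>R e3) \<partial>lborel \<partial>lborel)
        = (\<integral>\<^sup>+t. \<integral>\<^sup>+s. ennreal (a\<^sup>2) * (\<phi> t s * indicator B (a, 1 + t\<^sup>2 + s\<^sup>2)) \<partial>lborel \<partial>lborel)"
      by (subst nn_integral_scale_both[OF _ a]) (measurable, simp only: eq[OF a] ind)
  qed
  \<comment> \<open>The radial variable \<open>a\<close> moves innermost, where its integral is
    elementary.\<close>
  also have "\<dots> = (\<integral>\<^sup>+t. \<integral>\<^sup>+a. \<integral>\<^sup>+s. ennreal (a\<^sup>2) * (\<phi> t s * indicator B (a, 1 + t\<^sup>2 + s\<^sup>2)) \<partial>lborel \<partial>lborel \<partial>lborel)"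
    by (rule lborel_pair.Fubini') measurable
  also have "\<dots> = (\<integral>\<^sup>+t. \<integral>\<^sup>+s. \<integral>\<^sup>+a. ennreal (a\<^sup>2) * (\<phi> t s * indicator B (a, 1 + t\<^sup>2 + s\<^sup>2)) \<partial>lborel \<partial>lborel \<partial>lborel)"
    by (rule nn_integral_cong, rule lborel_pair.Fubini') measurable
  also have "\<dots> = (\<integral>\<^sup>+t. \<integral>\<^sup>+s. \<phi> t s * ennreal (2/3 * (1 / sqrt (1 + t\<^sup>2 + s\<^sup>2) ^ 3)) \<partial>lborel \<partial>lborel)"
  proof (intro nn_integral_cong)
    fix t s :: real
    have q: "0 < 1 + t\<^sup>2 + s\<^sup>2" by (simp add: add_pos_nonneg)
    have "(\<integral>\<^sup>+a. ennreal (a\<^sup>2) * (\<phi> t s * indicator B (a, 1 + t\<^sup>2 + s\<^sup>2)) \<partial>lborel)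
        = (\<integral>\<^sup>+a. \<phi> t s * (ennreal (a\<^sup>2) * indicator {a. a\<^sup>2 * (1 + t\<^sup>2 + s\<^sup>2) \<le> 1} a) \<partial>lborel)"
      by (intro nn_integral_cong) (auto simp: indicator_def B_def ac_simps)
    also have "\<dots> = \<phi> t s * (\<integral>\<^sup>+a. ennreal (a\<^sup>2) * indicator {a. a\<^sup>2 * (1 + t\<^sup>2 + s\<^sup>2) \<le> 1} a \<partial>lborel)"
      by (rule nn_integral_cmult) measurable
    finally show "(\<integral>\<^sup>+a. ennreal (a\<^sup>2) * (\<phi> t s * indicator B (a, 1 + t\<^sup>2 + s\<^sup>2)) \<partial>lborel)
        = \<phi> t s * ennreal (2/3 * (1 / sqrt (1 + t\<^sup>2 + s\<^sup>2) ^ 3))"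
      by (simp only: nn_integral_power2_ball[OF q])
  qed
  finally show ?thesis .
qed

section \<open>Moments of the uniform direction\<close>

lemma sgn_borel_measurable [measurable]: "(sgn :: real^3 \<Rightarrow> real^3) \<in> borel_measurable borel"
  unfolding sgn_div_norm by measurable

lemma nn_integral_sphere_law:
  assumes [measurable]: "f \<in> borel_measurable borel"
  shows "(\<integral>\<^sup>+u. f u \<partial>sphere_law) = (\<integral>\<^sup>+x. f (sgn x) * indicator (cball 0 1) x \<partial>lborel) / ennreal (4/3 * pi)"
proof -
  have "emeasure lborel (cball 0 1 :: (real^3) set) = ennreal (4/3 * pi)"
    by (simp add: emeasure_cball unit_ball_vol_3)
  then show ?thesis
    unfolding sphere_law_def by (simp add: nn_integral_distr nn_integral_uniform_measure)
qed

lemma space_sphere_law [simp]: "space sphere_law = UNIV"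
  and sets_sphere_law [simp, measurable_cong]: "sets sphere_law = sets borel"
  by (auto simp: sphere_law_def)

lemma sgn_frame_inner:
  assumes f: "orthonormal_frame e1 e2 e3" and "a \<noteq> 0"
  shows "\<bar>sgn (a *\<^sub>R e1 + (a * t) *\<^sub>R e2 + (a * s) *\<^sub>R e3) \<bullet> (c *\<^sub>R e1 + d *\<^sub>R e2)\<bar>
    = \<bar>c + d * t\<bar> / sqrt (1 + t\<^sup>2 + s\<^sup>2)"
proof -
  have "a\<^sup>2 + (a * t)\<^sup>2 + (a * s)\<^sup>2 = a\<^sup>2 * (1 + t\<^sup>2 + s\<^sup>2)"
    by (simp add: power_mult_distrib algebra_simps)
  then have n: "norm (a *\<^sub>R e1 + (a * t) *\<^sub>R e2 + (a * s) *\<^sub>R e3) = \<bar>a\<bar> * sqrt (1 + t\<^sup>2 + s\<^sup>2)"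
    by (simp add: norm_frame_combination[OF f] real_sqrt_mult)
  have i: "(a *\<^sub>R e1 + (a * t) *\<^sub>R e2 + (a * s) *\<^sub>R e3) \<bullet> (c *\<^sub>R e1 + d *\<^sub>R e2) = a * (c + d * t)"
    unfolding inner_add_right inner_scaleR_right inner_frame_combination[OF f] by (simp add: algebra_simps)
  have "\<bar>sgn (a *\<^sub>R e1 + (a * t) *\<^sub>R e2 + (a * s) *\<^sub>R e3) \<bullet> (c *\<^sub>R e1 + d *\<^sub>R e2)\<bar>
      = (\<bar>a\<bar> * \<bar>c + d * t\<bar>) / (\<bar>a\<bar> * sqrt (1 + t\<^sup>2 + s\<^sup>2))"
    unfolding sgn_div_norm inner_scaleR_left i n abs_mult[symmetric] by (simp add: abs_mult divide_inverse mult_ac)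
  then show ?thesis using \<open>a \<noteq> 0\<close> by simp
qed

text \<open>By Archimedes a coordinate of a uniform direction is uniform on \<open>{-1..1}\<close>,
  which explains the value; the computation is the gnomonic integral with one factor in place of
  two.\<close>

lemma nn_integral_sphere_law_abs_inner:
  assumes "norm n = 1"
  shows "(\<integral>\<^sup>+u. ennreal \<bar>u \<bullet> n\<bar> \<partial>sphere_law) = ennreal (1/2)"
proof -
  obtain e2 e3 where f: "orthonormal_frame n e2 e3"
    using exists_orthonormal_frame[OF assms] by (metis orthonormal_frame_def inner_commute)
  have "(\<integral>\<^sup>+x. ennreal \<bar>sgn x \<bullet> n\<bar> * indicator (cball 0 1) x \<partial>lborel)
      = (\<integral>\<^sup>+t. \<integral>\<^sup>+s. ennreal (1 / sqrt (1 + t\<^sup>2 + s\<^sup>2)) * ennreal (2/3 * (1 / sqrt (1 + t\<^sup>2 + s\<^sup>2) ^ 3)) \<partial>lborel \<partial>lborel)"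
    by (rule nn_integral_gnomonic[OF _ _ f]) (use sgn_frame_inner[OF f, of _ _ _ 1 0] in auto)
  also have "\<dots> = (\<integral>\<^sup>+t. \<integral>\<^sup>+s. ennreal (2/3) * ennreal (1 / sqrt ((1 + t\<^sup>2) + s\<^sup>2) ^ Suc 3) \<partial>lborel \<partial>lborel)"
    by (intro nn_integral_cong, subst (1 2) ennreal_mult[symmetric]) (auto simp: mult_ac power_Suc[symmetric] simp del: power_Suc)
  also have "\<dots> = (\<integral>\<^sup>+t. ennreal (2/3) * (ennreal (1 / sqrt (1 + t\<^sup>2) ^ 3) * ennreal (pi/2)) \<partial>lborel)"
  proof (intro nn_integral_cong)
    fix t :: real
    have "Suc 3 = 4" by simp
    then show "(\<integral>\<^sup>+s. ennreal (2/3) * ennreal (1 / sqrt ((1 + t\<^sup>2) + s\<^sup>2) ^ Suc 3) \<partial>lborel)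
        = ennreal (2/3) * (ennreal (1 / sqrt (1 + t\<^sup>2) ^ 3) * ennreal (pi/2))"
      using nn_integral_inverse_sqrt_scaled[OF one_plus_square_pos[of t], of 3]
      by (subst nn_integral_cmult, measurable) (simp only: nn_integral_inverse_sqrt_4)
  qed
  also have "\<dots> = ennreal (2/3) * (ennreal 2 * ennreal (pi/2))"
    by (subst nn_integral_cmult, measurable, subst nn_integral_multc, measurable) (simp only: nn_integral_inverse_sqrt_3)
  also have "ennreal 2 * ennreal (pi/2) = ennreal pi"
    by (subst ennreal_mult[symmetric]) auto
  also have "ennreal (2/3) * ennreal pi = ennreal (2/3 * pi)"
    by (rule ennreal_mult[symmetric]) auto
  finally show ?thesis
    by (subst nn_integral_sphere_law) (auto simp: divide_ennreal)
qed

lemma nn_integral_sphere_law_abs_inner_pair: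
  assumes n1: "norm n1 = 1" and n2: "norm n2 = 1"
  defines "\<rho> \<equiv> \<bar>n1 \<bullet> n2\<bar>"
  shows "(\<integral>\<^sup>+u. ennreal (\<bar>u \<bullet> n1\<bar> * \<bar>u \<bullet> n2\<bar>) \<partial>sphere_law)
    = ennreal (2 / (3 * pi) * (sqrt (1 - \<rho>\<^sup>2) + \<rho> * arcsin \<rho>))"
proof -
  \<comment> \<open>Passing from \<open>n2\<close> to its antipode changes no absolute value and
    makes the inner product with \<open>n1\<close> equal to \<open>\<rho>\<close>.\<close>
  define m where "m = (if n1 \<bullet> n2 \<ge> 0 then n2 else - n2)"
  have m: "norm m = 1" "n1 \<bullet> m = \<rho>" "\<bar>u \<bullet> m\<bar> = \<bar>u \<bullet> n2\<bar>" for u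
    using n2 by (auto simp: m_def \<rho>_def)
  have \<rho>: "0 \<le> \<rho>" "\<rho> \<le> 1"
    using Cauchy_Schwarz_ineq2[of n1 n2] n1 n2 by (auto simp: \<rho>_def)
  define \<sigma> where "\<sigma> = sqrt (1 - \<rho>\<^sup>2)"
  have "\<rho>\<^sup>2 \<le> 1" using \<rho> by (simp add: power_le_one)
  then have \<sigma>: "0 \<le> \<sigma>" "\<sigma>\<^sup>2 = 1 - \<rho>\<^sup>2" by (auto simp: \<sigma>_def)
  have rest: "(norm (m - \<rho> *\<^sub>R n1))\<^sup>2 = \<sigma>\<^sup>2"
    using m n1 unfolding power2_norm_eq_inner \<sigma>(2)
    by (simp add: inner_diff inner_commute norm_eq_1 power2_eq_square)
  obtain e2 e3 where f: "orthonormal_frame n1 e2 e3" and me: "m = \<rho> *\<^sub>R n1 + \<sigma> *\<^sub>R e2"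
  proof (cases "\<sigma> = 0")
    \<comment> \<open>Now \<open>m\<close> is a multiple of \<open>n1\<close>, and any completion of
      \<open>n1\<close> to a frame serves.\<close>
    case True
    obtain e2 e3 where f: "orthonormal_frame n1 e2 e3"
      using exists_orthonormal_frame[OF n1] by (metis orthonormal_frame_def inner_commute)
    show ?thesis by (rule that[OF f]) (use rest True in simp)
  next
    case False
    define e2 where "e2 = (1 / \<sigma>) *\<^sub>R (m - \<rho> *\<^sub>R n1)"
    have "norm (m - \<rho> *\<^sub>R n1) = \<sigma>" using rest \<sigma>(1) by (simp add: power2_eq_iff_nonneg)
    then have "norm e2 = 1" using \<sigma>(1) False by (simp add: e2_def)
    moreover have "n1 \<bullet> e2 = 0" using m n1 by (simp add: e2_def inner_diff_right norm_eq_1)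
    ultimately have "orthonormal_frame n1 e2 (cross3 n1 e2)" by (intro orthonormal_frame_cross3 n1)
    then show ?thesis by (rule that) (use False in \<open>simp add: e2_def\<close>)
  qed
  have eq: "ennreal (\<bar>sgn (a *\<^sub>R n1 + (a * t) *\<^sub>R e2 + (a * s) *\<^sub>R e3) \<bullet> n1\<bar> *
      \<bar>sgn (a *\<^sub>R n1 + (a * t) *\<^sub>R e2 + (a * s) *\<^sub>R e3) \<bullet> n2\<bar>) = ennreal (\<bar>\<rho> + \<sigma> * t\<bar> * (1 / sqrt (1 + t\<^sup>2 + s\<^sup>2) ^ 2))"
    if "a \<noteq> 0" for a t s
    using sgn_frame_inner[OF f that, of t s 1 0] sgn_frame_inner[OF f that, of t s \<rho> \<sigma>]
    unfolding m(3)[symmetric] me by (simp add: power2_eq_square)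
  have J: "(\<integral>\<^sup>+x. ennreal (\<bar>sgn x \<bullet> n1\<bar> * \<bar>sgn x \<bullet> n2\<bar>) * indicator (cball 0 1) x \<partial>lborel)
      = (\<integral>\<^sup>+t. \<integral>\<^sup>+s. ennreal (\<bar>\<rho> + \<sigma> * t\<bar> * (1 / sqrt (1 + t\<^sup>2 + s\<^sup>2) ^ 2)) *
            ennreal (2/3 * (1 / sqrt (1 + t\<^sup>2 + s\<^sup>2) ^ 3)) \<partial>lborel \<partial>lborel)"
    by (rule nn_integral_gnomonic[OF _ _ f]) (measurable, rule eq)
  also have "\<dots> = (\<integral>\<^sup>+t. \<integral>\<^sup>+s. ennreal (2/3 * \<bar>\<rho> + \<sigma> * t\<bar>) * ennreal (1 / sqrt ((1 + t\<^sup>2) + s\<^sup>2) ^ Suc 4) \<partial>lborel \<partial>lborel)"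
  proof (intro nn_integral_cong)
    fix t s :: real
    have "x * (1 / y ^ 2) * (2/3 * (1 / y ^ 3)) = 2/3 * x * (1 / y ^ Suc 4)" for x y :: real
      by (simp add: power_add[symmetric] eval_nat_numeral)
    then show "ennreal (\<bar>\<rho> + \<sigma> * t\<bar> * (1 / sqrt (1 + t\<^sup>2 + s\<^sup>2) ^ 2)) * ennreal (2/3 * (1 / sqrt (1 + t\<^sup>2 + s\<^sup>2) ^ 3))
      = ennreal (2/3 * \<bar>\<rho> + \<sigma> * t\<bar>) * ennreal (1 / sqrt ((1 + t\<^sup>2) + s\<^sup>2) ^ Suc 4)"
      by (subst (1 2) ennreal_mult[symmetric]) (auto simp del: real_sqrt_pow2 power_Suc)
  qed
  also have "\<dots> = (\<integral>\<^sup>+t. ennreal (2/3 * \<bar>\<rho> + \<sigma> * t\<bar>) * (ennreal (1 / sqrt (1 + t\<^sup>2) ^ 4) * ennreal (4/3)) \<partial>lborel)"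
  proof (intro nn_integral_cong)
    fix t :: real
    have "Suc 4 = 5" by simp
    then show "(\<integral>\<^sup>+s. ennreal (2/3 * \<bar>\<rho> + \<sigma> * t\<bar>) * ennreal (1 / sqrt ((1 + t\<^sup>2) + s\<^sup>2) ^ Suc 4) \<partial>lborel)
        = ennreal (2/3 * \<bar>\<rho> + \<sigma> * t\<bar>) * (ennreal (1 / sqrt (1 + t\<^sup>2) ^ 4) * ennreal (4/3))"
      using nn_integral_inverse_sqrt_scaled[OF one_plus_square_pos[of t], of 4]
      by (subst nn_integral_cmult, measurable) (simp only: nn_integral_inverse_sqrt_5)
  qed
  \<comment> \<open>8/9 is 2/3 from the radial integral times 4/3 from the integral over
    \<open>s\<close>; division by the volume \<open>4/3 * pi\<close> of the ball leaves
    \<open>2 / (3 * pi)\<close>.\<close>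
  also have "\<dots> = (\<integral>\<^sup>+t. ennreal (8/9) * ennreal (\<bar>\<rho> + \<sigma> * t\<bar> / sqrt (1 + t\<^sup>2) ^ 4) \<partial>lborel)"
    by (intro nn_integral_cong) (simp add: ennreal_mult[symmetric] mult.assoc[symmetric] del: real_sqrt_pow2)
  also have "\<dots> = ennreal (8/9) * ennreal (\<sigma> + \<rho> * arcsin \<rho>)"
    unfolding \<sigma>_def by (subst nn_integral_cmult, measurable) (simp only: nn_integral_abs_linear[OF \<rho>])
  also have "\<dots> = ennreal (8/9 * (\<sigma> + \<rho> * arcsin \<rho>))"
    using \<sigma> \<rho> by (intro ennreal_mult[symmetric]) (auto simp: arcsin_nonneg)
  finally have ball: "(\<integral>\<^sup>+x. ennreal (\<bar>sgn x \<bullet> n1\<bar> * \<bar>sgn x \<bullet> n2\<bar>) * indicator (cball 0 1) x \<partial>lborel)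
      = ennreal (8/9 * (\<sigma> + \<rho> * arcsin \<rho>))" .
  have "(\<integral>\<^sup>+u. ennreal (\<bar>u \<bullet> n1\<bar> * \<bar>u \<bullet> n2\<bar>) \<partial>sphere_law)
      = ennreal (8/9 * (\<sigma> + \<rho> * arcsin \<rho>)) / ennreal (4/3 * pi)"
    by (subst nn_integral_sphere_law, measurable, simp only: ball)
  also have "\<dots> = ennreal (8/9 * (\<sigma> + \<rho> * arcsin \<rho>) / (4/3 * pi))"
    using \<sigma> \<rho> by (intro divide_ennreal) (auto simp: arcsin_nonneg)
  also have "8/9 * (\<sigma> + \<rho> * arcsin \<rho>) / (4/3 * pi) = 2 / (3 * pi) * (sqrt (1 - \<rho>\<^sup>2) + \<rho> * arcsin \<rho>)"
    by (simp add: \<sigma>_def field_simps)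
  finally show ?thesis .
qed

lemma integral_sphere_law_abs_inner_pair:
  assumes "norm n1 = 1" "norm n2 = 1"
  shows "(\<integral>u. \<bar>u \<bullet> n1\<bar> * \<bar>u \<bullet> n2\<bar> \<partial>sphere_law)
    = 2 / (3 * pi) * (sqrt (1 - \<bar>n1 \<bullet> n2\<bar>\<^sup>2) + \<bar>n1 \<bullet> n2\<bar> * arcsin \<bar>n1 \<bullet> n2\<bar>)"
proof -
  have "\<bar>n1 \<bullet> n2\<bar> \<le> 1" using Cauchy_Schwarz_ineq2[of n1 n2] assms by simp
  then have "0 \<le> 2 / (3 * pi) * (sqrt (1 - \<bar>n1 \<bullet> n2\<bar>\<^sup>2) + \<bar>n1 \<bullet> n2\<bar> * arcsin \<bar>n1 \<bullet> n2\<bar>)"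
    by (intro mult_nonneg_nonneg add_nonneg_nonneg arcsin_nonneg) (auto simp: abs_square_le_1)
  then show ?thesis
    using nn_integral_sphere_law_abs_inner_pair[OF assms] by (subst (asm) nn_integral_eq_integrable) auto
qed

lemma integral_sphere_law_abs_inner:
  assumes "norm n = 1"
  shows "(\<integral>u. \<bar>u \<bullet> n\<bar> \<partial>sphere_law) = 1/2"
  using nn_integral_sphere_law_abs_inner[OF assms] by (subst (asm) nn_integral_eq_integrable) auto

section \<open>Closed form, derivative and range of \<open>I2\<close>\<close>

definition arcsin_primitive :: "real \<Rightarrow> real" where
  "arcsin_primitive \<rho> = sqrt (1 - \<rho>\<^sup>2) + \<rho> * arcsin \<rho>"

text \<open>A definite description has a determined value only if some pair of unit vectors realizes
  \<open>\<rho>\<close>; the range of \<open>\<rho>\<close> guarantees such a pair.\<close>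

lemma I2_eq:
  assumes "\<rho> \<in> {0..1}"
  shows "I2 \<rho> = 2 / (3 * pi) * arcsin_primitive \<rho>"
  unfolding I2_def
proof (rule the_equality)
  show "\<forall>n1\<in>sphere 0 1. \<forall>n2\<in>sphere 0 1. \<bar>n1 \<bullet> n2\<bar> = \<rho> \<longrightarrow>
      (\<integral>u. \<bar>u \<bullet> n1\<bar> * \<bar>u \<bullet> n2\<bar> \<partial>sphere_law) = 2 / (3 * pi) * arcsin_primitive \<rho>"
    by (auto simp: integral_sphere_law_abs_inner_pair arcsin_primitive_def)
next
  fix r assume r: "\<forall>n1\<in>sphere 0 1. \<forall>n2\<in>sphere 0 1. \<bar>n1 \<bullet> n2\<bar> = \<rho> \<longrightarrow>
      (\<integral>u. \<bar>u \<bullet> n1\<bar> * \<bar>u \<bullet> n2\<bar> \<partial>sphere_law) = r"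
  have f: "orthonormal_frame (axis 1 1) (axis 2 1) (axis 3 1)"
    by (simp add: orthonormal_frame_def inner_axis_axis)
  define n2 where "n2 = \<rho> *\<^sub>R axis 1 1 + sqrt (1 - \<rho>\<^sup>2) *\<^sub>R axis 2 1 + 0 *\<^sub>R (axis 3 1 :: real^3)"
  have "\<rho>\<^sup>2 \<le> 1" using assms by (simp add: power_le_one)
  then have "norm n2 = 1" unfolding n2_def norm_frame_combination[OF f] by simp
  moreover have "axis 1 1 \<bullet> n2 = \<rho>"
    unfolding n2_def inner_commute[of "axis 1 1"] inner_frame_combination[OF f] ..
  moreover have "norm (axis 1 1 :: real^3) = 1" by simp
  ultimately show "r = 2 / (3 * pi) * arcsin_primitive \<rho>"
    using r assms integral_sphere_law_abs_inner_pair[of "axis 1 1" n2]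
    by (auto simp: arcsin_primitive_def)
qed

lemma continuous_on_arcsin_primitive: "continuous_on {0..1} arcsin_primitive"
  unfolding arcsin_primitive_def by (intro continuous_intros) auto

lemma DERIV_arcsin_primitive:
  assumes "0 < \<rho>" "\<rho> < 1"
  shows "(arcsin_primitive has_real_derivative arcsin \<rho>) (at \<rho>)"
proof -
  have r: "\<rho>\<^sup>2 < 1" using assms by (simp add: power_less_one_iff)
  have "((\<lambda>\<rho>. 1 - \<rho>\<^sup>2) has_real_derivative - (2 * \<rho>)) (at \<rho>)"
    by (rule derivative_eq_intros refl | simp)+
  then have "((\<lambda>\<rho>. sqrt (1 - \<rho>\<^sup>2)) has_real_derivative inverse (sqrt (1 - \<rho>\<^sup>2)) / 2 * (- (2 * \<rho>))) (at \<rho>)"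
    by (rule DERIV_chain2[OF DERIV_real_sqrt, rotated]) (use r in simp)
  moreover have "((\<lambda>\<rho>. \<rho> * arcsin \<rho>) has_real_derivative 1 * arcsin \<rho> + inverse (sqrt (1 - \<rho>\<^sup>2)) * \<rho>) (at \<rho>)"
    by (intro DERIV_mult DERIV_ident DERIV_arcsin) (use assms in auto)
  ultimately have "(arcsin_primitive has_real_derivative
      inverse (sqrt (1 - \<rho>\<^sup>2)) / 2 * (- (2 * \<rho>)) + (1 * arcsin \<rho> + inverse (sqrt (1 - \<rho>\<^sup>2)) * \<rho>)) (at \<rho>)"
    unfolding arcsin_primitive_def by (rule DERIV_add)
  then show ?thesis by simp
qed

text \<open>The summands fail to be differentiable at 1, so they cannot be treated separately. As an
  integral of the continuous function \<open>arcsin\<close> the sum has its one-sided derivatives at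
  both ends; the added 1 is \<open>arcsin_primitive 0\<close>.\<close>

lemma DERIV_within_arcsin_primitive:
  assumes "\<rho> \<in> {0..1}"
  shows "(arcsin_primitive has_real_derivative arcsin \<rho>) (at \<rho> within {0..1})"
proof -
  have *: "1 + integral {0..x} arcsin = arcsin_primitive x" if "x \<in> {0..1}" for x
  proof -
    have "(arcsin has_integral arcsin_primitive x - arcsin_primitive 0) {0..x}"
    proof (rule fundamental_theorem_of_calculus_interior)
      show "continuous_on {0..x} arcsin_primitive"
        using continuous_on_arcsin_primitive by (rule continuous_on_subset) (use that in auto)
    qed (use that in \<open>auto simp: has_real_derivative_iff_has_vector_derivative[symmetric] intro!: DERIV_arcsin_primitive\<close>)
    then show ?thesis by (auto dest: integral_unique simp: arcsin_primitive_def)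
  qed
  have "((\<lambda>x. integral {0..x} arcsin) has_real_derivative arcsin \<rho>) (at \<rho> within {0..1})"
    using continuous_on_arcsin[OF continuous_on_id, of "{0..1}"]
    by (intro integral_has_real_derivative assms) simp
  then have "((\<lambda>x. 1 + integral {0..x} arcsin) has_real_derivative 0 + arcsin \<rho>) (at \<rho> within {0..1})"
    by (intro DERIV_add DERIV_const)
  then show ?thesis
    using has_field_derivative_transform_within[of _ _ \<rho> "{0..1}" 1 arcsin_primitive] assms * by auto
qed

lemma strict_mono_on_arcsin_primitive: "strict_mono_on {0..1} arcsin_primitive"
proof (rule strict_mono_onI)
  fix r s :: real assume rs: "r \<in> {0..1}" "s \<in> {0..1}" "r < s"
  show "arcsin_primitive r < arcsin_primitive s"
  proof (rule DERIV_pos_imp_increasing_open[OF rs(3)])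
    fix x assume "r < x" "x < s"
    then have "0 < x" "x < 1" using rs by simp_all
    moreover from this have "0 < arcsin x" using arcsin_less_arcsin[of 0 x] by simp
    ultimately show "\<exists>y. (arcsin_primitive has_real_derivative y) (at x) \<and> 0 < y"
      using DERIV_arcsin_primitive by blast
  next
    have "{r..s} \<subseteq> {0..1}" using rs by simp
    then show "continuous_on {r..s} arcsin_primitive"
      by (rule continuous_on_subset[OF continuous_on_arcsin_primitive])
  qed
qed

lemma DERIV_within_I2:
  assumes "\<rho> \<in> {0..1}"
  shows "(I2 has_real_derivative 2 / (3 * pi) * arcsin \<rho>) (at \<rho> within {0..1})"
proof -
  have "((\<lambda>\<rho>. 2 / (3 * pi) * arcsin_primitive \<rho>) has_real_derivative 2 / (3 * pi) * arcsin \<rho>) (at \<rho> within {0..1})"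
    by (intro DERIV_cmult DERIV_within_arcsin_primitive assms)
  then show ?thesis
    by (rule has_field_derivative_transform_within[OF _ zero_less_one assms]) (simp add: I2_eq)
qed

lemma strict_mono_on_I2: "strict_mono_on {0..1} I2"
proof (rule strict_mono_onI)
  fix r s :: real assume "r \<in> {0..1}" "s \<in> {0..1}" "r < s"
  then have "arcsin_primitive r < arcsin_primitive s"
    using strict_mono_on_arcsin_primitive by (rule strict_mono_onD[rotated])
  then show "I2 r < I2 s" unfolding I2_eq[OF \<open>r \<in> _\<close>] I2_eq[OF \<open>s \<in> _\<close>]
    by (intro mult_strict_left_mono) auto
qed

lemma I2_0: "I2 0 = 2 / (3 * pi)" and I2_1: "I2 1 = 1/3"
  by (simp_all add: I2_eq arcsin_primitive_def)

lemma bij_betw_I2: "bij_betw I2 {0..1} {2 / (3 * pi)..1/3}"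
  unfolding bij_betw_def
proof
  show "inj_on I2 {0..1}" by (rule strict_mono_on_imp_inj_on[OF strict_mono_on_I2])
  have mono: "I2 r \<le> I2 s" if "0 \<le> r" "r \<le> s" "s \<le> 1" for r s
    using strict_mono_on_leD[OF strict_mono_on_I2, of r s] that by auto
  have "continuous_on {0..1} I2"
    unfolding continuous_on_eq_continuous_within by (blast intro: DERIV_continuous DERIV_within_I2)
  then have "\<exists>x. 0 \<le> x \<and> x \<le> 1 \<and> I2 x = y" if "y \<in> {2 / (3 * pi)..1/3}" for y
    using that by (intro IVT') (auto simp: I2_0 I2_1)
  then have "{2 / (3 * pi)..1/3} \<subseteq> I2 ` {0..1}" by (metis atLeastAtMost_iff image_eqI subsetI)
  moreover have "I2 ` {0..1} \<subseteq> {2 / (3 * pi)..1/3}"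
    using mono[of 0] mono[of _ 1] by (auto simp: I2_0 I2_1)
  ultimately show "I2 ` {0..1} = {2 / (3 * pi)..1/3}" by auto
qed

text \<open>Orthogonal directions are negatively correlated; numerically this says
  \<open>pi > 8/3\<close>.\<close>

lemma k2_0_neg: "k2 0 < 0"
proof -
  have "2 / (3 * pi) < 1/4" using pi_gt3 by (simp add: field_simps)
  then show ?thesis by (simp add: k2_def I2_0)
qed

section \<open>Variances\<close>

locale uniform_direction = prob_space M for M :: "'a measure" +
  fixes U :: "'a \<Rightarrow> real^3"
  assumes uniform: "uniform_on_sphere M U"
begin

lemma measurable_restrict_direction: "U \<in> M \<rightarrow>\<^sub>M restrict_space borel (sphere 0 1)"
  using uniform by (simp add: uniform_on_sphere_def)

lemma measurable_direction [measurable]: "U \<in> M \<rightarrow>\<^sub>M borel"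
  using measurable_restrict_direction by (simp add: measurable_restrict_space2_iff)

lemma distr_direction: "distr M borel U = sphere_law"
  using uniform by (simp add: uniform_on_sphere_def)

lemma norm_direction: "x \<in> space M \<Longrightarrow> norm (U x) = 1"
  using measurable_space[OF measurable_restrict_direction, of x] by (simp add: space_restrict_space)

lemma expectation_abs_inner_pair:
  assumes "norm n1 = 1" "norm n2 = 1"
  shows "expectation (\<lambda>x. \<bar>U x \<bullet> n1\<bar> * \<bar>U x \<bullet> n2\<bar>) = I2 \<bar>n1 \<bullet> n2\<bar>"
proof -
  have "\<bar>n1 \<bullet> n2\<bar> \<in> {0..1}" using Cauchy_Schwarz_ineq2[of n1 n2] assms by simp
  have "expectation (\<lambda>x. \<bar>U x \<bullet> n1\<bar> * \<bar>U x \<bullet> n2\<bar>) = (\<integral>u. \<bar>u \<bullet> n1\<bar> * \<bar>u \<bullet> n2\<bar> \<partial>distr M borel U)"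
    by (rule integral_distr[symmetric]) measurable
  then show ?thesis
    unfolding distr_direction integral_sphere_law_abs_inner_pair[OF assms] I2_eq[OF \<open>_ \<in> _\<close>] arcsin_primitive_def .
qed

lemma expectation_abs_inner:
  assumes "norm n = 1"
  shows "expectation (\<lambda>x. \<bar>U x \<bullet> n\<bar>) = 1/2"
proof -
  have "expectation (\<lambda>x. \<bar>U x \<bullet> n\<bar>) = (\<integral>u. \<bar>u \<bullet> n\<bar> \<partial>distr M borel U)"
    by (rule integral_distr[symmetric]) measurable
  then show ?thesis
    unfolding distr_direction integral_sphere_law_abs_inner[OF assms] .
qed

lemma abs_inner_direction_le:
  assumes "norm n = 1" "x \<in> space M"
  shows "\<bar>U x \<bullet> n\<bar> \<le> 1"
  using Cauchy_Schwarz_ineq2[of "U x" n] norm_direction[OF assms(2)] assms(1) by simp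

lemma integrable_abs_inner:
  assumes "norm n = 1"
  shows "integrable M (\<lambda>x. \<bar>U x \<bullet> n\<bar>)"
  by (rule integrable_const_bound[where B = 1]) (auto intro!: AE_I2 abs_inner_direction_le[OF assms])

lemma integrable_abs_inner_pair:
  assumes "norm n1 = 1" "norm n2 = 1"
  shows "integrable M (\<lambda>x. \<bar>U x \<bullet> n1\<bar> * \<bar>U x \<bullet> n2\<bar>)"
  by (rule integrable_const_bound[where B = 1])
    (auto intro!: AE_I2 mult_le_one abs_inner_direction_le assms simp: abs_mult)

lemma covariance_abs_inner:
  assumes "norm n1 = 1" "norm n2 = 1"
  shows "integrable M (\<lambda>x. (\<bar>U x \<bullet> n1\<bar> - 1/2) * (\<bar>U x \<bullet> n2\<bar> - 1/2))" (is ?i)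
    and "expectation (\<lambda>x. (\<bar>U x \<bullet> n1\<bar> - 1/2) * (\<bar>U x \<bullet> n2\<bar> - 1/2)) = k2 \<bar>n1 \<bullet> n2\<bar>" (is ?e)
proof -
  have *: "(\<lambda>x. (\<bar>U x \<bullet> n1\<bar> - 1/2) * (\<bar>U x \<bullet> n2\<bar> - 1/2))
    = (\<lambda>x. \<bar>U x \<bullet> n1\<bar> * \<bar>U x \<bullet> n2\<bar> - 1/2 * \<bar>U x \<bullet> n1\<bar> - 1/2 * \<bar>U x \<bullet> n2\<bar> + 1/4)"
    by (auto simp: algebra_simps)
  note i = integrable_abs_inner[OF assms(1)] integrable_abs_inner[OF assms(2)] integrable_abs_inner_pair[OF assms]
  show ?i unfolding * by (intro Bochner_Integration.integrable_add Bochner_Integration.integrable_diff integrable_mult_right i integrable_const)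
  show ?e unfolding *
    using i by (simp add: k2_def expectation_abs_inner_pair[OF assms] expectation_abs_inner assms prob_space)
qed

text \<open>Serves twice: its nonnegativity is the positive semidefiniteness of \<open>k2\<close>,
  and half the facet areas as weights give the polytope formula.\<close>

lemma variance_weighted_sum:
  assumes "finite S" "\<And>s. s \<in> S \<Longrightarrow> norm (n s) = 1"
  shows "variance (\<lambda>x. \<Sum>s\<in>S. c s * \<bar>U x \<bullet> n s\<bar>) = (\<Sum>s\<in>S. \<Sum>t\<in>S. c s * c t * k2 \<bar>n s \<bullet> n t\<bar>)"
proof -
  have "expectation (\<lambda>x. \<Sum>s\<in>S. c s * \<bar>U x \<bullet> n s\<bar>) = (\<Sum>s\<in>S. c s * (1/2))"
    using assms(2) by (subst Bochner_Integration.integral_sum)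
      (auto intro!: integrable_mult_right integrable_abs_inner sum.cong simp: expectation_abs_inner)
  then have "variance (\<lambda>x. \<Sum>s\<in>S. c s * \<bar>U x \<bullet> n s\<bar>)
      = expectation (\<lambda>x. (\<Sum>s\<in>S. c s * (\<bar>U x \<bullet> n s\<bar> - 1/2))\<^sup>2)"
    by (simp add: right_diff_distrib sum_subtractf)
  also have "\<dots> = expectation (\<lambda>x. \<Sum>s\<in>S. \<Sum>t\<in>S. c s * c t * ((\<bar>U x \<bullet> n s\<bar> - 1/2) * (\<bar>U x \<bullet> n t\<bar> - 1/2)))"
    by (simp add: power2_eq_square sum_product mult_ac)
  also have "\<dots> = (\<Sum>s\<in>S. \<Sum>t\<in>S. c s * c t * k2 \<bar>n s \<bullet> n t\<bar>)"
    using assms(2) covariance_abs_inner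
    by (simp add: Bochner_Integration.integral_sum integrable_mult_right Bochner_Integration.integrable_sum)
  finally show ?thesis .
qed

text \<open>Common to the width with its generating measure and to twice the brightness with the
  surface area measure. All integrands are bounded and all measures finite, which justifies each
  exchange of integrals.\<close>

lemma variance_generated:
  assumes \<mu>: "finite_sphere_measure \<mu>"
    and f: "\<And>u. norm u = 1 \<Longrightarrow> f u = (\<integral>n. \<bar>u \<bullet> n\<bar> \<partial>\<mu>)"
  shows "variance (\<lambda>x. f (U x)) = (\<integral>n. (\<integral>n'. k2 \<bar>n \<bullet> n'\<bar> \<partial>\<mu>) \<partial>\<mu>)"
proof -
  interpret \<mu>: finite_measure \<mu> using \<mu> by (simp add: finite_sphere_measure_def)
  have s [measurable_cong]: "sets \<mu> = sets (restrict_space borel (sphere 0 1))"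
    using \<mu> by (simp add: finite_sphere_measure_def)
  then have sp: "n \<in> space \<mu> \<Longrightarrow> norm n = 1" for n
    using sets_eq_imp_space_eq[OF s] by (simp add: space_restrict_space)
  interpret P: pair_sigma_finite M \<mu> ..
  interpret F: finite_measure "M \<Otimes>\<^sub>M \<mu>"
    by (intro finite_measure_pair_measure) unfold_locales
  have [measurable]: "(\<lambda>n. n) \<in> \<mu> \<rightarrow>\<^sub>M borel"
    unfolding measurable_cong_sets[OF s refl] by (rule measurable_restrict_space1) simp
  \<comment> \<open>Centring before the integration makes \<open>A\<close> the deviation of
    \<open>f (U x)\<close> from its mean, so the variance is the second moment of
    \<open>A\<close>.\<close>
  define a where "a x n = \<bar>U x \<bullet> n\<bar> - 1/2" for x n
  have a_meas [measurable]: "(\<lambda>(x, n). a x n) \<in> borel_measurable (M \<Otimes>\<^sub>M \<mu>)"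
    unfolding a_def by measurable
  have a_meas' [measurable]: "(\<lambda>x. a x n) \<in> borel_measurable M" for n
    unfolding a_def by measurable
  have a_le: "\<bar>a x n\<bar> \<le> 1" if "x \<in> space M" "n \<in> space \<mu>" for x n
    using abs_inner_direction_le[OF sp[OF that(2)] that(1)] by (simp add: a_def)
  define A where "A x = (\<integral>n. a x n \<partial>\<mu>)" for x
  have A_meas [measurable]: "A \<in> borel_measurable M"
    unfolding A_def by (rule \<mu>.borel_measurable_lebesgue_integral) simp
  define m where "m = measure \<mu> (space \<mu>)"
  have ia: "integrable \<mu> (a x)" if "x \<in> space M" for x
    by (rule \<mu>.integrable_const_bound[where B = 1]) (auto intro!: AE_I2 simp: a_le that)
  have A_le: "\<bar>A x\<bar> \<le> m" if "x \<in> space M" for x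
  proof -
    have "\<bar>A x\<bar> \<le> (\<integral>n. \<bar>a x n\<bar> \<partial>\<mu>)" unfolding A_def by (rule integral_abs_bound)
    also have "\<dots> \<le> (\<integral>n. 1 \<partial>\<mu>)"
      using that by (intro integral_mono integrable_abs ia a_le) auto
    finally show ?thesis by (simp add: m_def)
  qed
  have fA: "f (U x) = A x + m / 2" if x: "x \<in> space M" for x
  proof -
    have "integrable \<mu> (\<lambda>n. a x n + 1/2)" using ia[OF x] by (intro Bochner_Integration.integrable_add) auto
    then have "A x + m / 2 = (\<integral>n. a x n + 1/2 \<partial>\<mu>)"
      using ia[OF x] by (simp add: A_def m_def)
    also have "\<dots> = f (U x)" by (simp add: a_def f[OF norm_direction[OF x]])
    finally show ?thesis by simp
  qed
  have iA: "integrable M A"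
    using A_le by (intro integrable_const_bound[where B = m]) (auto intro!: AE_I2)
  have i1: "integrable (M \<Otimes>\<^sub>M \<mu>) (\<lambda>(x, n). a x n)"
    by (rule F.integrable_const_bound[where B = 1]) (auto intro!: AE_I2 simp: space_pair_measure a_le)
  have EA: "expectation A = 0"
  proof -
    have "expectation A = (\<integral>n. expectation (\<lambda>x. a x n) \<partial>\<mu>)"
      unfolding A_def by (rule P.Fubini_integral[OF i1, symmetric])
    also have "\<dots> = (\<integral>n. 0 \<partial>\<mu>)"
      by (intro Bochner_Integration.integral_cong refl)
        (simp add: a_def integrable_abs_inner sp expectation_abs_inner prob_space)
    finally show ?thesis by simp
  qed
  have Ef: "expectation (\<lambda>x. f (U x)) = m / 2"
  proof -
    have "expectation (\<lambda>x. f (U x)) = expectation (\<lambda>x. A x + m / 2)"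
      by (intro Bochner_Integration.integral_cong refl fA)
    also have "\<dots> = m / 2" using iA by (simp add: EA prob_space)
    finally show ?thesis .
  qed
  \<comment> \<open>The square of \<open>A\<close> is opened one factor at a time: first a swap with
    \<open>A x\<close> kept whole, then a second swap for each fixed \<open>n\<close>.\<close>
  have i2: "integrable (M \<Otimes>\<^sub>M \<mu>) (\<lambda>(x, n). A x * a x n)"
  proof (rule F.integrable_const_bound[where B = m])
    show "AE y in M \<Otimes>\<^sub>M \<mu>. norm (case y of (x, n) \<Rightarrow> A x * a x n) \<le> m"
    proof (rule AE_I2, clarsimp simp: space_pair_measure abs_mult)
      fix x n assume "x \<in> space M" "n \<in> space \<mu>"
      then show "\<bar>A x\<bar> * \<bar>a x n\<bar> \<le> m"
        using mult_mono[OF A_le a_le] by (simp add: m_def)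
    qed
  qed measurable
  have i3: "integrable (M \<Otimes>\<^sub>M \<mu>) (\<lambda>(x, n'). a x n * a x n')" if n: "n \<in> space \<mu>" for n
    by (rule F.integrable_const_bound[where B = 1])
      (auto intro!: AE_I2 mult_le_one simp: space_pair_measure a_le n abs_mult)
  have "variance (\<lambda>x. f (U x)) = expectation (\<lambda>x. (A x)\<^sup>2)"
    unfolding Ef by (intro Bochner_Integration.integral_cong refl) (simp add: fA)
  also have "\<dots> = expectation (\<lambda>x. \<integral>n. A x * a x n \<partial>\<mu>)"
    by (intro Bochner_Integration.integral_cong refl) (simp add: power2_eq_square A_def)
  also have "\<dots> = (\<integral>n. expectation (\<lambda>x. A x * a x n) \<partial>\<mu>)"
    by (rule P.Fubini_integral[OF i2, symmetric])
  also have "\<dots> = (\<integral>n. expectation (\<lambda>x. \<integral>n'. a x n * a x n' \<partial>\<mu>) \<partial>\<mu>)"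
    by (intro Bochner_Integration.integral_cong refl) (simp add: A_def mult.commute)
  also have "\<dots> = (\<integral>n. (\<integral>n'. expectation (\<lambda>x. a x n * a x n') \<partial>\<mu>) \<partial>\<mu>)"
    by (intro Bochner_Integration.integral_cong refl P.Fubini_integral[OF i3, symmetric])
  also have "\<dots> = (\<integral>n. (\<integral>n'. k2 \<bar>n \<bullet> n'\<bar> \<partial>\<mu>) \<partial>\<mu>)"
    unfolding a_def by (intro Bochner_Integration.integral_cong refl covariance_abs_inner sp)
  finally show ?thesis .
qed

end

section \<open>Zero variance and constancy\<close>

lemma emeasure_sphere_law_ball_pos:
  assumes u: "norm u = 1" and \<delta>: "0 < \<delta>"
  shows "emeasure sphere_law (ball u \<delta>) > 0"
proof -
  \<comment> \<open>The open cone over the cap, cut off by the unit ball. It contains half of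
    \<open>u\<close>, and a nonempty open set is not null.\<close>
  define S :: "(real^3) set" where "S = (- {0} \<inter> sgn -` ball u \<delta>) \<inter> ball 0 1"
  have "continuous_on (- {0}) (sgn :: real^3 \<Rightarrow> real^3)"
    by (intro continuous_on_sgn continuous_intros) auto
  then have "open (- {0} \<inter> sgn -` ball u \<delta> :: (real^3) set)"
    by (rule continuous_open_preimage) (simp_all only: open_ball open_Compl closed_singleton)
  then have "open S" unfolding S_def by (rule open_Int[OF _ open_ball])
  moreover have "(1/2) *\<^sub>R u \<in> S"
    using u \<delta> by (auto simp: S_def sgn_div_norm)
  ultimately have "\<not> negligible S" by (auto dest: open_not_negligible)
  then have "emeasure lborel S \<noteq> 0"
    using \<open>open S\<close> by (auto simp: negligible_iff_emeasure0 borel_open)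
  moreover have "emeasure lborel S \<le> (\<integral>\<^sup>+x. indicator (ball u \<delta>) (sgn x) * indicator (cball 0 1) x \<partial>lborel)"
  proof -
    have "emeasure lborel S = (\<integral>\<^sup>+x. indicator S x \<partial>lborel)"
      using \<open>open S\<close> by (simp add: borel_open)
    also have "\<dots> \<le> (\<integral>\<^sup>+x. indicator (ball u \<delta>) (sgn x) * indicator (cball 0 1) x \<partial>lborel)"
      by (intro nn_integral_mono) (auto simp: S_def indicator_def)
    finally show ?thesis .
  qed
  ultimately have "(\<integral>\<^sup>+x. indicator (ball u \<delta>) (sgn x) * indicator (cball 0 1) x \<partial>lborel) > 0"
    by (metis le_zero_eq not_gr_zero)
  then have "(\<integral>\<^sup>+x. indicator (ball u \<delta>) x \<partial>sphere_law) > 0"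
    by (subst nn_integral_sphere_law) (auto simp: ennreal_zero_less_divide intro!: borel_measurable_indicator)
  then show ?thesis by simp
qed

context uniform_direction
begin

text \<open>Zero variance gives constancy only almost surely. A value different from the mean would
  persist near \<open>u\<close> by continuity, and every ball around \<open>u\<close> has positive
  probability. Continuity on the sphere also yields measurability, since \<open>U\<close> maps into
  the restricted space.\<close>

lemma variance_eq_0_iff_constant:
  fixes f :: "real^3 \<Rightarrow> real"
  assumes f: "continuous_on (sphere 0 1) f"
  shows "variance (\<lambda>x. f (U x)) = 0 \<longleftrightarrow> (\<exists>c. \<forall>u\<in>sphere 0 1. f u = c)"
proof
  assume "\<exists>c. \<forall>u\<in>sphere 0 1. f u = c"
  then obtain c where c: "\<And>u. norm u = 1 \<Longrightarrow> f u = c" by auto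
  have "expectation (\<lambda>x. f (U x)) = expectation (\<lambda>x. c)"
    by (intro Bochner_Integration.integral_cong refl c norm_direction)
  also have "\<dots> = c" by (simp add: prob_space)
  finally have "expectation (\<lambda>x. f (U x)) = c" .
  then have "variance (\<lambda>x. f (U x)) = expectation (\<lambda>x. (f (U x) - c)\<^sup>2)" by simp
  also have "\<dots> = expectation (\<lambda>x. 0)"
    by (intro Bochner_Integration.integral_cong refl) (simp add: c norm_direction)
  finally show "variance (\<lambda>x. f (U x)) = 0" by simp
next
  assume v: "variance (\<lambda>x. f (U x)) = 0"
  define m where "m = expectation (\<lambda>x. f (U x))"
  have [measurable]: "(\<lambda>x. f (U x)) \<in> borel_measurable M"
    by (rule measurable_compose[OF measurable_restrict_direction borel_measurable_continuous_on_restrict[OF f]])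
  have "bounded (f ` sphere 0 1)"
    by (intro compact_imp_bounded compact_continuous_image f compact_sphere)
  then obtain B where "\<forall>y\<in>f ` sphere 0 1. norm y \<le> B" unfolding bounded_iff by blast
  then have B: "\<bar>f u\<bar> \<le> B" if "norm u = 1" for u using that by auto
  have "integrable M (\<lambda>x. (f (U x) - m)\<^sup>2)"
  proof (rule integrable_const_bound[where B = "(B + \<bar>m\<bar>)\<^sup>2"])
    show "AE x in M. norm ((f (U x) - m)\<^sup>2) \<le> (B + \<bar>m\<bar>)\<^sup>2"
    proof (rule AE_I2)
      fix x assume "x \<in> space M"
      then have "\<bar>f (U x) - m\<bar> \<le> B + \<bar>m\<bar>" using B[OF norm_direction, of x] by linarith
      then show "norm ((f (U x) - m)\<^sup>2) \<le> (B + \<bar>m\<bar>)\<^sup>2" by (simp add: abs_le_square_iff[symmetric])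
    qed
  qed measurable
  then have AE: "AE x in M. f (U x) = m"
    using v integral_nonneg_eq_0_iff_AE[of M "\<lambda>x. (f (U x) - m)\<^sup>2"] by (simp add: m_def)
  have "f u = m" if u: "norm u = 1" for u
  proof (rule ccontr)
    assume "f u \<noteq> m"
    then have "0 < dist (f u) m" by simp
    moreover have "u \<in> sphere 0 1" using u by simp
    ultimately obtain \<delta> where \<delta>: "\<delta> > 0" "\<And>v. v \<in> sphere 0 1 \<Longrightarrow> dist v u < \<delta> \<Longrightarrow> dist (f v) (f u) < dist (f u) m"
      using f unfolding continuous_on_iff by metis
    have "AE x in M. U x \<notin> ball u \<delta>"
      using AE
    proof (rule AE_mp, intro AE_I2 impI notI)
      fix x assume "x \<in> space M" "f (U x) = m" "U x \<in> ball u \<delta>"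
      then show False using \<delta>(2)[of "U x"] norm_direction[of x] by (auto simp: dist_commute)
    qed
    then have "AE v in distr M borel U. v \<notin> ball u \<delta>"
      by (subst AE_distr_iff) auto
    then have "emeasure sphere_law (ball u \<delta>) = 0"
      unfolding distr_direction by (subst (asm) AE_iff_measurable[of "ball u \<delta>"]) auto
    then show False using emeasure_sphere_law_ball_pos[OF u \<delta>(1)] by simp
  qed
  then show "\<exists>c. \<forall>u\<in>sphere 0 1. f u = c" by auto
qed

section \<open>The kernel on unoriented directions\<close>

lemma k2_kernel_pair:
  "k2_kernel {n, - n} {n', - n'} = k2 \<bar>n \<bullet> n'\<bar>"
proof -
  have "(\<lambda>(n, n'). k2 \<bar>n \<bullet> n'\<bar>) ` ({n, - n} \<times> {n', - n'}) = {k2 \<bar>n \<bullet> n'\<bar>}" by auto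
  then show ?thesis by (simp add: k2_kernel_def)
qed

text \<open>A representative \<open>r d\<close> of each direction lets the quadratic form be read as
  the variance of a weighted sum of the \<open>\<bar>U \<bullet> r d\<bar>\<close>; this is why a
  statement free of \<open>U\<close> is proved inside the locale.\<close>

lemma psd_k2_kernel: "psd_kernel_on unoriented_directions k2_kernel"
proof -
  have "\<exists>n. norm n = 1 \<and> d = {n, - n}" if "d \<in> unoriented_directions" for d
    using that by (auto simp: unoriented_directions_def)
  then obtain r where r: "\<And>d. d \<in> unoriented_directions \<Longrightarrow> norm (r d) = 1"
      "\<And>d. d \<in> unoriented_directions \<Longrightarrow> d = {r d, - r d}" by metis
  have k: "k2_kernel d d' = k2 \<bar>r d \<bullet> r d'\<bar>" if "d \<in> unoriented_directions" "d' \<in> unoriented_directions" for d d'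
    using k2_kernel_pair[of "r d" "r d'"] r(2)[OF that(1)] r(2)[OF that(2)] by simp
  show ?thesis
    unfolding psd_kernel_on_def
  proof (intro conjI ballI allI impI)
    fix d d' assume "d \<in> unoriented_directions" "d' \<in> unoriented_directions"
    then show "k2_kernel d d' = k2_kernel d' d" by (simp add: k inner_commute)
  next
    fix S c assume S: "finite S \<and> S \<subseteq> unoriented_directions"
    have "0 \<le> variance (\<lambda>x. \<Sum>d\<in>S. c d * \<bar>U x \<bullet> r d\<bar>)" by (rule variance_positive)
    also have "\<dots> = (\<Sum>d\<in>S. \<Sum>d'\<in>S. c d * c d' * k2 \<bar>r d \<bullet> r d'\<bar>)"
      using S r(1) by (intro variance_weighted_sum) auto
    also have "\<dots> = (\<Sum>d\<in>S. \<Sum>d'\<in>S. c d * c d' * k2_kernel d d')"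
      using S by (intro sum.cong refl) (auto simp: k subset_iff)
    finally show "0 \<le> (\<Sum>d\<in>S. \<Sum>d'\<in>S. c d * c d' * k2_kernel d d')" .
  qed
qed

end

lemma k2_kernel_takes_negative_value:
  "\<exists>d\<in>unoriented_directions. \<exists>d'\<in>unoriented_directions. k2_kernel d d' < 0"
proof -
  have "{axis 1 1, - axis 1 1} \<in> unoriented_directions" "{axis 2 1, - axis 2 1} \<in> unoriented_directions"
    by (auto simp: unoriented_directions_def)
  moreover have "k2_kernel {axis 1 1, - axis 1 1} {axis 2 1, - axis 2 1} < 0"
  proof -
    have "(\<lambda>(n, n'). k2 \<bar>n \<bullet> n'\<bar>) ` ({axis 1 1, - axis 1 1} \<times> {axis 2 1, - axis 2 1 :: real^3}) = {k2 0}"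
      by (auto simp: inner_axis_axis)
    then show ?thesis by (simp add: k2_kernel_def k2_0_neg)
  qed
  ultimately show ?thesis by blast
qed

section \<open>Support functions and zonoids\<close>

lemma bdd_above_inner_image: "bounded K \<Longrightarrow> bdd_above ((\<lambda>x. u \<bullet> x) ` K)"
  by (intro bounded_imp_bdd_above bounded_linear_image bounded_linear_inner_right)

lemma inner_le_support_fun: "bounded K \<Longrightarrow> x \<in> K \<Longrightarrow> u \<bullet> x \<le> support_fun K u"
  unfolding support_fun_def by (intro cSUP_upper bdd_above_inner_image)

lemma support_fun_leI: "K \<noteq> {} \<Longrightarrow> (\<And>x. x \<in> K \<Longrightarrow> u \<bullet> x \<le> B) \<Longrightarrow> support_fun K u \<le> B"
  unfolding support_fun_def by (intro cSUP_least)

text \<open>A bound \<open>B\<close> for the norms in \<open>K\<close> is a Lipschitz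
  constant.\<close>

lemma continuous_on_support_fun:
  assumes K: "bounded K" "K \<noteq> {}"
  shows "continuous_on S (support_fun K)"
proof -
  obtain B where B: "\<And>x. x \<in> K \<Longrightarrow> norm x \<le> B" using K(1) by (auto simp: bounded_iff)
  have le: "support_fun K u \<le> support_fun K v + B * norm (u - v)" for u v
  proof (rule support_fun_leI[OF K(2)])
    fix x assume x: "x \<in> K"
    have "u \<bullet> x = v \<bullet> x + (u - v) \<bullet> x" by (simp add: inner_diff_left)
    also have "(u - v) \<bullet> x \<le> norm (u - v) * norm x" by (rule norm_cauchy_schwarz)
    also have "\<dots> \<le> B * norm (u - v)" using B[OF x] by (subst mult.commute) (intro mult_right_mono, auto)
    finally show "u \<bullet> x \<le> support_fun K v + B * norm (u - v)"
      using inner_le_support_fun[OF K(1) x, of v] by linarith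
  qed
  have "0 \<le> B" using K(2) B by (metis all_not_in_conv norm_ge_zero order_trans)
  then have "B-lipschitz_on S (support_fun K)"
  proof (intro lipschitz_onI)
    fix u v
    show "dist (support_fun K u) (support_fun K v) \<le> B * dist u v"
      using le[of u v] le[of v u] by (simp add: dist_real_def dist_norm abs_le_iff norm_minus_commute)
  qed
  then show ?thesis by (rule lipschitz_on_continuous_on)
qed

lemma continuous_on_width:
  assumes "bounded K" "K \<noteq> {}"
  shows "continuous_on S (width K)"
  unfolding width_def
  by (intro continuous_intros continuous_on_support_fun[OF assms]
      continuous_on_compose2[OF continuous_on_support_fun[OF assms, of UNIV]]) auto

text \<open>Turns Hausdorff closeness of bodies into closeness of support functions, uniformly on
  the sphere.\<close>

lemma support_fun_minkowski_cball:
  assumes "A \<noteq> {}" "bounded P" "A \<subseteq> P + cball 0 \<epsilon>"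
  shows "support_fun A u \<le> support_fun P u + \<epsilon> * norm u"
proof (rule support_fun_leI[OF assms(1)])
  fix x assume "x \<in> A"
  then obtain p y where x: "x = p + y" "p \<in> P" "norm y \<le> \<epsilon>"
    using assms(3) by (auto elim!: set_plus_elim dest!: subsetD)
  have "u \<bullet> y \<le> norm u * norm y" by (rule norm_cauchy_schwarz)
  also have "\<dots> \<le> \<epsilon> * norm u" using x by (subst mult.commute) (intro mult_right_mono, auto)
  finally show "u \<bullet> x \<le> support_fun P u + \<epsilon> * norm u"
    using inner_le_support_fun[OF assms(2) x(2), of u] by (simp add: x(1) inner_add_right)
qed

section \<open>Central symmetry of zonotopes and zonoids\<close>

lemma zonotope_centrally_symmetric:
  assumes "zonotope P"
  shows "P \<noteq> {} \<and> bounded P \<and> (\<exists>c. \<forall>x\<in>P. c - x \<in> P)"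
proof -
  obtain m :: nat and a b where P: "P = (\<Sum>i<m. closed_segment (a i) (b i))"
    using assms by (auto simp: zonotope_def)
  show ?thesis unfolding P
  proof (induction m)
    case 0
    show ?case by (auto simp: set_zero)
  next
    case (Suc m)
    let ?A = "\<Sum>i<m. closed_segment (a i) (b i)" and ?B = "closed_segment (a m) (b m)"
    \<comment> \<open>\<open>c\<close> stands for twice the centre; a further segment adds the sum
      \<open>a m + b m\<close> of its endpoints.\<close>
    obtain c where c: "\<forall>x\<in>?A. c - x \<in> ?A" using Suc by blast
    have B: "a m + b m - y \<in> ?B" if "y \<in> ?B" for y
    proof -
      obtain t where t: "0 \<le> t" "t \<le> 1" "y = (1 - t) *\<^sub>R a m + t *\<^sub>R b m"
        using \<open>y \<in> ?B\<close> unfolding in_segment by blast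
      have "a m + b m - y = (1 - (1 - t)) *\<^sub>R a m + (1 - t) *\<^sub>R b m"
        unfolding t(3) by (simp add: scaleR_diff_left)
      then show ?thesis
        using t(1,2) by (intro in_segment(1)[THEN iffD2] exI[of _ "1 - t"] conjI) simp_all
    qed
    have "c + (a m + b m) - z \<in> ?A + ?B" if "z \<in> ?A + ?B" for z
    proof -
      obtain x y where "z = x + y" "x \<in> ?A" "y \<in> ?B"
        using \<open>z \<in> ?A + ?B\<close> by (rule set_plus_elim)
      then have "(c - x) + (a m + b m - y) \<in> ?A + ?B" using c B by (intro set_plus_intro) auto
      then show ?thesis using \<open>z = x + y\<close> by (simp add: algebra_simps)
    qed
    moreover have "bounded (?A + ?B)"
      unfolding set_plus_image using Suc by (intro bounded_plus bounded_closed_segment) blast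
    moreover have "?A + ?B \<noteq> {}"
      unfolding set_plus_image using Suc ends_in_segment(1)[of "a m" "b m"] by blast
    ultimately show ?case unfolding sum.lessThan_Suc by blast
  qed
qed

lemma support_fun_symmetric:
  assumes "P \<noteq> {}" "bounded P" "\<forall>x\<in>P. c - x \<in> P"
  shows "support_fun P u - support_fun P (- u) = c \<bullet> u"
proof -
  have "support_fun P v \<le> support_fun P (- v) + c \<bullet> v" for v
  proof (rule support_fun_leI[OF assms(1)])
    fix x assume "x \<in> P"
    then have "(- v) \<bullet> (c - x) \<le> support_fun P (- v)"
      using assms by (intro inner_le_support_fun) auto
    then show "v \<bullet> x \<le> support_fun P (- v) + c \<bullet> v"
      by (simp add: inner_diff_right inner_commute)
  qed
  from this[of u] this[of "- u"] show ?thesis by simp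
qed

text \<open>The vectors \<open>c\<close> of the approximating zonotopes vary with \<epsilon> and are
  never passed to a limit. Each of them shows \<open>D\<close> to be linear up to an error of order
  \<epsilon>; so \<open>D\<close> is linear, and the adjoint applied to 1 is the vector representing
  it.\<close>

lemma zonoid_support_fun_odd_part:
  assumes Z: "zonoid Z"
  shows "\<exists>c. \<forall>u. support_fun Z u - support_fun Z (- u) = c \<bullet> u"
proof -
  define D where "D u = support_fun Z u - support_fun Z (- u)" for u
  have Zc: "compact Z" "Z \<noteq> {}" using Z by (auto simp: zonoid_def convex_body_def)
  have approx: "\<exists>c. \<forall>u. \<bar>D u - c \<bullet> u\<bar> \<le> 2 * \<epsilon> * norm u" if "\<epsilon> > 0" for \<epsilon>
  proof -
    obtain P where P: "zonotope P" "Z \<subseteq> P + cball 0 \<epsilon>" "P \<subseteq> Z + cball 0 \<epsilon>"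
      using Z \<open>\<epsilon> > 0\<close> by (auto simp: zonoid_def)
    obtain c where c: "P \<noteq> {}" "bounded P" "\<forall>x\<in>P. c - x \<in> P"
      using zonotope_centrally_symmetric[OF P(1)] by auto
    have h: "support_fun Z u \<le> support_fun P u + \<epsilon> * norm u" "support_fun P u \<le> support_fun Z u + \<epsilon> * norm u" for u
      using support_fun_minkowski_cball[OF Zc(2) c(2) P(2)]
        support_fun_minkowski_cball[OF c(1) compact_imp_bounded[OF Zc(1)] P(3)] by auto
    have "\<bar>D u - c \<bullet> u\<bar> \<le> 2 * \<epsilon> * norm u" for u
      using support_fun_symmetric[OF c, of u] h[of u] h[of "- u"] unfolding D_def
      by (simp add: abs_le_iff)
    then show ?thesis by blast
  qed
  have small: "x = 0" if "\<And>\<epsilon>. \<epsilon> > 0 \<Longrightarrow> \<bar>x\<bar> \<le> \<epsilon> * K" "K \<ge> 0" for x K :: real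
  proof (rule ccontr)
    assume "x \<noteq> 0"
    define \<epsilon> where "\<epsilon> = \<bar>x\<bar> / (2 * (K + 1))"
    have "\<epsilon> > 0" using \<open>x \<noteq> 0\<close> that(2) by (simp add: \<epsilon>_def)
    have "\<epsilon> * K < \<epsilon> * (2 * (K + 1))" using \<open>\<epsilon> > 0\<close> that(2) by (intro mult_strict_left_mono) auto
    also have "\<dots> = \<bar>x\<bar>" using that(2) by (simp add: \<epsilon>_def)
    finally show False using that(1)[OF \<open>\<epsilon> > 0\<close>] by simp
  qed
  have "linear D"
  proof (rule linearI)
    fix u v
    have "D (u + v) - D u - D v = 0"
    proof (rule small)
      fix \<epsilon> :: real assume "\<epsilon> > 0"
      from approx[OF this] obtain c where c: "\<And>u. \<bar>D u - c \<bullet> u\<bar> \<le> 2 * \<epsilon> * norm u" by blast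
      have "\<bar>D (u + v) - D u - D v\<bar> \<le> 2 * \<epsilon> * norm (u + v) + 2 * \<epsilon> * norm u + 2 * \<epsilon> * norm v"
        using c[of "u + v"] c[of u] c[of v] by (simp add: inner_add_right)
      then show "\<bar>D (u + v) - D u - D v\<bar> \<le> \<epsilon> * (2 * norm (u + v) + 2 * norm u + 2 * norm v)"
        by (simp add: algebra_simps)
    qed simp
    then show "D (u + v) = D u + D v" by simp
  next
    fix r u
    have "D (r *\<^sub>R u) - r * D u = 0"
    proof (rule small)
      fix \<epsilon> :: real assume "\<epsilon> > 0"
      from approx[OF this] obtain c where c: "\<And>u. \<bar>D u - c \<bullet> u\<bar> \<le> 2 * \<epsilon> * norm u" by blast
      have "\<bar>r\<bar> * \<bar>D u - c \<bullet> u\<bar> \<le> \<bar>r\<bar> * (2 * \<epsilon> * norm u)"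
        using c[of u] by (intro mult_left_mono) auto
      then have "\<bar>r * D u - r * (c \<bullet> u)\<bar> \<le> \<bar>r\<bar> * (2 * \<epsilon> * norm u)"
        by (simp add: abs_mult[symmetric] right_diff_distrib)
      moreover have "\<bar>D (r *\<^sub>R u) - r * (c \<bullet> u)\<bar> \<le> 2 * \<epsilon> * (\<bar>r\<bar> * norm u)"
        using c[of "r *\<^sub>R u"] by simp
      ultimately have "\<bar>D (r *\<^sub>R u) - r * D u\<bar> \<le> 2 * \<epsilon> * (\<bar>r\<bar> * norm u) + \<bar>r\<bar> * (2 * \<epsilon> * norm u)"
        by linarith
      then show "\<bar>D (r *\<^sub>R u) - r * D u\<bar> \<le> \<epsilon> * (4 * \<bar>r\<bar> * norm u)"
        by (simp add: algebra_simps)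
    qed simp
    then show "D (r *\<^sub>R u) = r *\<^sub>R D u" by simp
  qed
  then have "D u = adjoint D 1 \<bullet> u" for u
    using adjoint_works[of D u 1] by (simp add: inner_commute)
  then show ?thesis unfolding D_def by blast
qed

section \<open>Recovering a body from its support function\<close>

lemma mem_convex_iff_support_fun:
  assumes K: "convex_body K"
  shows "x \<in> K \<longleftrightarrow> (\<forall>u\<in>sphere 0 1. u \<bullet> x \<le> support_fun K u)"
proof
  assume "x \<in> K"
  then show "\<forall>u\<in>sphere 0 1. u \<bullet> x \<le> support_fun K u"
    using K by (auto simp: convex_body_def intro!: inner_le_support_fun compact_imp_bounded)
next
  assume *: "\<forall>u\<in>sphere 0 1. u \<bullet> x \<le> support_fun K u"
  show "x \<in> K"
  proof (rule ccontr)
    assume "x \<notin> K"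
    then obtain a b where ab: "a \<bullet> x < b" "\<forall>y\<in>K. b < a \<bullet> y"
      using separating_hyperplane_closed_point[of K x] K
      by (auto simp: convex_body_def compact_imp_closed)
    have "a \<noteq> 0" using ab K by (auto simp: convex_body_def)
    \<comment> \<open>The separation puts \<open>x\<close> on the lower side of the hyperplane, so
      the outward direction is opposite to \<open>a\<close>.\<close>
    define u where "u = - sgn a"
    have "norm u = 1" using \<open>a \<noteq> 0\<close> by (simp add: u_def norm_sgn)
    have s: "u \<bullet> v = - ((a \<bullet> v) / norm a)" for v
      by (simp add: u_def sgn_div_norm divide_inverse mult.commute)
    have "support_fun K u \<le> - (b / norm a)"
    proof (rule support_fun_leI)
      fix y assume "y \<in> K"
      then have "b / norm a \<le> (a \<bullet> y) / norm a"
        using ab by (intro divide_right_mono) (auto intro: less_imp_le)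
      then show "u \<bullet> y \<le> - (b / norm a)" by (simp add: s)
    qed (use K in \<open>simp add: convex_body_def\<close>)
    moreover have "u \<bullet> x > - (b / norm a)"
      using ab \<open>a \<noteq> 0\<close> by (simp add: s divide_strict_right_mono)
    moreover have "u \<bullet> x \<le> support_fun K u" using * \<open>norm u = 1\<close> by simp
    ultimately show False by linarith
  qed
qed

text \<open>Has the shape of \<open>mem_convex_iff_support_fun\<close>, so that a body with the
  support function of a ball is that ball.\<close>

lemma mem_cball_iff_inner:
  fixes x :: "real^3"
  assumes "0 \<le> r"
  shows "x \<in> cball c r \<longleftrightarrow> (\<forall>u\<in>sphere 0 1. u \<bullet> x \<le> u \<bullet> c + r)"
proof
  assume x: "x \<in> cball c r"
  show "\<forall>u\<in>sphere 0 1. u \<bullet> x \<le> u \<bullet> c + r"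
  proof
    fix u :: "real^3" assume "u \<in> sphere 0 1"
    then have "u \<bullet> (x - c) \<le> norm (x - c)" using norm_cauchy_schwarz[of u "x - c"] by simp
    then show "u \<bullet> x \<le> u \<bullet> c + r" using x by (simp add: dist_norm inner_diff_right norm_minus_commute)
  qed
next
  assume *: "\<forall>u\<in>sphere 0 1. u \<bullet> x \<le> u \<bullet> c + r"
  show "x \<in> cball c r"
  proof (cases "x = c")
    case False
    then have "norm (sgn (x - c)) = 1" by (simp add: norm_sgn)
    then have "sgn (x - c) \<bullet> (x - c) \<le> r" using * by (simp add: inner_diff_right algebra_simps)
    moreover have "sgn (x - c) \<bullet> (x - c) = norm (x - c)"
      using False by (simp add: sgn_div_norm dot_square_norm power2_eq_square)
    ultimately show ?thesis by (simp add: dist_norm norm_minus_commute)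
  qed (use assms in simp)
qed

lemma support_fun_cball:
  assumes "norm u = 1" "0 \<le> r"
  shows "support_fun (cball c r) u = u \<bullet> c + r"
proof (rule antisym)
  show "support_fun (cball c r) u \<le> u \<bullet> c + r"
    using assms mem_cball_iff_inner[OF assms(2)] by (intro support_fun_leI) auto
  have "u \<bullet> (c + r *\<^sub>R u) \<le> support_fun (cball c r) u"
    using assms by (intro inner_le_support_fun) (auto simp: dist_norm)
  then show "u \<bullet> c + r \<le> support_fun (cball c r) u"
    using assms by (simp add: inner_add_right norm_eq_1)
qed

text \<open>Constant width fixes the even part of the support function, the zonoid property makes
  the odd part linear, and together they are the support function of a ball with centre
  \<open>c / 2\<close> and radius \<open>w / 2\<close>. The interior excludes a single point, the
  case \<open>w = 0\<close>.\<close>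

lemma zonoid_constant_width_imp_ball:
  assumes Z: "zonoid Z" and int: "interior Z \<noteq> {}" and w: "\<forall>u\<in>sphere 0 1. width Z u = w"
  shows "\<exists>c. \<exists>r>0. Z = cball c r"
proof -
  obtain c where c: "\<And>u. support_fun Z u - support_fun Z (- u) = c \<bullet> u"
    using zonoid_support_fun_odd_part[OF Z] by blast
  have K: "convex_body Z" using Z by (simp add: zonoid_def)
  then have Zc: "bounded Z" "Z \<noteq> {}" by (auto simp: convex_body_def compact_imp_bounded)
  have h: "support_fun Z u = u \<bullet> ((1/2) *\<^sub>R c) + w / 2" if "u \<in> sphere 0 1" for u
  proof -
    have "support_fun Z u + support_fun Z (- u) = w" using w that by (simp add: width_def)
    then show ?thesis using c[of u] by (simp add: inner_commute)
  qed
  obtain z where "z \<in> Z" using Zc by auto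
  have "0 \<le> width Z (axis 1 1)"
    using inner_le_support_fun[OF Zc(1) \<open>z \<in> Z\<close>, of "axis 1 1"] inner_le_support_fun[OF Zc(1) \<open>z \<in> Z\<close>, of "- axis 1 1"]
    by (simp add: width_def)
  then have "0 \<le> w" using w by auto
  then have eq: "Z = cball ((1/2) *\<^sub>R c) (w / 2)"
    using mem_convex_iff_support_fun[OF K] mem_cball_iff_inner[of "w / 2"] h by auto
  have "w \<noteq> 0" using int eq by auto
  then show ?thesis using eq \<open>0 \<le> w\<close> by (intro exI[of _ "(1/2) *\<^sub>R c"] exI[of _ "w / 2"]) auto
qed

lemma (in uniform_direction) variance_width_eq_0_iff:
  assumes Z: "zonoid Z" and int: "interior Z \<noteq> {}"
  shows "variance (\<lambda>x. width Z (U x)) = 0 \<longleftrightarrow> (\<exists>c. \<exists>r>0. Z = cball c r)"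
proof -
  have "variance (\<lambda>x. width Z (U x)) = 0 \<longleftrightarrow> (\<exists>w. \<forall>u\<in>sphere 0 1. width Z u = w)"
    using Z by (intro variance_eq_0_iff_constant continuous_on_width)
      (auto simp: zonoid_def convex_body_def compact_imp_bounded)
  also have "\<dots> \<longleftrightarrow> (\<exists>c. \<exists>r>0. Z = cball c r)"
  proof
    assume "\<exists>c. \<exists>r>0. Z = cball c r"
    then obtain c r where "r > 0" "Z = cball c r" by auto
    then have "\<forall>u\<in>sphere 0 1. width Z u = 2 * r"
      by (auto simp: width_def support_fun_cball)
    then show "\<exists>w. \<forall>u\<in>sphere 0 1. width Z u = w" by blast
  qed (use zonoid_constant_width_imp_ball[OF Z int] in blast)
  finally show ?thesis .
qed

section \<open>Variation of the distance function\<close>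

lemma sublevel_interval:
  fixes g :: "real \<Rightarrow> real"
  assumes convex: "convex_on UNIV g" and cont: "continuous_on UNIV g"
    and bnd: "bounded {t. g t \<le> \<epsilon>}" and r: "r \<le> \<epsilon>" "{t. g t \<le> r} \<noteq> {}"
  obtains a b where "a \<le> b" "{t. g t \<le> r} = {a..b}"
proof -
  have "convex {t. g t \<le> r}"
    unfolding convex_def
  proof (intro ballI allI impI)
    fix x y u v :: real assume *: "x \<in> {t. g t \<le> r}" "y \<in> {t. g t \<le> r}" "0 \<le> u" "0 \<le> v" "u + v = 1"
    then have "g (u *\<^sub>R x + v *\<^sub>R y) \<le> u * g x + v * g y" using convex by (simp add: convex_on_def)
    also have "\<dots> \<le> u * r + v * r" using * by (intro add_mono mult_left_mono) auto
    also have "\<dots> = r" using *(5) by (simp add: distrib_right[symmetric])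
    finally show "u *\<^sub>R x + v *\<^sub>R y \<in> {t. g t \<le> r}" by simp
  qed
  moreover have "compact {t. g t \<le> r}"
  proof (rule compact_eq_bounded_closed[THEN iffD2], rule conjI)
    show "bounded {t. g t \<le> r}" using bnd by (rule bounded_subset) (use r in auto)
    show "closed {t. g t \<le> r}" by (intro closed_Collect_le cont continuous_on_const)
  qed
  ultimately obtain a b where ab: "{t. g t \<le> r} = {a..b}"
    using connected_compact_interval_1 connected_convex_1 by metis
  moreover have "a \<le> b" using r(2) unfolding ab by simp
  ultimately show ?thesis using that by blast
qed

text \<open>A convex function that leaves its sublevel set on both sides runs down from the level to its
  minimum and up again, so the variation is twice the depth.\<close>

lemma nn_integral_abs_deriv_convex:
  fixes g g' :: "real \<Rightarrow> real"
  assumes convex: "convex_on UNIV g" and cont: "continuous_on UNIV g" and nonneg: "\<And>t. 0 \<le> g t"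
    and deriv: "\<And>t. 0 < g t \<Longrightarrow> (g has_real_derivative g' t) (at t)"
    and [measurable]: "g' \<in> borel_measurable borel"
    and bnd: "bounded {t. g t \<le> \<epsilon>}" and ne: "{t. g t \<le> \<epsilon>} \<noteq> {}" and \<epsilon>: "0 < \<epsilon>"
  obtains m where "0 \<le> m" "m \<le> \<epsilon>" "(\<exists>t. g t = 0) \<Longrightarrow> m = 0"
    "(\<integral>\<^sup>+t. ennreal \<bar>g' t\<bar> * indicator {t. 0 < g t \<and> g t \<le> \<epsilon>} t \<partial>lborel) = ennreal (2 * (\<epsilon> - m))"
proof -
  obtain \<alpha> \<beta> where \<alpha>\<beta>: "\<alpha> \<le> \<beta>" "{t. g t \<le> \<epsilon>} = {\<alpha>..\<beta>}"
    using sublevel_interval[OF convex cont bnd order_refl ne] .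
  have le_iff: "g t \<le> \<epsilon> \<longleftrightarrow> \<alpha> \<le> t \<and> t \<le> \<beta>" for t
    using \<alpha>\<beta>(2) by (metis atLeastAtMost_iff mem_Collect_eq)
  have "continuous_on {\<alpha>..\<beta>} g" by (rule continuous_on_subset[OF cont]) simp
  then have "\<exists>t\<in>{\<alpha>..\<beta>}. \<forall>s\<in>{\<alpha>..\<beta>}. g t \<le> g s"
    using \<alpha>\<beta>(1) by (intro continuous_attains_inf) auto
  then obtain t0 where t0: "t0 \<in> {\<alpha>..\<beta>}" "\<And>t. t \<in> {\<alpha>..\<beta>} \<Longrightarrow> g t0 \<le> g t" by blast
  \<comment> \<open>The minimum is positive exactly when \<open>g\<close> has no zero; then the
    variation falls short of \<open>2 * \<epsilon>\<close> by \<open>2 * m\<close>.\<close>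
  define m where "m = g t0"
  have m: "0 \<le> m" "m \<le> \<epsilon>" using nonneg t0(1) le_iff by (auto simp: m_def)
  have min: "m \<le> g t" for t
    using t0(2)[of t] m(2) le_iff[of t] by (cases "g t \<le> \<epsilon>") (auto simp: m_def)
  obtain \<gamma> \<delta> where \<gamma>\<delta>: "\<gamma> \<le> \<delta>" "{t. g t \<le> m} = {\<gamma>..\<delta>}"
    using sublevel_interval[OF convex cont bnd m(2)] m_def by blast
  have m_iff: "g t \<le> m \<longleftrightarrow> \<gamma> \<le> t \<and> t \<le> \<delta>" for t
    using \<gamma>\<delta>(2) by (metis atLeastAtMost_iff mem_Collect_eq)
  have g\<gamma>: "g \<gamma> = m" "g \<delta> = m" using m_iff min \<gamma>\<delta>(1) by (auto intro!: antisym)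
  have ord: "\<alpha> \<le> \<gamma>" "\<delta> \<le> \<beta>" using g\<gamma> m(2) le_iff[of \<gamma>] le_iff[of \<delta>] by simp_all
  have end_le: "g \<alpha> \<le> \<epsilon>" "g \<beta> \<le> \<epsilon>"
    using le_iff[of \<alpha>] le_iff[of \<beta>] \<alpha>\<beta>(1) by simp_all
  have level: "g \<alpha> = \<epsilon>" "g \<beta> = \<epsilon>"
  proof -
    \<comment> \<open>One step outside the sublevel set the level is exceeded, so the intermediate
      value theorem finds a point of level \<epsilon> not above \<open>\<alpha>\<close>; the
      sublevel set leaves only \<open>\<alpha>\<close> itself.\<close>
    have "\<epsilon> \<le> g (\<alpha> - 1)" using le_iff[of "\<alpha> - 1"] by simp
    then have "\<exists>t. \<alpha> - 1 \<le> t \<and> t \<le> \<alpha> \<and> g t = \<epsilon>"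
      using end_le by (intro IVT2' continuous_on_subset[OF cont]) simp_all
    then obtain t where "t \<le> \<alpha>" "g t = \<epsilon>" by blast
    moreover from this have "\<alpha> \<le> t" using le_iff[of t] by simp
    ultimately show "g \<alpha> = \<epsilon>" by simp
    have "\<epsilon> \<le> g (\<beta> + 1)" using le_iff[of "\<beta> + 1"] by simp
    then have "\<exists>t. \<beta> \<le> t \<and> t \<le> \<beta> + 1 \<and> g t = \<epsilon>"
      using end_le by (intro IVT' continuous_on_subset[OF cont]) simp_all
    then obtain t where "\<beta> \<le> t" "g t = \<epsilon>" by blast
    moreover from this have "t \<le> \<beta>" using le_iff[of t] by simp
    ultimately show "g \<beta> = \<epsilon>" by simp
  qed
  have pos: "0 < g t" if "t < \<gamma> \<or> \<delta> < t" for t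
  proof -
    have "\<not> g t \<le> m" using that m_iff[of t] by linarith
    then show ?thesis using m(1) by simp
  qed
  have tangent: "g' t * (x - t) \<le> g x - g t" if "0 < g t" for x t
    using convex_on_imp_above_tangent[OF convex _ _ _ has_field_derivative_at_within[OF deriv[OF that]], of x]
    by simp
  have right: "0 \<le> g' t" if "\<delta> < t" for t
  proof -
    have "g' t * (\<delta> - t) \<le> 0" using tangent[OF pos, of t \<delta>] that min[of t] g\<gamma> by auto
    then show ?thesis using that by (simp add: mult_le_0_iff)
  qed
  have left: "g' t \<le> 0" if "t < \<gamma>" for t
  proof -
    have "g' t * (\<gamma> - t) \<le> 0" using tangent[OF pos, of t \<gamma>] that min[of t] g\<gamma> by auto
    then show ?thesis using that by (simp add: mult_le_0_iff)
  qed
  have R: "(\<integral>\<^sup>+t. ennreal (g' t) * indicator {\<delta><..<\<beta>} t \<partial>lborel) = ennreal (\<epsilon> - m)"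
  proof -
    have "(g' has_integral g \<beta> - g \<delta>) {\<delta>..\<beta>}"
      using ord pos
      by (intro fundamental_theorem_of_calculus_interior continuous_on_subset[OF cont])
        (auto simp: has_real_derivative_iff_has_vector_derivative[symmetric] intro!: deriv)
    then show ?thesis
      using right by (intro nn_integral_has_integral_lebesgue') (auto simp: has_integral_Icc_iff_Ioo level g\<gamma>)
  qed
  have L: "(\<integral>\<^sup>+t. ennreal (- g' t) * indicator {\<alpha><..<\<gamma>} t \<partial>lborel) = ennreal (\<epsilon> - m)"
  proof -
    have "(g' has_integral g \<gamma> - g \<alpha>) {\<alpha>..\<gamma>}"
      using ord pos
      by (intro fundamental_theorem_of_calculus_interior continuous_on_subset[OF cont])
        (auto simp: has_real_derivative_iff_has_vector_derivative[symmetric] intro!: deriv)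
    then have "((\<lambda>t. - g' t) has_integral - (g \<gamma> - g \<alpha>)) {\<alpha>..\<gamma>}" by (rule has_integral_neg)
    then show ?thesis
      using left by (intro nn_integral_has_integral_lebesgue') (auto simp: has_integral_Icc_iff_Ioo level g\<gamma>)
  qed
  have "(\<integral>\<^sup>+t. ennreal \<bar>g' t\<bar> * indicator {t. 0 < g t \<and> g t \<le> \<epsilon>} t \<partial>lborel)
      = (\<integral>\<^sup>+t. ennreal (g' t) * indicator {\<delta><..<\<beta>} t + ennreal (- g' t) * indicator {\<alpha><..<\<gamma>} t \<partial>lborel)"
  \<comment> \<open>At \<open>\<alpha>\<close> and \<open>\<beta>\<close> the level is attained, so
    these points count on the left but lie outside the open intervals; they form a null set.\<close>
  proof (rule nn_integral_cong_AE, rule AE_mp[OF AE_lborel_singleton[of \<alpha>]], rule AE_mp[OF AE_lborel_singleton[of \<beta>]],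
      rule AE_I2, intro impI)
    fix t assume t: "t \<noteq> \<alpha>" "t \<noteq> \<beta>"
    consider "t < \<gamma>" | "\<delta> < t" | "\<gamma> \<le> t" "t \<le> \<delta>" by linarith
    then show "ennreal \<bar>g' t\<bar> * indicator {t. 0 < g t \<and> g t \<le> \<epsilon>} t
        = ennreal (g' t) * indicator {\<delta><..<\<beta>} t + ennreal (- g' t) * indicator {\<alpha><..<\<gamma>} t"
    proof cases
      case 1
      have "t \<notin> {\<delta><..<\<beta>}" using 1 \<gamma>\<delta>(1) by simp
      moreover have "0 < g t \<and> g t \<le> \<epsilon> \<longleftrightarrow> t \<in> {\<alpha><..<\<gamma>}"
        using 1 pos[of t] le_iff[of t] t ord \<gamma>\<delta>(1) by auto
      ultimately show ?thesis using left[OF 1] by (simp add: indicator_def)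
    next
      case 2
      have "t \<notin> {\<alpha><..<\<gamma>}" using 2 \<gamma>\<delta>(1) by simp
      moreover have "0 < g t \<and> g t \<le> \<epsilon> \<longleftrightarrow> t \<in> {\<delta><..<\<beta>}"
        using 2 pos[of t] le_iff[of t] t ord \<gamma>\<delta>(1) by auto
      ultimately show ?thesis using right[OF 2] by (simp add: indicator_def)
    next
      case 3
      then have "g t = m" using m_iff[of t] min[of t] by simp
      \<comment> \<open>On the flat bottom the integrand vanishes, either because
        \<open>g t = 0\<close> takes \<open>t\<close> out of the range or because the derivative at
        a minimum is 0.\<close>
      have "g' t = 0" if "0 < g t"
        by (rule DERIV_local_min[OF deriv[OF that] zero_less_one]) (use min \<open>g t = m\<close> in auto)
      moreover have "t \<notin> {\<delta><..<\<beta>}" "t \<notin> {\<alpha><..<\<gamma>}" using 3 by auto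
      ultimately show ?thesis by (auto simp: indicator_def)
    qed
  qed
  also have "\<dots> = ennreal (\<epsilon> - m) + ennreal (\<epsilon> - m)"
    by (subst nn_integral_add) (simp_all add: R L)
  also have "\<dots> = ennreal (2 * (\<epsilon> - m))"
    using m by (subst ennreal_plus[symmetric]) auto
  finally have "(\<integral>\<^sup>+t. ennreal \<bar>g' t\<bar> * indicator {t. 0 < g t \<and> g t \<le> \<epsilon>} t \<partial>lborel) = ennreal (2 * (\<epsilon> - m))" .
  moreover have "m = 0" if "\<exists>t. g t = 0" using that min m(1) by (metis antisym)
  ultimately show ?thesis using that m by blast
qed

section \<open>Differentiability of the distance function\<close>

definition outer_normal :: "(real^3) set \<Rightarrow> real^3 \<Rightarrow> real^3" where
  "outer_normal K x = sgn (x - closest_point K x)"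

lemma infdist_eq_dist_closest_point:
  assumes "closed K" "K \<noteq> {}"
  shows "infdist x K = dist x (closest_point K x)"
proof (rule antisym)
  show "infdist x K \<le> dist x (closest_point K x)"
    by (rule infdist_le[OF closest_point_in_set[OF assms]])
  show "dist x (closest_point K x) \<le> infdist x K"
    unfolding infdist_notempty[OF assms(2)] using assms closest_point_le by (intro cINF_greatest) auto
qed

text \<open>The convex combination of the two nearest points lies in \<open>K\<close> and competes
  for the distance of the intermediate point.\<close>

lemma convex_on_infdist_line:
  fixes K :: "(real^3) set"
  assumes "convex K" "closed K" "K \<noteq> {}"
  shows "convex_on UNIV (\<lambda>t. infdist (p + t *\<^sub>R u) K)"
proof (rule convex_onI)
  fix t x y :: real assume t: "0 < t" "t < 1"
  let ?X = "p + x *\<^sub>R u" and ?Y = "p + y *\<^sub>R u"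
  let ?a = "closest_point K ?X" and ?b = "closest_point K ?Y"
  have "(1 - t) *\<^sub>R ?a + t *\<^sub>R ?b \<in> K"
    using t assms closest_point_in_set[OF assms(2,3)] by (intro convexD) auto
  then have "infdist (p + ((1 - t) *\<^sub>R x + t *\<^sub>R y) *\<^sub>R u) K
      \<le> dist (p + ((1 - t) *\<^sub>R x + t *\<^sub>R y) *\<^sub>R u) ((1 - t) *\<^sub>R ?a + t *\<^sub>R ?b)"
    by (rule infdist_le)
  also have "\<dots> = norm ((1 - t) *\<^sub>R (?X - ?a) + t *\<^sub>R (?Y - ?b))"
    by (simp add: dist_norm algebra_simps)
  also have "\<dots> \<le> (1 - t) * norm (?X - ?a) + t * norm (?Y - ?b)"
    using t by (intro norm_triangle_le) simp
  finally show "infdist (p + ((1 - t) *\<^sub>R x + t *\<^sub>R y) *\<^sub>R u) K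
      \<le> (1 - t) * infdist ?X K + t * infdist ?Y K"
    by (simp add: infdist_eq_dist_closest_point[OF assms(2,3)] dist_norm)
qed simp

text \<open>The distance to the nearest point bounds the distance function from above, the distance to
  the supporting half-space from below; both are tangent at \<open>x\<close>.\<close>

lemma infdist_expansion:
  fixes K :: "(real^3) set"
  assumes K: "convex K" "closed K" "K \<noteq> {}" and pos: "0 < infdist x K" and u: "norm u = 1"
  shows "\<bar>infdist (x + h *\<^sub>R u) K - infdist x K - h * (u \<bullet> outer_normal K x)\<bar> \<le> h\<^sup>2 / (2 * infdist x K)"
proof -
  define \<pi> where "\<pi> = closest_point K x"
  define d where "d = infdist x K"
  define D where "D = u \<bullet> outer_normal K x"
  have \<pi>: "\<pi> \<in> K" "\<And>y. y \<in> K \<Longrightarrow> (x - \<pi>) \<bullet> (y - \<pi>) \<le> 0"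
    using closest_point_in_set[OF K(2,3)] closest_point_dot[OF K(1,2)] by (auto simp: \<pi>_def)
  have d: "d > 0" "norm (x - \<pi>) = d"
    using pos by (auto simp: d_def infdist_eq_dist_closest_point[OF K(2,3)] \<pi>_def dist_norm)
  have N: "outer_normal K x = (1 / d) *\<^sub>R (x - \<pi>)"
    unfolding outer_normal_def \<pi>_def[symmetric] sgn_div_norm d(2) by (simp add: divide_inverse)
  have nN: "norm (outer_normal K x) = 1" using d by (simp add: N)
  have Dd: "u \<bullet> (x - \<pi>) = d * D" using d by (simp add: D_def N)
  have dd: "(x - \<pi>) \<bullet> (x - \<pi>) = d\<^sup>2" using d(2) by (simp add: dot_square_norm)
  have Nd: "outer_normal K x \<bullet> (x - \<pi>) = d"
    unfolding N inner_scaleR_left dd using d(1) by (simp add: power2_eq_square)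
  have "\<bar>D\<bar> \<le> 1" using Cauchy_Schwarz_ineq2[of u "outer_normal K x"] u nN by (simp add: D_def)
  have lower: "d + h * D \<le> infdist (x + h *\<^sub>R u) K"
    unfolding infdist_notempty[OF K(3)]
  proof (rule cINF_greatest[OF K(3)])
    fix y assume y: "y \<in> K"
    have "d + h * D = outer_normal K x \<bullet> (x + h *\<^sub>R u - \<pi>)"
    proof -
      have "outer_normal K x \<bullet> (x + h *\<^sub>R u - \<pi>) = outer_normal K x \<bullet> ((x - \<pi>) + h *\<^sub>R u)"
        by (simp add: algebra_simps)
      also have "\<dots> = d + h * D"
        unfolding inner_add_right Nd by (simp add: D_def inner_commute)
      finally show ?thesis ..
    qed
    also have "\<dots> = outer_normal K x \<bullet> (x + h *\<^sub>R u - y) + outer_normal K x \<bullet> (y - \<pi>)"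
      by (simp add: inner_diff_right inner_add_right)
    also have "outer_normal K x \<bullet> (y - \<pi>) \<le> 0"
      using \<pi>(2)[OF y] d(1) by (simp add: N divide_nonpos_pos)
    also have "outer_normal K x \<bullet> (x + h *\<^sub>R u - y) \<le> norm (outer_normal K x) * norm (x + h *\<^sub>R u - y)"
      by (rule norm_cauchy_schwarz)
    finally show "d + h * D \<le> dist (x + h *\<^sub>R u) y" by (simp add: nN dist_norm)
  qed
  \<comment> \<open>The bound is the tangent of the square root at \<open>d\<^sup>2\<close>; after
    squaring, the slack is the square of \<open>h * D + h\<^sup>2 / (2 * d)\<close>.\<close>
  have "norm (x + h *\<^sub>R u - \<pi>) \<le> d + (h * D + h\<^sup>2 / (2 * d))"
  proof (rule power2_le_imp_le)
    have "(norm (x + h *\<^sub>R u - \<pi>))\<^sup>2 = (norm ((x - \<pi>) + h *\<^sub>R u))\<^sup>2" by (simp add: algebra_simps)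
    also have "\<dots> = d\<^sup>2 + 2 * h * (d * D) + h\<^sup>2"
    proof -
      have "u \<bullet> u = 1" using u by (simp add: norm_eq_1)
      then show ?thesis
        unfolding power2_norm_eq_inner inner_add_left inner_add_right dd
        by (simp add: inner_commute[of "x - \<pi>" u] Dd) (simp add: power2_eq_square)
    qed
    also have "\<dots> = d\<^sup>2 + 2 * d * (h * D + h\<^sup>2 / (2 * d))" using d(1) by (simp add: field_simps power2_eq_square)
    also have "\<dots> \<le> (d + (h * D + h\<^sup>2 / (2 * d)))\<^sup>2"
      unfolding power2_sum[of d] by simp
    finally show "(norm (x + h *\<^sub>R u - \<pi>))\<^sup>2 \<le> (d + (h * D + h\<^sup>2 / (2 * d)))\<^sup>2" .
    \<comment> \<open>Comparing squares requires a nonnegative right side; \<open>2 * d\<close>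
      times it is this sum of terms that are nonnegative because
      \<open>\<bar>D\<bar> \<le> 1\<close>.\<close>
    have "0 \<le> (d + h * D)\<^sup>2 + d\<^sup>2 + h\<^sup>2 * (1 - D\<^sup>2)"
      using \<open>\<bar>D\<bar> \<le> 1\<close> by (intro add_nonneg_nonneg mult_nonneg_nonneg) (auto simp: abs_square_le_1)
    also have "\<dots> = 2 * d * (d + (h * D + h\<^sup>2 / (2 * d)))"
      using d(1) by (simp add: field_simps power2_eq_square)
    finally show "0 \<le> d + (h * D + h\<^sup>2 / (2 * d))" using d(1) by (simp add: zero_le_mult_iff)
  qed
  moreover have "infdist (x + h *\<^sub>R u) K \<le> norm (x + h *\<^sub>R u - \<pi>)"
    using infdist_le[OF \<pi>(1), of "x + h *\<^sub>R u"] by (simp add: dist_norm)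
  moreover have "0 \<le> h\<^sup>2 / (2 * d)" using d(1) by simp
  ultimately show ?thesis using lower by (simp add: d_def[symmetric] D_def[symmetric] abs_le_iff)
qed

lemma infdist_has_derivative_line:
  fixes K :: "(real^3) set"
  assumes K: "convex K" "closed K" "K \<noteq> {}" and pos: "0 < infdist (p + t *\<^sub>R u) K" and u: "norm u = 1"
  shows "((\<lambda>t. infdist (p + t *\<^sub>R u) K) has_real_derivative u \<bullet> outer_normal K (p + t *\<^sub>R u)) (at t)"
  unfolding DERIV_def
proof (rule Lim_transform)
  define d where "d = infdist (p + t *\<^sub>R u) K"
  define D where "D = u \<bullet> outer_normal K (p + t *\<^sub>R u)"
  show "((\<lambda>h::real. D) \<longlongrightarrow> u \<bullet> outer_normal K (p + t *\<^sub>R u)) (at 0)" by (simp add: D_def)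
  show "((\<lambda>h. (infdist (p + (t + h) *\<^sub>R u) K - infdist (p + t *\<^sub>R u) K) / h - D) \<longlongrightarrow> 0) (at 0)"
  proof (rule Lim_null_comparison)
    show "\<forall>\<^sub>F h in at 0. norm ((infdist (p + (t + h) *\<^sub>R u) K - infdist (p + t *\<^sub>R u) K) / h - D) \<le> \<bar>h\<bar> / (2 * d)"
    proof (rule eventually_at_topological[THEN iffD2], intro exI[of _ UNIV] conjI ballI impI)
      fix h :: real assume h: "h \<noteq> 0"
      have "\<bar>infdist (p + (t + h) *\<^sub>R u) K - infdist (p + t *\<^sub>R u) K - h * D\<bar> \<le> h\<^sup>2 / (2 * d)"
        using infdist_expansion[OF K pos u, of h] by (simp add: D_def d_def algebra_simps)
      then have "\<bar>infdist (p + (t + h) *\<^sub>R u) K - infdist (p + t *\<^sub>R u) K - h * D\<bar> / \<bar>h\<bar> \<le> h\<^sup>2 / (2 * d) / \<bar>h\<bar>"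
        by (rule divide_right_mono) simp
      also have "h\<^sup>2 / (2 * d) / \<bar>h\<bar> = \<bar>h\<bar> / (2 * d)"
      proof -
        have "h\<^sup>2 = \<bar>h\<bar> * \<bar>h\<bar>" by (simp add: power2_eq_square)
        then have "h\<^sup>2 / (2 * d) / \<bar>h\<bar> = (\<bar>h\<bar> / \<bar>h\<bar>) * (\<bar>h\<bar> / (2 * d))"
          by (simp only: times_divide_eq_left times_divide_eq_right divide_divide_eq_left mult.commute)
        also have "\<bar>h\<bar> / \<bar>h\<bar> = 1" using h by simp
        finally show ?thesis by (simp only: mult_1)
      qed
      also have "\<bar>infdist (p + (t + h) *\<^sub>R u) K - infdist (p + t *\<^sub>R u) K - h * D\<bar> / \<bar>h\<bar>
          = \<bar>(infdist (p + (t + h) *\<^sub>R u) K - infdist (p + t *\<^sub>R u) K) / h - D\<bar>"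
        using h by (simp add: abs_divide[symmetric] diff_divide_distrib)
      finally show "norm ((infdist (p + (t + h) *\<^sub>R u) K - infdist (p + t *\<^sub>R u) K) / h - D) \<le> \<bar>h\<bar> / (2 * d)" by simp
    qed auto
    have "((\<lambda>h::real. \<bar>h\<bar> / (2 * d)) \<longlongrightarrow> \<bar>0\<bar> / (2 * d)) (at 0)"
      using pos by (intro tendsto_intros) (auto simp: d_def)
    then show "((\<lambda>h::real. \<bar>h\<bar> / (2 * d)) \<longlongrightarrow> 0) (at 0)" by simp
  qed
qed

lemma continuous_on_infdist_line:
  fixes K :: "(real^3) set"
  shows "continuous_on S (\<lambda>t. infdist (p + t *\<^sub>R u) K)"
  by (intro continuous_intros)

section \<open>Cauchy's projection formula\<close>

definition frame_coords :: "real^3 \<Rightarrow> real^3 \<Rightarrow> real^3 \<Rightarrow> real^2" where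
  "frame_coords e1 e2 x = vector [x \<bullet> e1, x \<bullet> e2]"

lemma frame_coords_combination:
  assumes "orthonormal_frame e1 e2 u"
  shows "frame_coords e1 e2 (a *\<^sub>R e1 + b *\<^sub>R e2 + c *\<^sub>R u) = vector [a, b]"
  unfolding frame_coords_def inner_frame_combination[OF assms] ..

lemma linear_frame_coords: "linear (frame_coords e1 e2)"
  unfolding frame_coords_def vector2_eq
  by (rule linearI) (simp_all add: inner_add_left scaleR_add_left scaleR_add_right)

lemma continuous_on_frame_coords: "continuous_on S (frame_coords e1 e2)"
  by (intro linear_continuous_on linear_conv_bounded_linear[THEN iffD1] linear_frame_coords)

lemma compact_frame_coords: "compact K \<Longrightarrow> compact (frame_coords e1 e2 ` K)"
  by (intro compact_continuous_image continuous_on_frame_coords)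

text \<open>The frame is chosen by an unspecified but fixed rule that does not look at the set. One
  frame for all sets makes the shadows of a body and of its parallel bodies comparable.\<close>

lemma plane_area_frame:
  assumes "norm u = 1"
  obtains e1 e2 where "orthonormal_frame e1 e2 u"
    "\<And>A. plane_area u A = measure lebesgue (frame_coords e1 e2 ` A)"
proof -
  define e where "e = (SOME e. plane_frame u e)"
  obtain f1 f2 where "orthonormal_frame f1 f2 u" using exists_orthonormal_frame[OF assms] .
  then have "plane_frame u (f1, f2)"
    by (simp add: plane_frame_def orthonormal_frame_def norm_eq_1)
  then have e: "plane_frame u e" unfolding e_def by (rule someI)
  show ?thesis
  proof (rule that[of "fst e" "snd e"])
    show "orthonormal_frame (fst e) (snd e) u"
      using e assms by (simp add: plane_frame_def orthonormal_frame_def norm_eq_1 case_prod_beta)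
    show "plane_area u A = measure lebesgue (frame_coords (fst e) (snd e) ` A)" for A
      by (simp add: plane_area_def e_def[symmetric] frame_coords_def[abs_def] case_prod_beta)
  qed
qed

lemma brightness_frame:
  assumes "norm u = 1"
  obtains e1 e2 where "orthonormal_frame e1 e2 u"
    "\<And>K. brightness K u = measure lebesgue (frame_coords e1 e2 ` K)"
proof -
  obtain e1 e2 where e: "orthonormal_frame e1 e2 u"
    and a: "\<And>A. plane_area u A = measure lebesgue (frame_coords e1 e2 ` A)"
    using plane_area_frame[OF assms] by metis
  have "frame_coords e1 e2 (orth_projection u x) = frame_coords e1 e2 x" for x
    using orthonormal_frameD[OF e] by (simp add: frame_coords_def orth_projection_def inner_diff_left)
  then have "brightness K u = measure lebesgue (frame_coords e1 e2 ` K)" for K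
    by (simp add: brightness_def a image_image)
  then show ?thesis using that e by blast
qed

section \<open>Shells and parallel bodies\<close>

abbreviation (input) parallel_body :: "(real^3) set \<Rightarrow> nat \<Rightarrow> (real^3) set" where
  "parallel_body K n \<equiv> {x. infdist x K \<le> 1 / real (Suc n)}"

definition shell :: "(real^3) set \<Rightarrow> real \<Rightarrow> (real^3) set" where
  "shell K \<epsilon> = {x. 0 < infdist x K \<and> infdist x K \<le> \<epsilon>}"

lemma infdist_borel_measurable [measurable]:
  fixes K :: "(real^3) set"
  shows "(\<lambda>x. infdist x K) \<in> borel_measurable borel"
  by (intro borel_measurable_continuous_onI continuous_intros)

lemma shell_borel [measurable]: "shell K \<epsilon> \<in> sets borel"
  unfolding shell_def by measurable

context
  fixes K :: "(real^3) set"
  assumes K: "convex_body K"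
begin

lemma convex_bodyD: "convex K" "compact K" "closed K" "K \<noteq> {}"
  using K by (auto simp: convex_body_def compact_imp_closed)

lemma outer_normal_borel_measurable [measurable]: "outer_normal K \<in> borel_measurable borel"
proof -
  have "closest_point K \<in> borel_measurable borel"
    by (intro borel_measurable_continuous_onI continuous_on_closest_point convex_bodyD)
  then show ?thesis unfolding outer_normal_def[abs_def] sgn_div_norm by measurable
qed

lemma compact_parallel_body: "0 < \<epsilon> \<Longrightarrow> compact {x. infdist x K \<le> \<epsilon>}"
  by (rule compact_infdist_le[OF convex_bodyD(4,2)])

text \<open>On the line over \<open>(a, b)\<close> the integrand is the absolute derivative of the
  distance to \<open>K\<close>. A line that misses \<open>K\<close> but meets the parallel body
  gives some value between 0 and \<open>2 * \<epsilon>\<close>, hence the different shadows in the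
  two bounds.\<close>

lemma nn_integral_line:
  assumes f: "orthonormal_frame e1 e2 u" and \<epsilon>: "0 < \<epsilon>"
  defines "V a b \<equiv> (\<integral>\<^sup>+c. ennreal \<bar>u \<bullet> outer_normal K (a *\<^sub>R e1 + b *\<^sub>R e2 + c *\<^sub>R u)\<bar> *
      indicator (shell K \<epsilon>) (a *\<^sub>R e1 + b *\<^sub>R e2 + c *\<^sub>R u) \<partial>lborel)"
  shows "V a b \<le> ennreal (2 * \<epsilon>) * indicator (frame_coords e1 e2 ` {x. infdist x K \<le> \<epsilon>}) (vector [a, b])"
    and "ennreal (2 * \<epsilon>) * indicator (frame_coords e1 e2 ` K) (vector [a, b]) \<le> V a b"
proof -
  define p where "p = a *\<^sub>R e1 + b *\<^sub>R e2"
  define g where "g t = infdist (p + t *\<^sub>R u) K" for t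
  define g' where "g' t = u \<bullet> outer_normal K (p + t *\<^sub>R u)" for t
  have u: "norm u = 1" using f by (simp add: orthonormal_frame_def norm_eq_1)
  have V: "V a b = (\<integral>\<^sup>+t. ennreal \<bar>g' t\<bar> * indicator {t. 0 < g t \<and> g t \<le> \<epsilon>} t \<partial>lborel)"
    by (simp add: V_def g_def g'_def p_def shell_def indicator_def)
  have hit: "vector [a, b] \<in> frame_coords e1 e2 ` {x. infdist x K \<le> r} \<longleftrightarrow> (\<exists>t. g t \<le> r)" for r
  proof
    assume "vector [a, b] \<in> frame_coords e1 e2 ` {x. infdist x K \<le> r}"
    then obtain x where x: "infdist x K \<le> r" "frame_coords e1 e2 x = vector [a, b]" by auto
    have "x \<bullet> e1 = a" "x \<bullet> e2 = b"
      using x(2) by (metis frame_coords_def vector_2)+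
    then have "x = p + (x \<bullet> u) *\<^sub>R u"
      using frame_representation[OF f, of x] by (simp add: p_def)
    then have "g (x \<bullet> u) \<le> r" using x(1) by (simp add: g_def)
    then show "\<exists>t. g t \<le> r" ..
  next
    assume "\<exists>t. g t \<le> r"
    then obtain t where "infdist (p + t *\<^sub>R u) K \<le> r" by (auto simp: g_def)
    moreover have "frame_coords e1 e2 (p + t *\<^sub>R u) = vector [a, b]"
      unfolding p_def by (rule frame_coords_combination[OF f])
    ultimately show "vector [a, b] \<in> frame_coords e1 e2 ` {x. infdist x K \<le> r}"
      by (intro image_eqI[of _ _ "p + t *\<^sub>R u"]) auto
  qed
  have K0: "K = {x. infdist x K \<le> 0}"
    using in_closed_iff_infdist_zero[OF convex_bodyD(3,4)] infdist_nonneg by (auto intro: antisym)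
  have main: "\<exists>m. 0 \<le> m \<and> ((\<exists>t. g t = 0) \<longrightarrow> m = 0) \<and> V a b = ennreal (2 * (\<epsilon> - m))"
    if ne: "{t. g t \<le> \<epsilon>} \<noteq> {}"
  proof -
    have bnd: "bounded {t. g t \<le> \<epsilon>}"
    proof -
      obtain B where B: "\<And>x. infdist x K \<le> \<epsilon> \<Longrightarrow> norm x \<le> B"
        using compact_imp_bounded[OF compact_parallel_body[OF \<epsilon>]] unfolding bounded_iff by blast
      have "\<bar>t\<bar> \<le> B" if "g t \<le> \<epsilon>" for t
      proof -
        have "(p + t *\<^sub>R u) \<bullet> u = t" unfolding p_def by (rule inner_frame_combination[OF f])
        moreover have "\<bar>(p + t *\<^sub>R u) \<bullet> u\<bar> \<le> norm (p + t *\<^sub>R u)"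
          using Cauchy_Schwarz_ineq2[of "p + t *\<^sub>R u" u] u by simp
        moreover have "norm (p + t *\<^sub>R u) \<le> B" using B that by (simp add: g_def)
        ultimately show ?thesis by simp
      qed
      then show ?thesis unfolding bounded_iff by (intro exI[of _ B]) simp
    qed
    have conv: "convex_on UNIV g" unfolding g_def by (rule convex_on_infdist_line[OF convex_bodyD(1,3,4)])
    have cont: "continuous_on UNIV g" unfolding g_def by (rule continuous_on_infdist_line)
    have nonneg: "0 \<le> g t" for t by (simp add: g_def infdist_nonneg)
    have deriv: "(g has_real_derivative g' t) (at t)" if "0 < g t" for t
      using that infdist_has_derivative_line[OF convex_bodyD(1,3,4) _ u, of p t] by (simp add: g_def[abs_def] g'_def)
    have meas: "g' \<in> borel_measurable borel" unfolding g'_def by measurable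
    from nn_integral_abs_deriv_convex[OF conv cont nonneg deriv meas bnd ne \<epsilon>] show ?thesis
      unfolding V by blast
  qed
  show "V a b \<le> ennreal (2 * \<epsilon>) * indicator (frame_coords e1 e2 ` {x. infdist x K \<le> \<epsilon>}) (vector [a, b])"
  proof (cases "\<exists>t. g t \<le> \<epsilon>")
    case True
    then obtain m where "0 \<le> m" "V a b = ennreal (2 * (\<epsilon> - m))" using main by blast
    then show ?thesis using True hit[of \<epsilon>] by (simp add: ennreal_leI)
  next
    case False
    then have "V a b = 0" unfolding V by (simp add: indicator_def)
    then show ?thesis by simp
  qed
  show "ennreal (2 * \<epsilon>) * indicator (frame_coords e1 e2 ` K) (vector [a, b]) \<le> V a b"
  proof (cases "\<exists>t. g t \<le> 0")
    case True
    then obtain t where "g t \<le> 0" by blast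
    then have "g t = 0" "g t \<le> \<epsilon>" using \<epsilon> infdist_nonneg[of "p + t *\<^sub>R u" K] by (auto simp: g_def)
    then have "{t. g t \<le> \<epsilon>} \<noteq> {}" by blast
    from main[OF this] \<open>g t = 0\<close> have "V a b = ennreal (2 * (\<epsilon> - 0))" by blast
    then have "V a b = ennreal (2 * \<epsilon>)" by simp
    then show ?thesis by (simp add: indicator_def)
  next
    case False
    then have "vector [a, b] \<notin> frame_coords e1 e2 ` K" using hit[of 0] K0 by simp
    then show ?thesis by simp
  qed
qed

lemma nn_integral_shell_bounds:
  assumes u: "norm u = 1" and \<epsilon>: "0 < \<epsilon>"
  defines "\<Phi> \<equiv> (\<integral>\<^sup>+x. ennreal \<bar>u \<bullet> outer_normal K x\<bar> * indicator (shell K \<epsilon>) x \<partial>lborel)"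
  shows "ennreal (2 * \<epsilon> * brightness K u) \<le> \<Phi>"
    and "\<Phi> \<le> ennreal (2 * \<epsilon> * brightness {x. infdist x K \<le> \<epsilon>} u)"
proof -
  obtain e1 e2 where f: "orthonormal_frame e1 e2 u"
    and b: "\<And>K. brightness K u = measure lebesgue (frame_coords e1 e2 ` K)"
    using brightness_frame[OF u] by metis
  have area: "(\<integral>\<^sup>+a. \<integral>\<^sup>+b. ennreal (2 * \<epsilon>) * indicator (frame_coords e1 e2 ` C) (vector [a, b]) \<partial>lborel \<partial>lborel)
      = ennreal (2 * \<epsilon> * brightness C u)" if "compact C" for C
  proof -
    have c: "compact (frame_coords e1 e2 ` C)" by (rule compact_frame_coords[OF that])
    then have [measurable]: "frame_coords e1 e2 ` C \<in> sets borel" by (rule borel_compact)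
    have "(\<integral>\<^sup>+a. \<integral>\<^sup>+b. ennreal (2 * \<epsilon>) * indicator (frame_coords e1 e2 ` C) (vector [a, b]) \<partial>lborel \<partial>lborel)
      = (\<integral>\<^sup>+y. ennreal (2 * \<epsilon>) * indicator (frame_coords e1 e2 ` C) y \<partial>lborel)"
      by (subst nn_integral_vector2) auto
    also have "\<dots> = ennreal (2 * \<epsilon>) * emeasure lborel (frame_coords e1 e2 ` C)"
      by (simp add: nn_integral_cmult)
    also have "emeasure lborel (frame_coords e1 e2 ` C) = ennreal (measure lborel (frame_coords e1 e2 ` C))"
      using emeasure_compact_finite[OF c] by (intro emeasure_eq_ennreal_measure) simp
    also have "measure lborel (frame_coords e1 e2 ` C) = brightness C u"
      by (simp add: b)
    finally show ?thesis using \<epsilon> by (simp add: ennreal_mult b)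
  qed
  have \<Phi>: "\<Phi> = (\<integral>\<^sup>+a. \<integral>\<^sup>+b. \<integral>\<^sup>+c. ennreal \<bar>u \<bullet> outer_normal K (a *\<^sub>R e1 + b *\<^sub>R e2 + c *\<^sub>R u)\<bar> *
      indicator (shell K \<epsilon>) (a *\<^sub>R e1 + b *\<^sub>R e2 + c *\<^sub>R u) \<partial>lborel \<partial>lborel \<partial>lborel)"
    unfolding \<Phi>_def by (rule nn_integral_frame[OF _ f]) measurable
  show "ennreal (2 * \<epsilon> * brightness K u) \<le> \<Phi>"
    unfolding \<Phi> area[OF convex_bodyD(2), symmetric] by (intro nn_integral_mono nn_integral_line(2)[OF f \<epsilon>])
  show "\<Phi> \<le> ennreal (2 * \<epsilon> * brightness {x. infdist x K \<le> \<epsilon>} u)"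
    unfolding \<Phi> area[OF compact_parallel_body[OF \<epsilon>], symmetric]
    by (intro nn_integral_mono nn_integral_line(1)[OF f \<epsilon>])
qed

text \<open>Projection does not increase distances, so the shadow of a parallel body lies in the
  closed neighbourhood \<open>A n\<close> of the shadow of \<open>K\<close>. These compact sets
  decrease to that shadow, and their areas converge.\<close>

lemma brightness_parallel_body_tendsto:
  assumes u: "norm u = 1"
  shows "(\<lambda>n. brightness (parallel_body K n) u) \<longlonglongrightarrow> brightness K u"
proof -
  obtain e1 e2 where f: "orthonormal_frame e1 e2 u"
    and b: "\<And>K. brightness K u = measure lebesgue (frame_coords e1 e2 ` K)"
    using brightness_frame[OF u] by metis
  let ?Q = "\<lambda>n. frame_coords e1 e2 ` (parallel_body K n)"
  define C where "C = frame_coords e1 e2 ` K"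
  have C: "compact C" "C \<noteq> {}" using compact_frame_coords convex_bodyD by (auto simp: C_def)
  define A where "A n = {y. infdist y C \<le> 1 / real (Suc n)}" for n
  have cA: "compact (A n)" for n unfolding A_def by (rule compact_infdist_le[OF C(2,1)]) simp
  have fin: "emeasure lborel (A n) \<noteq> \<infinity>" for n
    using emeasure_compact_finite[OF cA, of n] by (auto simp: top_unique less_top)
  have "decseq A"
    unfolding A_def by (intro decseq_SucI) (auto intro: order_trans simp: frac_le)
  then have "(\<lambda>n. emeasure lborel (A n)) \<longlonglongrightarrow> emeasure lborel (\<Inter>n. A n)"
    using cA fin by (intro Lim_emeasure_decseq) (auto intro: borel_compact)
  moreover have "(\<Inter>n. A n) = C"
  proof
    show "C \<subseteq> (\<Inter>n. A n)" by (auto simp: A_def)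
    show "(\<Inter>n. A n) \<subseteq> C"
    proof
      fix y assume "y \<in> (\<Inter>n. A n)"
      then have le: "infdist y C \<le> 1 / real (Suc n)" for n by (auto simp: A_def)
      have "infdist y C \<le> 0"
        by (rule LIMSEQ_le_const[OF LIMSEQ_inverse_real_of_nat]) (use le in \<open>auto simp: inverse_eq_divide\<close>)
      then have "infdist y C = 0" using infdist_nonneg by (intro antisym)
      then show "y \<in> C" using in_closed_iff_infdist_zero[OF compact_imp_closed[OF C(1)] C(2)] by simp
    qed
  qed
  ultimately have "(\<lambda>n. emeasure lborel (A n)) \<longlonglongrightarrow> emeasure lborel C" by simp
  moreover have "emeasure lborel C \<noteq> \<infinity>" using emeasure_compact_finite[OF C(1)] by simp
  ultimately have lim: "(\<lambda>n. measure lborel (A n)) \<longlonglongrightarrow> measure lborel C"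
    unfolding measure_def by (intro tendsto_enn2real) (auto simp: less_top)
  have sub: "?Q n \<subseteq> A n" for n
  proof (clarsimp simp: A_def simp del: of_nat_Suc)
    fix x assume x: "infdist x K \<le> 1 / real (Suc n)"
    define \<pi> where "\<pi> = closest_point K x"
    have "\<pi> \<in> K" unfolding \<pi>_def by (rule closest_point_in_set[OF convex_bodyD(3,4)])
    then have "infdist (frame_coords e1 e2 x) C \<le> dist (frame_coords e1 e2 x) (frame_coords e1 e2 \<pi>)"
      by (intro infdist_le) (simp add: C_def)
    also have "\<dots> \<le> dist x \<pi>"
    proof -
      have "(norm (frame_coords e1 e2 (x - \<pi>)))\<^sup>2 \<le> (norm (x - \<pi>))\<^sup>2"
      proof -
        have "(norm (frame_coords e1 e2 z))\<^sup>2 = (z \<bullet> e1)\<^sup>2 + (z \<bullet> e2)\<^sup>2" for z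
          by (simp add: frame_coords_def norm_vec_def L2_set_def UNIV_2)
        moreover have "(norm z)\<^sup>2 = (z \<bullet> e1)\<^sup>2 + (z \<bullet> e2)\<^sup>2 + (z \<bullet> u)\<^sup>2" for z
          using norm_frame_combination[OF f, of "z \<bullet> e1" "z \<bullet> e2" "z \<bullet> u"]
          unfolding frame_representation[OF f, of z, symmetric] by simp
        ultimately show ?thesis by simp
      qed
      then have "norm (frame_coords e1 e2 (x - \<pi>)) \<le> norm (x - \<pi>)" by (rule power2_le_imp_le) simp
      then show ?thesis by (simp add: dist_norm linear_diff[OF linear_frame_coords])
    qed
    also have "\<dots> = infdist x K" unfolding \<pi>_def by (rule infdist_eq_dist_closest_point[OF convex_bodyD(3,4), symmetric])
    finally show "infdist (frame_coords e1 e2 x) C \<le> 1 / real (Suc n)" using x by linarith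
  qed
  have bor: "?Q n \<in> sets borel" for n
    by (intro borel_compact compact_frame_coords compact_parallel_body) simp
  have sub2: "C \<subseteq> ?Q n" for n
    unfolding C_def by (intro image_mono) (auto simp: convex_bodyD)
  have m: "measure lborel C \<le> brightness (parallel_body K n) u"
    "brightness (parallel_body K n) u \<le> measure lborel (A n)" for n
  proof -
    have fm: "A n \<in> fmeasurable lborel" "?Q n \<in> fmeasurable lborel"
      using fin[of n] cA[of n] bor[of n]
        emeasure_compact_finite[OF compact_frame_coords[OF compact_parallel_body, of "1 / real (Suc n)" e1 e2]]
      by (auto intro!: fmeasurableI borel_compact simp: less_top)
    have eq: "brightness (parallel_body K n) u = measure lborel (?Q n)"
      using bor[of n] by (simp add: b)
    show "measure lborel C \<le> brightness (parallel_body K n) u"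
      unfolding eq using fm borel_compact[OF C(1)] by (intro measure_mono_fmeasurable sub2) simp_all
    show "brightness (parallel_body K n) u \<le> measure lborel (A n)"
      unfolding eq using fm bor by (intro measure_mono_fmeasurable sub) simp_all
  qed
  have "brightness K u = measure lborel C" using borel_compact[OF C(1)] by (simp add: b C_def)
  then show ?thesis
    using tendsto_sandwich[OF _ _ tendsto_const[of "measure lborel C"] lim] m by (auto intro!: always_eventually)
qed

end

text \<open>Approximates an integral by the level sets of the integrand, so that convergence on sets
  carries over to integrals.\<close>

lemma (in finite_measure) integral_level_sets_approx:
  assumes f [measurable]: "f \<in> borel_measurable M" and f01: "\<And>x. x \<in> space M \<Longrightarrow> 0 \<le> f x \<and> f x \<le> (1::real)"
    and N: "0 < N"
  shows "\<bar>(\<integral>x. f x \<partial>M) - (\<Sum>j=1..N. measure M {x\<in>space M. real j / real N \<le> f x}) / real N\<bar>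
    \<le> measure M (space M) / real N"
proof -
  define s where "s x = (\<Sum>j=1..N. indicator {x\<in>space M. real j / real N \<le> f x} x) / real N" for x
  have close: "\<bar>f x - s x\<bar> \<le> 1 / real N" if x: "x \<in> space M" for x
  proof -
    define w where "w = real N * f x"
    have w: "0 \<le> w" "w \<le> real N" using f01[OF x] N by (auto simp: w_def mult_left_le)
    have "(\<Sum>j=1..N. indicator {x\<in>space M. real j / real N \<le> f x} x) = (\<Sum>j=1..N. of_bool (real j \<le> w) :: real)"
      using x N by (intro sum.cong refl) (simp add: indicator_def w_def field_simps)
    also have "\<dots> = real (card ({1..N} \<inter> {j. real j \<le> w}))"
      by (simp add: of_bool_def sum.If_cases)
    also have "{1..N} \<inter> {j. real j \<le> w} = {1..nat \<lfloor>w\<rfloor>}"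
      using w by (auto simp: le_nat_iff le_floor_iff)
    finally have "real N * s x = real (nat \<lfloor>w\<rfloor>)" using N by (simp add: s_def)
    then have "real N * s x = of_int \<lfloor>w\<rfloor>" using w by simp
    then have "\<bar>w - real N * s x\<bar> \<le> 1" by linarith
    moreover have "w - real N * s x = real N * (f x - s x)" by (simp add: w_def right_diff_distrib)
    ultimately have "real N * \<bar>f x - s x\<bar> \<le> 1" using N by (simp add: abs_mult)
    then show ?thesis using N by (simp add: field_simps)
  qed
  have int_s: "integrable M s"
    unfolding s_def by (intro integrable_divide Bochner_Integration.integrable_sum integrable_real_indicator)
      (auto simp: emeasure_finite less_top[symmetric])
  have "integrable M f"
    by (rule integrable_const_bound[where B = 1]) (auto intro!: AE_I2 simp: f01)
  then have "(\<integral>x. f x \<partial>M) - (\<integral>x. s x \<partial>M) = (\<integral>x. f x - s x \<partial>M)" using int_s by simp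
  also have "\<bar>\<dots>\<bar> \<le> (\<integral>x. \<bar>f x - s x\<bar> \<partial>M)" by (rule integral_abs_bound)
  also have "\<dots> \<le> (\<integral>x. 1 / real N \<partial>M)"
    using \<open>integrable M f\<close> int_s close by (intro integral_mono) auto
  also have "\<dots> = measure M (space M) / real N" by simp
  finally have "\<bar>(\<integral>x. f x \<partial>M) - (\<integral>x. s x \<partial>M)\<bar> \<le> measure M (space M) / real N" .
  moreover have "(\<integral>x. s x \<partial>M) = (\<Sum>j=1..N. measure M {x\<in>space M. real j / real N \<le> f x}) / real N"
    unfolding s_def by (subst integral_divide_zero, subst Bochner_Integration.integral_sum)
      (auto intro!: integrable_real_indicator simp: emeasure_finite less_top[symmetric])
  ultimately show ?thesis by simp
qed

section \<open>Thin shells and the surface area measure\<close>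

context
  fixes K :: "(real^3) set"
  assumes K: "convex_body K"
begin

abbreviation (input) "shell_space n \<equiv> restrict_space lborel (shell K (1 / real (Suc n)))"

lemma finite_measure_shell: "finite_measure (shell_space n)"
proof (rule finite_measureI)
  have "emeasure lborel (shell K (1 / real (Suc n))) \<le> emeasure lborel (parallel_body K n)"
    by (intro emeasure_mono) (auto simp: shell_def borel_compact[OF compact_parallel_body[OF K]])
  also have "\<dots> < \<infinity>"
    by (intro emeasure_compact_finite compact_parallel_body[OF K]) simp
  finally show "emeasure (shell_space n) (space (shell_space n)) \<noteq> \<infinity>"
    by (simp add: space_restrict_space emeasure_restrict_space)
qed

lemma norm_outer_normal: "x \<in> shell K \<epsilon> \<Longrightarrow> norm (outer_normal K x) = 1"
  using convex_bodyD[OF K] infdist_eq_dist_closest_point[of K x]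
  by (auto simp: shell_def outer_normal_def norm_sgn)

lemma outer_normal_measurable_shell [measurable]: "outer_normal K \<in> borel_measurable (shell_space n)"
  by (rule measurable_restrict_space1) (simp add: outer_normal_borel_measurable[OF K])

lemma abs_inner_outer_normal:
  assumes "norm u = 1" "x \<in> space (shell_space n)"
  shows "0 \<le> \<bar>u \<bullet> outer_normal K x\<bar> \<and> \<bar>u \<bullet> outer_normal K x\<bar> \<le> 1"
  using Cauchy_Schwarz_ineq2[of u "outer_normal K x"] assms norm_outer_normal[of x]
  by (auto simp: space_restrict_space)

lemma integrable_shell: "integrable (shell_space n) (\<lambda>x. \<bar>u \<bullet> outer_normal K x\<bar>)"
proof -
  interpret finite_measure "shell_space n" by (rule finite_measure_shell)
  show ?thesis
  proof (rule integrable_const_bound[where B = "norm u"])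
    show "AE x in shell_space n. norm \<bar>u \<bullet> outer_normal K x\<bar> \<le> norm u"
    proof (rule AE_I2)
      fix x assume "x \<in> space (shell_space n)"
      then have "norm (outer_normal K x) = 1" using norm_outer_normal[of x] by (simp add: space_restrict_space)
      then show "norm \<bar>u \<bullet> outer_normal K x\<bar> \<le> norm u"
        using Cauchy_Schwarz_ineq2[of u "outer_normal K x"] by simp
    qed
  qed measurable
qed

abbreviation (input) "shell_integral n u \<equiv> (\<integral>x. \<bar>u \<bullet> outer_normal K x\<bar> \<partial>shell_space n)"

text \<open>Divided by the thickness, the two shell bounds enclose the integral between twice the
  brightness of \<open>K\<close> and twice that of its parallel body.\<close>

lemma brightness_shell_tendsto:
  assumes u: "norm u = 1"
  shows "(\<lambda>n. shell_integral n u * real (Suc n)) \<longlonglongrightarrow> 2 * brightness K u"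
proof (rule tendsto_sandwich[OF _ _ tendsto_const])
  have eq: "(\<integral>\<^sup>+x. ennreal \<bar>u \<bullet> outer_normal K x\<bar> * indicator (shell K (1 / real (Suc n))) x \<partial>lborel)
      = ennreal (shell_integral n u)" for n
    by (subst nn_integral_restrict_space[symmetric], simp)
      (rule nn_integral_eq_integral[OF integrable_shell], simp)
  have b0: "0 \<le> brightness C u" for C
    by (simp add: brightness_def plane_area_def Let_def case_prod_beta)
  show "\<forall>\<^sub>F n in sequentially. 2 * brightness K u \<le> shell_integral n u * real (Suc n)"
  proof (rule always_eventually, rule allI)
    fix n
    have "2 * (1 / real (Suc n)) * brightness K u \<le> shell_integral n u"
    proof (rule ennreal_le_iff[THEN iffD1])
      show "ennreal (2 * (1 / real (Suc n)) * brightness K u) \<le> ennreal (shell_integral n u)"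
        unfolding eq[symmetric] by (rule nn_integral_shell_bounds(1)[OF K u]) simp
    qed (use b0 in simp)
    then show "2 * brightness K u \<le> shell_integral n u * real (Suc n)"
      by (simp add: field_simps)
  qed
  show "\<forall>\<^sub>F n in sequentially. shell_integral n u * real (Suc n)
      \<le> 2 * brightness (parallel_body K n) u"
  proof (rule always_eventually, rule allI)
    fix n
    have "shell_integral n u \<le> 2 * (1 / real (Suc n)) * brightness (parallel_body K n) u"
    proof (rule ennreal_le_iff[THEN iffD1])
      show "ennreal (shell_integral n u) \<le> ennreal (2 * (1 / real (Suc n)) * brightness (parallel_body K n) u)"
        unfolding eq[symmetric] by (rule nn_integral_shell_bounds(2)[OF K u]) simp
    qed (use b0 in simp)
    then show "shell_integral n u * real (Suc n)
      \<le> 2 * brightness (parallel_body K n) u"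
      by (simp add: field_simps)
  qed
  show "(\<lambda>n. 2 * brightness (parallel_body K n) u) \<longlonglongrightarrow> 2 * brightness K u"
    by (intro tendsto_mult tendsto_const brightness_parallel_body_tendsto[OF K u])
qed

lemma continuous_on_brightness: "continuous_on (sphere 0 1) (brightness K)"
proof -
  \<comment> \<open>A substitute for the limit of the scaled shell volumes, built from limits
    already known: the norm of a normal is at most the sum of its absolute coordinates, and each
    coordinate gives a shell integral in an axis direction.\<close>
  define L where "L = (\<Sum>i\<in>UNIV. 2 * brightness K (axis (i::3) 1))"
  define \<phi> where "\<phi> n u = shell_integral n u * real (Suc n)" for n u
  have lim: "(\<lambda>n. \<phi> n u) \<longlonglongrightarrow> 2 * brightness K u" if "norm u = 1" for u
    unfolding \<phi>_def by (rule brightness_shell_tendsto[OF that])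
  have \<phi>_le: "\<bar>\<phi> n u - \<phi> n v\<bar> \<le> norm (u - v) * (\<Sum>i\<in>UNIV. \<phi> n (axis (i::3) 1))" for n u v
  proof -
    interpret finite_measure "shell_space n" by (rule finite_measure_shell)
    have "\<bar>shell_integral n u - shell_integral n v\<bar>
        = \<bar>\<integral>x. \<bar>u \<bullet> outer_normal K x\<bar> - \<bar>v \<bullet> outer_normal K x\<bar> \<partial>shell_space n\<bar>"
      by (rule arg_cong[where f = abs], rule Bochner_Integration.integral_diff[symmetric, OF integrable_shell integrable_shell])
    also have "\<dots> \<le> (\<integral>x. \<bar>\<bar>u \<bullet> outer_normal K x\<bar> - \<bar>v \<bullet> outer_normal K x\<bar>\<bar> \<partial>shell_space n)"
      by (rule integral_abs_bound)
    also have "\<dots> \<le> (\<integral>x. norm (u - v) * (\<Sum>i\<in>UNIV. \<bar>axis (i::3) 1 \<bullet> outer_normal K x\<bar>) \<partial>shell_space n)"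
    proof (rule integral_mono)
      fix x
      have "\<bar>\<bar>u \<bullet> outer_normal K x\<bar> - \<bar>v \<bullet> outer_normal K x\<bar>\<bar> \<le> \<bar>(u - v) \<bullet> outer_normal K x\<bar>"
        by (simp add: inner_diff_left abs_triangle_ineq3)
      also have "\<dots> \<le> norm (u - v) * norm (outer_normal K x)" by (rule Cauchy_Schwarz_ineq2)
      also have "norm (outer_normal K x) \<le> (\<Sum>i\<in>UNIV. \<bar>axis (i::3) 1 \<bullet> outer_normal K x\<bar>)"
        using norm_le_l1_cart[of "outer_normal K x"] by (simp add: inner_axis')
      finally show "\<bar>\<bar>u \<bullet> outer_normal K x\<bar> - \<bar>v \<bullet> outer_normal K x\<bar>\<bar>
          \<le> norm (u - v) * (\<Sum>i\<in>UNIV. \<bar>axis (i::3) 1 \<bullet> outer_normal K x\<bar>)"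
        by (simp add: mult_left_mono)
    qed (rule integrable_abs[OF Bochner_Integration.integrable_diff[OF integrable_shell integrable_shell]],
        intro integrable_mult_right Bochner_Integration.integrable_sum integrable_shell)
    also have "\<dots> = norm (u - v) * (\<Sum>i\<in>UNIV. shell_integral n (axis (i::3) 1))"
      by (simp only: integral_mult_right_zero Bochner_Integration.integral_sum[OF integrable_shell])
    finally have *: "\<bar>shell_integral n u - shell_integral n v\<bar>
        \<le> norm (u - v) * (\<Sum>i\<in>UNIV. shell_integral n (axis (i::3) 1))" .
    have "\<bar>\<phi> n u - \<phi> n v\<bar> = \<bar>shell_integral n u - shell_integral n v\<bar> * real (Suc n)"
      unfolding \<phi>_def left_diff_distrib[symmetric] abs_mult by simp
    also have "\<dots> \<le> norm (u - v) * (\<Sum>i\<in>UNIV. shell_integral n (axis (i::3) 1)) * real (Suc n)"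
      using * by (rule mult_right_mono) simp
    also have "\<dots> = norm (u - v) * (\<Sum>i\<in>UNIV. \<phi> n (axis (i::3) 1))"
      by (simp only: \<phi>_def sum_distrib_right mult.assoc)
    finally show ?thesis .
  qed
  have lip: "\<bar>2 * brightness K u - 2 * brightness K v\<bar> \<le> norm (u - v) * L" if "norm u = 1" "norm v = 1" for u v
  proof (rule LIMSEQ_le)
    show "(\<lambda>n. \<bar>\<phi> n u - \<phi> n v\<bar>) \<longlonglongrightarrow> \<bar>2 * brightness K u - 2 * brightness K v\<bar>"
      by (intro tendsto_rabs tendsto_diff lim that)
    show "(\<lambda>n. norm (u - v) * (\<Sum>i\<in>UNIV. \<phi> n (axis (i::3) 1))) \<longlonglongrightarrow> norm (u - v) * L"
      unfolding L_def by (intro tendsto_mult tendsto_const tendsto_sum lim) simp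
  qed (use \<phi>_le in blast)
  have "0 \<le> L"
    unfolding L_def by (intro sum_nonneg) (simp add: brightness_def plane_area_def Let_def case_prod_beta)
  have "(L / 2)-lipschitz_on (sphere 0 1) (brightness K)"
  proof (rule lipschitz_onI)
    fix u v :: "real^3" assume "u \<in> sphere 0 1" "v \<in> sphere 0 1"
    then show "dist (brightness K u) (brightness K v) \<le> L / 2 * dist u v"
      using lip[of u v] unfolding dist_real_def dist_norm right_diff_distrib[symmetric] abs_mult
      by (simp add: mult.commute)
  qed (use \<open>0 \<le> L\<close> in simp)
  then show ?thesis by (rule lipschitz_on_continuous_on)
qed

text \<open>The limits are taken in a fixed order. With \<open>N\<close> fixed the thickness tends
  to 0, where the hypothesis on \<open>S\<close> applies to each level set; then \<open>N\<close>
  grows. Twice the brightness and the integral over \<open>S\<close> both lie within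
  \<open>measure S (space S) / N\<close> of the same sum.\<close>

lemma Cauchy_projection_formula:
  assumes S: "surface_area_measure K S" and u: "norm u = 1"
  shows "brightness K u = 1/2 * (\<integral>n. \<bar>u \<bullet> n\<bar> \<partial>S)"
proof -
  interpret S: finite_measure S using S by (simp add: surface_area_measure_def finite_sphere_measure_def)
  have sS: "sets S = sets (restrict_space borel (sphere 0 1))"
    using S by (simp add: surface_area_measure_def finite_sphere_measure_def)
  have spS: "space S = sphere 0 1" using sets_eq_imp_space_eq[OF sS] by (simp add: space_restrict_space)
  have mS [measurable]: "(\<lambda>n. n) \<in> S \<rightarrow>\<^sub>M borel"
    unfolding measurable_cong_sets[OF sS refl] by (rule measurable_restrict_space1) simp
  let ?L = "\<lambda>n A. measure lebesgue (local_parallel_set K (1 / real (Suc n)) A)"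
  have "\<bar>2 * brightness K u - (\<integral>n. \<bar>u \<bullet> n\<bar> \<partial>S)\<bar> \<le> 2 * measure S (space S) / real N" if N: "0 < N" for N :: nat
  proof -
    define \<omega> where "\<omega> j = {n\<in>space S. real j / real N \<le> \<bar>u \<bullet> n\<bar>}" for j :: nat
    have \<omega>: "\<omega> j \<in> sets S" for j unfolding \<omega>_def by measurable
    have seq: "filterlim (\<lambda>n. 1 / real (Suc n)) (at_right 0) sequentially"
      using LIMSEQ_inverse_real_of_nat by (intro tendsto_imp_filterlim_at_right) (auto simp: inverse_eq_divide)
    have lps: "(\<lambda>n. ?L n A * real (Suc n)) \<longlonglongrightarrow> measure S A" if "A \<in> sets S" for A
    proof -
      have "((\<lambda>\<epsilon>. measure lebesgue (local_parallel_set K \<epsilon> A) / \<epsilon>) \<longlongrightarrow> measure S A) (at_right 0)"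
        using S that by (simp add: surface_area_measure_def)
      from filterlim_compose[OF this seq] show ?thesis by simp
    qed
    \<comment> \<open>A shell point is classified by its outer normal, so the level sets of the
      integrand on the shell are local parallel sets.\<close>
    have shell: "local_parallel_set K \<epsilon> A = {x \<in> shell K \<epsilon>. outer_normal K x \<in> A}" for \<epsilon> A
      using in_closed_iff_infdist_zero[OF convex_bodyD(3,4)[OF K]] infdist_nonneg[of _ K]
      by (auto simp: local_parallel_set_def shell_def outer_normal_def less_le)
    have vol: "?L n (\<omega> j)
        = measure (shell_space n) {x\<in>space (shell_space n). real j / real N \<le> \<bar>u \<bullet> outer_normal K x\<bar>}" for n j
    proof -
      have "local_parallel_set K (1 / real (Suc n)) (\<omega> j)
          = {x\<in>space (shell_space n). real j / real N \<le> \<bar>u \<bullet> outer_normal K x\<bar>}"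
        using norm_outer_normal by (auto simp: shell \<omega>_def spS space_restrict_space)
      moreover have "{x\<in>shell K (1 / real (Suc n)). real j / real N \<le> \<bar>u \<bullet> outer_normal K x\<bar>} \<in> sets borel"
        using outer_normal_borel_measurable[OF K] by measurable
      ultimately show ?thesis
        by (subst measure_restrict_space) (auto simp: space_restrict_space)
    qed
    have vol0: "?L n (space S) = measure (shell_space n) (space (shell_space n))" for n
    proof -
      have "local_parallel_set K (1 / real (Suc n)) (space S) = shell K (1 / real (Suc n))"
        using norm_outer_normal by (auto simp: shell spS)
      then show ?thesis by (simp add: space_restrict_space measure_restrict_space)
    qed
    define \<Phi> where "\<Phi> n = shell_integral n u" for n
    have step: "\<bar>\<Phi> n * real (Suc n) - (\<Sum>j=1..N. ?L n (\<omega> j) * real (Suc n)) / real N\<bar>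
        \<le> ?L n (space S) * real (Suc n) / real N" for n
    proof -
      interpret F: finite_measure "shell_space n" by (rule finite_measure_shell)
      have "\<bar>\<Phi> n - (\<Sum>j=1..N. ?L n (\<omega> j)) / real N\<bar>
          \<le> ?L n (space S) / real N"
        unfolding vol vol0 \<Phi>_def by (rule F.integral_level_sets_approx[OF _ abs_inner_outer_normal[OF u] N]) measurable
      then have "\<bar>\<Phi> n - (\<Sum>j=1..N. ?L n (\<omega> j)) / real N\<bar> * real (Suc n)
          \<le> ?L n (space S) / real N * real (Suc n)"
        by (rule mult_right_mono) simp
      moreover have "\<bar>\<Phi> n - (\<Sum>j=1..N. ?L n (\<omega> j)) / real N\<bar> * real (Suc n)
         = \<bar>\<Phi> n * real (Suc n) - (\<Sum>j=1..N. ?L n (\<omega> j) * real (Suc n)) / real N\<bar>"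
        unfolding sum_distrib_right[symmetric] times_divide_eq_left[symmetric] left_diff_distrib[symmetric] abs_mult by simp
      ultimately show ?thesis by (simp only: times_divide_eq_left)
    qed
    have "\<bar>2 * brightness K u - (\<Sum>j=1..N. measure S (\<omega> j)) / real N\<bar> \<le> measure S (space S) / real N"
    proof (rule LIMSEQ_le)
      show "(\<lambda>n. \<bar>\<Phi> n * real (Suc n) - (\<Sum>j=1..N. ?L n (\<omega> j) * real (Suc n)) / real N\<bar>)
          \<longlonglongrightarrow> \<bar>2 * brightness K u - (\<Sum>j=1..N. measure S (\<omega> j)) / real N\<bar>"
        unfolding \<Phi>_def using N
        by (intro tendsto_rabs tendsto_diff brightness_shell_tendsto[OF u] tendsto_divide tendsto_sum lps \<omega> tendsto_const) simp
      show "(\<lambda>n. ?L n (space S) * real (Suc n) / real N)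
          \<longlonglongrightarrow> measure S (space S) / real N"
        using N by (intro tendsto_divide lps sets.top tendsto_const) simp
    qed (use step in blast)
    moreover have "\<bar>(\<integral>n. \<bar>u \<bullet> n\<bar> \<partial>S) - (\<Sum>j=1..N. measure S (\<omega> j)) / real N\<bar> \<le> measure S (space S) / real N"
      unfolding \<omega>_def
    proof (rule S.integral_level_sets_approx[OF _ _ N])
      fix n assume "n \<in> space S"
      then show "0 \<le> \<bar>u \<bullet> n\<bar> \<and> \<bar>u \<bullet> n\<bar> \<le> 1"
        using Cauchy_Schwarz_ineq2[of u n] u by (simp add: spS)
    qed measurable
    ultimately show ?thesis by (simp add: abs_le_iff)
  qed
  then have le: "\<bar>2 * brightness K u - (\<integral>n. \<bar>u \<bullet> n\<bar> \<partial>S)\<bar> \<le> 2 * measure S (space S) * inverse (real (Suc n))" for n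
    using zero_less_Suc[of n] unfolding divide_inverse by blast
  have "(\<lambda>n. 2 * measure S (space S) * inverse (real (Suc n))) \<longlonglongrightarrow> 2 * measure S (space S) * 0"
    by (intro tendsto_mult tendsto_const LIMSEQ_inverse_real_of_nat)
  then have "\<bar>2 * brightness K u - (\<integral>n. \<bar>u \<bullet> n\<bar> \<partial>S)\<bar> \<le> 2 * measure S (space S) * 0"
    by (rule LIMSEQ_le_const) (use le in blast)
  then show ?thesis by simp
qed

end

context uniform_direction
begin

lemma variance_brightness_eq_0_iff:
  assumes "convex_body K"
  shows "variance (\<lambda>x. brightness K (U x)) = 0 \<longleftrightarrow> constant_brightness K"
  unfolding constant_brightness_def by (rule variance_eq_0_iff_constant[OF continuous_on_brightness[OF assms]])

lemma variance_brightness: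
  assumes K: "convex_body K" and S: "surface_area_measure K S"
  shows "variance (\<lambda>x. brightness K (U x)) = 1/4 * (\<integral>n. (\<integral>n'. k2 \<bar>n \<bullet> n'\<bar> \<partial>S) \<partial>S)"
proof -
  have fS: "finite_sphere_measure S" using S by (simp add: surface_area_measure_def)
  \<comment> \<open>The integral over \<open>S\<close> represents twice the brightness; undoing the
    doubling is the origin of the factor 1/4.\<close>
  have sq: "(x - y)\<^sup>2 = 1/4 * (2 * x - 2 * y)\<^sup>2" for x y :: real
    by (simp add: power2_eq_square algebra_simps)
  have "variance (\<lambda>x. brightness K (U x))
      = expectation (\<lambda>x. 1/4 * (2 * brightness K (U x) - 2 * expectation (\<lambda>x. brightness K (U x)))\<^sup>2)"
    by (rule Bochner_Integration.integral_cong[OF refl sq])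
  also have "\<dots> = 1/4 * variance (\<lambda>x. 2 * brightness K (U x))"
    unfolding integral_mult_right_zero ..
  also have "variance (\<lambda>x. 2 * brightness K (U x)) = (\<integral>n. (\<integral>n'. k2 \<bar>n \<bullet> n'\<bar> \<partial>S) \<partial>S)"
    by (rule variance_generated[OF fS]) (simp add: Cauchy_projection_formula[OF K S])
  finally show ?thesis .
qed

end

section \<open>Polytopes\<close>

lemma inner_frame_expansion:
  assumes f: "orthonormal_frame e1 e2 e3"
  shows "x \<bullet> y = (x \<bullet> e1) * (y \<bullet> e1) + (x \<bullet> e2) * (y \<bullet> e2) + (x \<bullet> e3) * (y \<bullet> e3)"
proof -
  have "x \<bullet> y = ((x \<bullet> e1) *\<^sub>R e1 + (x \<bullet> e2) *\<^sub>R e2 + (x \<bullet> e3) *\<^sub>R e3) \<bullet> y"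
    using frame_representation[OF f, of x] by simp
  then show ?thesis unfolding inner_add_left inner_scaleR_left by (simp only: inner_commute)
qed

text \<open>A point of the plane \<open>n \<bullet> x = k\<close> has coordinates \<open>y\<close> in the frame \<open>f1, f2, n\<close>; the projection
  along \<open>u\<close> acts on \<open>y\<close> as an affine map, whose determinant is a cofactor of an orthogonal matrix.\<close>

lemma measure_frame_coords_plane:
  assumes f: "orthonormal_frame f1 f2 n" and e: "orthonormal_frame e1 e2 u"
    and F: "compact F" "\<And>x. x \<in> F \<Longrightarrow> n \<bullet> x = k"
  shows "measure lebesgue (frame_coords e1 e2 ` F) = \<bar>u \<bullet> n\<bar> * measure lebesgue (frame_coords f1 f2 ` F)"
proof -
  define A :: "real^2 \<Rightarrow> real^2" where "A y = frame_coords e1 e2 (y$1 *\<^sub>R f1 + y$2 *\<^sub>R f2)" for y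
  define c where "c = frame_coords e1 e2 (k *\<^sub>R n)"
  note lin = linear_frame_coords[of e1 e2]
  have "linear A"
    unfolding A_def by (rule linearI) (simp_all add: linear_add[OF lin] linear_scale[OF lin] algebra_simps)
  have eq: "frame_coords e1 e2 x = c + A (frame_coords f1 f2 x)" if "x \<in> F" for x
  proof -
    have "x = (x \<bullet> f1) *\<^sub>R f1 + (x \<bullet> f2) *\<^sub>R f2 + k *\<^sub>R n"
      using frame_representation[OF f, of x] F(2)[OF that] by (simp add: inner_commute)
    then have "frame_coords e1 e2 x = frame_coords e1 e2 ((x \<bullet> f1) *\<^sub>R f1 + (x \<bullet> f2) *\<^sub>R f2) + c"
      unfolding c_def by (metis linear_add[OF lin])
    then show ?thesis by (simp add: A_def frame_coords_def[of f1 f2] add.commute)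
  qed
  then have "frame_coords e1 e2 ` F = (+) c ` (A ` (frame_coords f1 f2 ` F))"
    by (simp add: image_image)
  then have "measure lebesgue (frame_coords e1 e2 ` F) = measure lebesgue (A ` (frame_coords f1 f2 ` F))"
    by (simp only: measure_translation)
  also have "\<dots> = \<bar>det (matrix A)\<bar> * measure lebesgue (frame_coords f1 f2 ` F)"
    by (intro measure_linear_image \<open>linear A\<close> lmeasurable_compact compact_frame_coords F(1))
  also have "\<bar>det (matrix A)\<bar> = \<bar>u \<bullet> n\<bar>"
  proof -
    \<comment> \<open>Entries of an orthogonal matrix apart from the row of \<open>u\<close>; the
      relations of the other two rows determine their minor up to sign as the cofactor
      \<open>u \<bullet> n\<close>.\<close>
    define a b c d p q where "a = f1 \<bullet> e1" and "b = f2 \<bullet> e1" and "c = f1 \<bullet> e2" and "d = f2 \<bullet> e2"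
      and "p = n \<bullet> e1" and "q = n \<bullet> e2"
    have det: "det (matrix A) = a * d - b * c"
      by (simp add: det_2 matrix_def A_def frame_coords_def a_def b_def c_def d_def axis_def)
    have "a * a + b * b + p * p = 1" "c * c + d * d + q * q = 1" "a * c + b * d + p * q = 0"
      using inner_frame_expansion[OF f, of e1 e1] inner_frame_expansion[OF f, of e2 e2]
        inner_frame_expansion[OF f, of e1 e2] orthonormal_frameD[OF e]
      by (simp_all add: a_def b_def c_def d_def p_def q_def inner_commute)
    moreover have "p * p + q * q + (u \<bullet> n) * (u \<bullet> n) = 1"
      using inner_frame_expansion[OF e, of n n] orthonormal_frameD[OF f]
      by (simp add: p_def q_def inner_commute)
    \<comment> \<open>Lagrange's identity expresses the squared determinant by the inner products
      just computed.\<close>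
    moreover have "(a * d - b * c)\<^sup>2 = (a * a + b * b) * (c * c + d * d) - (a * c + b * d)\<^sup>2"
      by (simp add: power2_eq_square algebra_simps)
    ultimately have "(a * d - b * c)\<^sup>2 = (1 - p * p) * (1 - q * q) - (- (p * q))\<^sup>2"
      by (metis add_diff_cancel_right' add_eq_0_iff2)
    also have "\<dots> = 1 - p * p - q * q" by (simp add: power2_eq_square algebra_simps)
    also have "\<dots> = (u \<bullet> n)\<^sup>2" using \<open>p * p + q * q + (u \<bullet> n) * (u \<bullet> n) = 1\<close> by (simp add: power2_eq_square)
    finally show ?thesis unfolding det by (simp only: power2_eq_iff abs_eq_iff)
  qed
  finally show ?thesis .
qed

text \<open>A plane containing the direction \<open>u\<close> is seen from that direction as a line.
  This disposes of facets parallel to \<open>u\<close> and of the common parts of two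
  facets.\<close>

lemma negligible_frame_coords_line:
  assumes e: "orthonormal_frame e1 e2 u" and w: "w \<bullet> u = 0" "w \<noteq> 0" and G: "\<And>x. x \<in> G \<Longrightarrow> w \<bullet> x = c"
  shows "negligible (frame_coords e1 e2 ` G)"
proof (rule negligible_subset)
  have "vector [w \<bullet> e1, w \<bullet> e2] \<noteq> (0 :: real^2)"
  proof
    assume "vector [w \<bullet> e1, w \<bullet> e2] = (0 :: real^2)"
    then have "w \<bullet> e1 = 0" "w \<bullet> e2 = 0" by (metis vector_2 zero_index)+
    then have "w = 0" using frame_representation[OF e, of w] w(1) by simp
    then show False using w(2) by simp
  qed
  then show "negligible {y. vector [w \<bullet> e1, w \<bullet> e2] \<bullet> (y :: real^2) = c}"
    by (intro negligible_hyperplane) simp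
  show "frame_coords e1 e2 ` G \<subseteq> {y. vector [w \<bullet> e1, w \<bullet> e2] \<bullet> y = c}"
  proof (rule image_subsetI)
    fix x assume "x \<in> G"
    have "vector [w \<bullet> e1, w \<bullet> e2] \<bullet> frame_coords e1 e2 x = (w \<bullet> e1) * (x \<bullet> e1) + (w \<bullet> e2) * (x \<bullet> e2)"
      by (simp add: frame_coords_def inner_vec_def sum_2)
    also have "\<dots> = w \<bullet> x" using inner_frame_expansion[OF e, of w x] w(1) by simp
    finally show "frame_coords e1 e2 x \<in> {y. vector [w \<bullet> e1, w \<bullet> e2] \<bullet> y = c}" using G[OF \<open>x \<in> G\<close>] by simp
  qed
qed

section \<open>Facet normals and half-spaces\<close>

lemma unit_normals_of_plane:
  assumes n: "norm n = 1" and n': "norm (n' :: real^3) = 1" and eq: "{x. n \<bullet> x = k} = {x. n' \<bullet> x = k'}"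
  shows "n' = n \<or> n' = - n"
proof -
  \<comment> \<open>The part of \<open>n'\<close> orthogonal to \<open>n\<close>. A shift by
    \<open>w\<close> stays in the plane and so keeps the inner product with \<open>n'\<close> fixed,
    which forces \<open>w = 0\<close>.\<close>
  define w where "w = n' - (n' \<bullet> n) *\<^sub>R n"
  have nn: "n \<bullet> n = 1" "n' \<bullet> n' = 1" using n n' by (simp_all add: norm_eq_1)
  have w: "n \<bullet> w = 0" using nn by (simp add: w_def inner_diff_right inner_commute)
  have x0: "k *\<^sub>R n \<in> {x. n \<bullet> x = k}" using nn by simp
  moreover have "k *\<^sub>R n + w \<in> {x. n \<bullet> x = k}" using nn w by (simp add: inner_add_right)
  ultimately have "n' \<bullet> (k *\<^sub>R n) = k'" "n' \<bullet> (k *\<^sub>R n + w) = k'" unfolding eq by auto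
  then have "n' \<bullet> w = 0" by (simp add: inner_add_right)
  then have "w \<bullet> w = 0" using w by (simp add: w_def inner_diff_left inner_commute)
  then have n'_eq: "n' = (n' \<bullet> n) *\<^sub>R n" by (simp add: w_def)
  then have "\<bar>n' \<bullet> n\<bar> = 1" using n n' by (metis norm_scaleR mult.right_neutral)
  then show ?thesis using n'_eq by (metis abs_eq_iff abs_1 scaleR_minus1_left scaleR_one)
qed

lemma plane_no_interior:
  assumes "norm (n :: real^3) = 1" "P \<subseteq> {x. n \<bullet> x = k}"
  shows "interior P = {}"
proof -
  have "n \<noteq> 0" using assms(1) by auto
  then show ?thesis using interior_mono[OF assms(2)] by simp
qed

text \<open>The affine hull of a facet is a whole plane, so a supporting unit normal can only be
  \<open>n\<close> or \<open>- n\<close>; the latter would flatten \<open>P\<close> into that plane,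
  against its interior.\<close>

lemma facet_normal_eq:
  assumes F: "F facet_of P" and int: "interior P \<noteq> {}"
    and n: "norm n = 1" and P: "\<And>x. x \<in> P \<Longrightarrow> n \<bullet> x \<le> k" and Fk: "\<And>x. x \<in> F \<Longrightarrow> n \<bullet> x = k"
  shows "facet_normal P F = n"
  unfolding facet_normal_def
proof (rule the_equality)
  show "norm n = 1 \<and> (\<forall>x\<in>F. \<forall>y\<in>P. n \<bullet> y \<le> n \<bullet> x)" using n P Fk by simp
next
  fix n' assume n': "norm n' = 1 \<and> (\<forall>x\<in>F. \<forall>y\<in>P. n' \<bullet> y \<le> n' \<bullet> x)"
  have FP: "F \<subseteq> P" "F \<noteq> {}" using F by (auto simp: facet_of_def dest: face_of_imp_subset)
  then obtain x0 where x0: "x0 \<in> F" by auto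
  have "aff_dim P = aff_dim (affine hull P)" by simp
  then have "aff_dim P = 3" unfolding affine_hull_nonempty_interior[OF int] by simp
  then have dF: "aff_dim (affine hull F) = 2" using F by (simp add: facet_of_def)
  have hull: "affine hull F = {x. m \<bullet> x = c}" if m: "norm m = 1" "\<And>x. x \<in> F \<Longrightarrow> m \<bullet> x = c" for m :: "real^3" and c
  proof (rule affine_dim_equal)
    show "affine hull F \<subseteq> {x. m \<bullet> x = c}"
      using m by (intro hull_minimal affine_hyperplane) auto
    have "m \<noteq> 0" using m by auto
    then show "aff_dim (affine hull F) = aff_dim {x. m \<bullet> x = c}" unfolding dF by simp
  qed (use FP in \<open>auto simp: affine_hyperplane\<close>)
  have F': "n' \<bullet> x = n' \<bullet> x0" if "x \<in> F" for x
    using n' that x0 FP(1) by (intro antisym) auto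
  have "{x. n \<bullet> x = k} = {x. n' \<bullet> x = n' \<bullet> x0}"
    using hull[OF n Fk] hull[of n' "n' \<bullet> x0"] n' F' by auto
  then have "n' = n \<or> n' = - n" using n n' by (intro unit_normals_of_plane) auto
  moreover have "n' \<noteq> - n"
  proof
    assume "n' = - n"
    then have "k \<le> n \<bullet> y" if "y \<in> P" for y using n' x0 Fk[OF x0] that by force
    then have "P \<subseteq> {x. n \<bullet> x = k}" using P by (auto intro: antisym)
    then show False using plane_no_interior[OF n] int by blast
  qed
  ultimately show "n' = n" by simp
qed

text \<open>In a minimal family of half-spaces each one cuts out a facet and every facet arises so;
  normalized, the family becomes a description of \<open>P\<close> indexed by its facets. The
  interior makes the affine hull the whole space.\<close>

lemma polytope_facet_halfspaces:
  assumes P: "polytope P" and int: "interior P \<noteq> {}"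
  obtains k where "\<And>F. F \<in> facets P \<Longrightarrow> norm (facet_normal P F) = 1"
    "\<And>F x. F \<in> facets P \<Longrightarrow> x \<in> P \<Longrightarrow> facet_normal P F \<bullet> x \<le> k F"
    "\<And>F. F \<in> facets P \<Longrightarrow> F = P \<inter> {x. facet_normal P F \<bullet> x = k F}"
    "\<And>x. (\<And>F. F \<in> facets P \<Longrightarrow> facet_normal P F \<bullet> x \<le> k F) \<Longrightarrow> x \<in> P"
proof -
  have "polyhedron P" using P by (rule polytope_imp_polyhedron)
  then obtain H where H: "finite H" "P = affine hull P \<inter> \<Inter>H"
    "\<forall>h\<in>H. \<exists>a b. a \<noteq> 0 \<and> h = {x. a \<bullet> x \<le> b}" "\<forall>H'. H' \<subset> H \<longrightarrow> P \<subset> affine hull P \<inter> \<Inter>H'"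
    unfolding polyhedron_Int_affine_minimal by blast
  from H(3) obtain a b where ab: "\<And>h. h \<in> H \<Longrightarrow> a h \<noteq> 0 \<and> h = {x. a h \<bullet> x \<le> b h}" by metis
  have fac: "F facet_of P \<longleftrightarrow> (\<exists>h. h \<in> H \<and> F = P \<inter> {x. a h \<bullet> x = b h})" for F
    by (rule facet_of_polyhedron_explicit[OF H(1,2) ab]) (use H(4) in auto)
  have PH: "P = \<Inter>H" using H(2) unfolding affine_hull_nonempty_interior[OF int] by simp
  define \<nu> where "\<nu> h = a h /\<^sub>R norm (a h)" for h
  define c where "c h = b h / norm (a h)" for h
  have \<nu>: "norm (\<nu> h) = 1" if "h \<in> H" for h using ab[OF that] by (simp add: \<nu>_def)
  have \<nu>_le: "\<nu> h \<bullet> x \<le> c h \<longleftrightarrow> a h \<bullet> x \<le> b h" and \<nu>_eq: "\<nu> h \<bullet> x = c h \<longleftrightarrow> a h \<bullet> x = b h" if "h \<in> H" for h x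
    using ab[OF that] by (simp_all add: \<nu>_def c_def field_simps)
  define k where "k F = facet_normal P F \<bullet> (SOME x. x \<in> F)" for F
  have main: "facet_normal P F = \<nu> h \<and> k F = c h"
    if h: "h \<in> H" and F: "F = P \<inter> {x. a h \<bullet> x = b h}" for F h
  proof -
    have Ff: "F facet_of P" using fac h F by blast
    then have "F \<noteq> {}" by (simp add: facet_of_def)
    then have "(SOME x. x \<in> F) \<in> F" by (simp add: some_in_eq)
    then have "\<nu> h \<bullet> (SOME x. x \<in> F) = c h" using \<nu>_eq[OF h] F by blast
    moreover have "facet_normal P F = \<nu> h"
    proof (rule facet_normal_eq[OF Ff int \<nu>[OF h]])
      fix x assume "x \<in> P"
      then have "x \<in> h" using h PH by blast
      then show "\<nu> h \<bullet> x \<le> c h" using \<nu>_le[OF h] ab[OF h] by blast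
    qed (use \<nu>_eq[OF h] F in blast)
    ultimately show ?thesis by (simp add: k_def)
  qed
  have *: "\<exists>h\<in>H. F = P \<inter> {x. a h \<bullet> x = b h}" if "F \<in> facets P" for F
    using that fac by (auto simp: facets_def)
  show ?thesis
  proof (rule that[of k])
    fix F assume "F \<in> facets P"
    then obtain h where h: "h \<in> H" "F = P \<inter> {x. a h \<bullet> x = b h}" using * by blast
    note m = main[OF h]
    show "norm (facet_normal P F) = 1" using m \<nu>[OF h(1)] by simp
    show "F = P \<inter> {x. facet_normal P F \<bullet> x = k F}" using m \<nu>_eq[OF h(1)] h(2) by simp
    show "facet_normal P F \<bullet> x \<le> k F" if "x \<in> P" for x
    proof -
      have "x \<in> h" using h(1) PH that by blast
      then show ?thesis using m \<nu>_le[OF h(1)] ab[OF h(1)] by auto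
    qed
  next
    fix x assume x: "\<And>F. F \<in> facets P \<Longrightarrow> facet_normal P F \<bullet> x \<le> k F"
    have "x \<in> h" if h: "h \<in> H" for h
    proof -
      define F where "F = P \<inter> {x. a h \<bullet> x = b h}"
      have "F \<in> facets P" unfolding facets_def using fac h F_def by blast
      then have "\<nu> h \<bullet> x \<le> c h" using x[of F] main[OF h F_def] by simp
      then show ?thesis using \<nu>_le[OF h] ab[OF h] by blast
    qed
    then show "x \<in> P" using PH by blast
  qed
qed

text \<open>Above almost every point of the shadow the line in direction \<open>u\<close> enters and leaves \<open>P\<close> through the
  relative interior of exactly one facet each, so the shadows of the facets cover it twice.\<close>

lemma brightness_polytope:
  assumes P: "polytope P" and int: "interior P \<noteq> {}" and u: "norm u = 1"
  shows "2 * brightness P u = (\<Sum>F\<in>facets P. facet_area P F * \<bar>u \<bullet> facet_normal P F\<bar>)"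
proof -
  obtain k where n1: "\<And>F. F \<in> facets P \<Longrightarrow> norm (facet_normal P F) = 1"
    and le: "\<And>F x. F \<in> facets P \<Longrightarrow> x \<in> P \<Longrightarrow> facet_normal P F \<bullet> x \<le> k F"
    and Feq: "\<And>F. F \<in> facets P \<Longrightarrow> F = P \<inter> {x. facet_normal P F \<bullet> x = k F}"
    and inP: "\<And>x. (\<And>F. F \<in> facets P \<Longrightarrow> facet_normal P F \<bullet> x \<le> k F) \<Longrightarrow> x \<in> P"
    using polytope_facet_halfspaces[OF P int] by metis
  define \<nu> where "\<nu> = facet_normal P"
  have fin: "finite (facets P)" unfolding facets_def by (rule finite_polytope_facets[OF P])
  have cP: "compact P" by (rule polytope_imp_compact[OF P])
  have cF: "compact F" if "F \<in> facets P" for F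
    using that face_of_imp_compact[OF polytope_imp_convex[OF P] cP] facet_of_imp_face_of by (auto simp: facets_def)
  have memF: "x \<in> F \<longleftrightarrow> x \<in> P \<and> \<nu> F \<bullet> x = k F" if "F \<in> facets P" for F x
    using Feq[OF that] unfolding \<nu>_def by blast
  obtain e1 e2 where e: "orthonormal_frame e1 e2 u"
    and b: "\<And>K. brightness K u = measure lebesgue (frame_coords e1 e2 ` K)"
    using brightness_frame[OF u] by metis
  define q where "q = frame_coords e1 e2"
  have areaF: "facet_area P F * \<bar>u \<bullet> \<nu> F\<bar> = measure lebesgue (q ` F)" if F: "F \<in> facets P" for F
  proof -
    obtain f1 f2 where f: "orthonormal_frame f1 f2 (\<nu> F)"
      and a: "\<And>A. plane_area (\<nu> F) A = measure lebesgue (frame_coords f1 f2 ` A)"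
      using plane_area_frame[OF n1[OF F]] unfolding \<nu>_def by metis
    have "measure lebesgue (q ` F) = \<bar>u \<bullet> \<nu> F\<bar> * measure lebesgue (frame_coords f1 f2 ` F)"
      unfolding q_def by (rule measure_frame_coords_plane[OF f e cF[OF F]]) (use memF[OF F] in blast)
    then show ?thesis by (simp add: facet_area_def \<nu>_def[symmetric] a)
  qed
  \<comment> \<open>The shadows over which the count may fail: of facets parallel to
    \<open>u\<close>, and of points common to two facets. If the two facets are both parallel to
    \<open>u\<close>, the first part contains them already.\<close>
  define E where "E = (\<Union>F\<in>{F\<in>facets P. u \<bullet> \<nu> F = 0}. q ` F) \<union>
    (\<Union>(F, G)\<in>{(F, G). F \<in> facets P \<and> G \<in> facets P \<and> F \<noteq> G \<and> u \<bullet> \<nu> F \<noteq> 0}. q ` (F \<inter> G))"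
  have "negligible E"
    unfolding E_def
  proof (intro negligible_Un negligible_Union finite_imageI)
    show "finite {F \<in> facets P. u \<bullet> \<nu> F = 0}" using fin by simp
    show "finite {(F, G). F \<in> facets P \<and> G \<in> facets P \<and> F \<noteq> G \<and> u \<bullet> \<nu> F \<noteq> 0}"
      by (rule finite_subset[of _ "facets P \<times> facets P"]) (use fin in auto)
  next
    fix t assume "t \<in> (`) q ` {F \<in> facets P. u \<bullet> \<nu> F = 0}"
    then obtain F where F: "F \<in> facets P" "u \<bullet> \<nu> F = 0" "t = q ` F" by blast
    have "\<nu> F \<bullet> u = 0" "\<nu> F \<noteq> 0" using F(2) n1[OF F(1)] by (auto simp: inner_commute \<nu>_def)
    then show "negligible t" unfolding F(3) q_def
      by (rule negligible_frame_coords_line[OF e]) (use memF[OF F(1)] in blast)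
  next
    fix t assume "t \<in> (\<lambda>(F, G). q ` (F \<inter> G)) ` {(F, G). F \<in> facets P \<and> G \<in> facets P \<and> F \<noteq> G \<and> u \<bullet> \<nu> F \<noteq> 0}"
    then obtain F G where FG: "F \<in> facets P" "G \<in> facets P" "F \<noteq> G" "u \<bullet> \<nu> F \<noteq> 0" "t = q ` (F \<inter> G)" by blast
    \<comment> \<open>Chosen so that \<open>w\<close> is orthogonal to \<open>u\<close>. The inner
      product with \<open>w\<close> is constant on the common part, which therefore projects into a
      line.\<close>
    define l where "l = (\<nu> G \<bullet> u) / (\<nu> F \<bullet> u)"
    define w where "w = \<nu> G - l *\<^sub>R \<nu> F"
    show "negligible t"
    proof (cases "F \<inter> G = {}")
      case False
      then obtain x0 where x0: "x0 \<in> F" "x0 \<in> G" by blast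
      have "w \<bullet> u = 0" using FG(4) by (simp add: w_def l_def inner_diff_left inner_commute[of u])
      moreover have "w \<noteq> 0"
      proof
        assume "w = 0"
        then have G: "\<nu> G = l *\<^sub>R \<nu> F" by (simp add: w_def)
        have "\<bar>l\<bar> = 1" using n1[OF FG(1)] n1[OF FG(2)] G unfolding \<nu>_def by (metis norm_scaleR mult.right_neutral)
        have kG: "k G = l * k F"
          using x0 memF[OF FG(1), of x0] memF[OF FG(2), of x0] G by simp
        \<comment> \<open>Equal normals at a common point make the two facets coincide, opposite
          ones confine \<open>P\<close> to a single plane.\<close>
        consider "l = 1" | "l = -1" using \<open>\<bar>l\<bar> = 1\<close> by linarith
        then show False
        proof cases
          case 1
          then have "F = G" using Feq[OF FG(1)] Feq[OF FG(2)] G kG unfolding \<nu>_def by simp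
          then show False using FG(3) by simp
        next
          case 2
          have "P \<subseteq> {x. \<nu> F \<bullet> x = k F}"
          proof
            fix x assume "x \<in> P"
            then have "\<nu> F \<bullet> x \<le> k F" "\<nu> G \<bullet> x \<le> k G" using le FG unfolding \<nu>_def by auto
            then show "x \<in> {x. \<nu> F \<bullet> x = k F}" using G kG 2 by simp
          qed
          then show False using plane_no_interior n1[OF FG(1)] int unfolding \<nu>_def by blast
        qed
      qed
      moreover have "w \<bullet> x = k G - l * k F" if "x \<in> F \<inter> G" for x
        using that memF[OF FG(1), of x] memF[OF FG(2), of x] by (simp add: w_def inner_diff_left)
      ultimately show ?thesis unfolding FG(5) q_def by (rule negligible_frame_coords_line[OF e])
    qed (simp add: FG(5))
  qed
  have line: "x = z + ((x - z) \<bullet> u) *\<^sub>R u" if "q x = q z" for x z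
  proof -
    have "(x - z) \<bullet> e1 = 0" "(x - z) \<bullet> e2 = 0"
      using that unfolding q_def frame_coords_def inner_diff_left by (metis vector_2 diff_self)+
    then have "x - z = ((x - z) \<bullet> u) *\<^sub>R u" using frame_representation[OF e, of "x - z"] by simp
    then show ?thesis by (metis add.commute diff_add_cancel)
  qed
  have q_line: "q (x + t *\<^sub>R u) = q x" for x t
    using orthonormal_frameD[OF e] by (simp add: q_def frame_coords_def inner_add_left)
  have extreme: "\<exists>F\<in>facets P. z \<in> F \<and> v \<bullet> \<nu> F > 0"
    if z: "z \<in> P" and last: "\<And>t. 0 < t \<Longrightarrow> z + t *\<^sub>R v \<notin> P" for z v
  proof (rule ccontr)
    \<comment> \<open>Otherwise every facet inequality survives a short step in direction \<open>v\<close>.\<close>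
    assume "\<not> ?thesis"
    then have no: "\<nu> F \<bullet> z < k F \<or> v \<bullet> \<nu> F \<le> 0" if "F \<in> facets P" for F
      using that memF[OF that, of z] z le[OF that z] unfolding \<nu>_def by force
    have "\<forall>\<^sub>F t in at_right 0. \<forall>F\<in>facets P. \<nu> F \<bullet> (z + t *\<^sub>R v) \<le> k F"
    proof (rule eventually_ball_finite[OF fin], rule ballI)
      fix F assume F: "F \<in> facets P"
      show "\<forall>\<^sub>F t in at_right 0. \<nu> F \<bullet> (z + t *\<^sub>R v) \<le> k F"
      proof (cases "v \<bullet> \<nu> F \<le> 0")
        case True
        have zk: "\<nu> F \<bullet> z \<le> k F" using le[OF F z] by (simp add: \<nu>_def)
        show ?thesis
          using eventually_at_right_less[of 0]
        proof eventually_elim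
          case (elim t)
          then have "t * (\<nu> F \<bullet> v) \<le> 0" using True by (simp add: mult_nonneg_nonpos inner_commute)
          then show ?case using zk by (simp add: inner_add_right)
        qed
      next
        case False
        then have "\<nu> F \<bullet> z < k F" using no[OF F] by simp
        moreover have "((\<lambda>t. \<nu> F \<bullet> (z + t *\<^sub>R v)) \<longlongrightarrow> \<nu> F \<bullet> (z + 0 *\<^sub>R v)) (at_right 0)"
          by (intro tendsto_intros)
        ultimately have "\<forall>\<^sub>F t in at_right 0. \<nu> F \<bullet> (z + t *\<^sub>R v) < k F"
          by (intro order_tendstoD(2)) auto
        then show ?thesis by (rule eventually_mono) simp
      qed
    qed
    then have "\<forall>\<^sub>F t in at_right 0. z + t *\<^sub>R v \<in> P"
      by (rule eventually_mono) (rule inP, simp add: \<nu>_def)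
    moreover have "\<forall>\<^sub>F t in at_right (0::real). 0 < t" by (rule eventually_at_right_less)
    ultimately have "\<forall>\<^sub>F t in at_right (0::real). False" by eventually_elim (use last in blast)
    then show False by simp
  qed
  have count: "(\<Sum>F\<in>facets P. indicator (q ` F) y) = 2 * (indicator (q ` P) y :: real)" if y: "y \<notin> E" for y
  proof (cases "y \<in> q ` P")
    case False
    then have "y \<notin> q ` F" if "F \<in> facets P" for F using Feq[OF that] by blast
    then show ?thesis using False by (simp add: indicator_def)
  next
    case True
    \<comment> \<open>The chord of \<open>P\<close> over \<open>y\<close>. Its top end
      \<open>z1\<close> yields the facet \<open>F1\<close>, its bottom end \<open>z2\<close> the
      facet \<open>F2\<close>.\<close>
    define L where "L = P \<inter> q -` {y}"
    have "closed (q -` {y})" unfolding q_def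
      using continuous_on_frame_coords[of UNIV] by (intro continuous_closed_vimage) (auto simp: continuous_on_eq_continuous_at)
    then have L: "compact L" "L \<noteq> {}" using cP True by (auto simp: L_def compact_Int_closed)
    have cont: "continuous_on L (\<lambda>x. x \<bullet> u)" by (intro continuous_intros)
    obtain z1 where z1: "z1 \<in> L" "\<And>x. x \<in> L \<Longrightarrow> x \<bullet> u \<le> z1 \<bullet> u"
      using continuous_attains_sup[OF L cont] by blast
    obtain z2 where z2: "z2 \<in> L" "\<And>x. x \<in> L \<Longrightarrow> z2 \<bullet> u \<le> x \<bullet> u"
      using continuous_attains_inf[OF L cont] by blast
    have uu: "u \<bullet> u = 1" using u by (simp add: norm_eq_1)
    obtain F1 where F1: "F1 \<in> facets P" "z1 \<in> F1" "u \<bullet> \<nu> F1 > 0"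
    proof -
      have "z1 + t *\<^sub>R u \<notin> P" if "0 < t" for t
      proof
        assume "z1 + t *\<^sub>R u \<in> P"
        then have "z1 + t *\<^sub>R u \<in> L" using z1(1) by (simp add: L_def q_line)
        then show False using z1(2)[of "z1 + t *\<^sub>R u"] that by (simp add: inner_add_left uu)
      qed
      then show ?thesis using extreme[of z1 u] z1(1) that by (auto simp: L_def)
    qed
    obtain F2 where F2: "F2 \<in> facets P" "z2 \<in> F2" "u \<bullet> \<nu> F2 < 0"
    proof -
      have "z2 + t *\<^sub>R (- u) \<notin> P" if "0 < t" for t
      proof
        assume *: "z2 + t *\<^sub>R (- u) \<in> P"
        have "q (z2 + t *\<^sub>R (- u)) = q z2" using q_line[of z2 "- t"] by simp
        then have "z2 + t *\<^sub>R (- u) \<in> L" using z2(1) * by (simp add: L_def)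
        then show False using z2(2)[of "z2 + t *\<^sub>R (- u)"] that by (simp add: inner_diff_left uu)
      qed
      then show ?thesis using extreme[of z2 "- u"] z2(1) that by (auto simp: L_def)
    qed
    have "{F\<in>facets P. y \<in> q ` F} = {F1, F2}"
    proof
      have "y = q z1" "y = q z2" using z1(1) z2(1) by (simp_all add: L_def)
      then show "{F1, F2} \<subseteq> {F\<in>facets P. y \<in> q ` F}" using F1 F2 by blast
      show "{F\<in>facets P. y \<in> q ` F} \<subseteq> {F1, F2}"
      proof
        fix F assume "F \<in> {F\<in>facets P. y \<in> q ` F}"
        then obtain x where F: "F \<in> facets P" "x \<in> F" "y = q x" by blast
        have xL: "x \<in> L" using F memF[OF F(1), of x] by (simp add: L_def)
        have "u \<bullet> \<nu> F \<noteq> 0" using y F unfolding E_def by blast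
        moreover have "F = F1" if pos: "u \<bullet> \<nu> F > 0"
        proof (rule ccontr)
          assume "F \<noteq> F1"
          \<comment> \<open>Above a point of \<open>F\<close> the line violates the inequality of
            \<open>F\<close>, so \<open>x\<close> is already the top end and lies in both
            \<open>F\<close> and \<open>F1\<close>; such points have their shadow in
            \<open>E\<close>.\<close>
          define t where "t = (z1 - x) \<bullet> u"
          have "0 \<le> t" using z1(2)[OF xL] by (simp add: t_def inner_diff_left)
          have z: "z1 = x + t *\<^sub>R u" unfolding t_def using z1(1) xL by (intro line) (simp add: L_def)
          have "\<nu> F \<bullet> z1 \<le> k F" using le[OF F(1)] z1(1) by (simp add: L_def \<nu>_def)
          moreover have "\<nu> F \<bullet> z1 = k F + t * (u \<bullet> \<nu> F)"
            using memF[OF F(1), of x] F(2) unfolding z inner_add_right by (simp add: inner_commute)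
          ultimately have "t * (u \<bullet> \<nu> F) \<le> 0" by simp
          then have "t = 0" using \<open>0 \<le> t\<close> pos by (simp add: mult_le_0_iff)
          then have "x = z1" using z by simp
          then have "y \<in> q ` (F \<inter> F1)" using F F1(2) by blast
          then show False using y F(1) F1(1) \<open>F \<noteq> F1\<close> \<open>u \<bullet> \<nu> F \<noteq> 0\<close> unfolding E_def by blast
        qed
        moreover have "F = F2" if neg: "u \<bullet> \<nu> F < 0"
        proof (rule ccontr)
          assume "F \<noteq> F2"
          define t where "t = (z2 - x) \<bullet> u"
          have "t \<le> 0" using z2(2)[OF xL] by (simp add: t_def inner_diff_left)
          have z: "z2 = x + t *\<^sub>R u" unfolding t_def using z2(1) xL by (intro line) (simp add: L_def)
          have "\<nu> F \<bullet> z2 \<le> k F" using le[OF F(1)] z2(1) by (simp add: L_def \<nu>_def)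
          moreover have "\<nu> F \<bullet> z2 = k F + t * (u \<bullet> \<nu> F)"
            using memF[OF F(1), of x] F(2) unfolding z inner_add_right by (simp add: inner_commute)
          ultimately have "t * (u \<bullet> \<nu> F) \<le> 0" by simp
          then have "t = 0" using \<open>t \<le> 0\<close> neg by (simp add: mult_le_0_iff)
          then have "x = z2" using z by simp
          then have "y \<in> q ` (F \<inter> F2)" using F F2(2) by blast
          then show False using y F(1) F2(1) \<open>F \<noteq> F2\<close> \<open>u \<bullet> \<nu> F \<noteq> 0\<close> unfolding E_def by blast
        qed
        ultimately show "F \<in> {F1, F2}" by (cases "u \<bullet> \<nu> F > 0") auto
      qed
    qed
    moreover have "F1 \<noteq> F2" using F1(3) F2(3) by auto
    ultimately have "card {F\<in>facets P. y \<in> q ` F} = 2" by simp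
    moreover have "(\<Sum>F\<in>facets P. indicator (q ` F) y) = real (card {F\<in>facets P. y \<in> q ` F})"
      using fin by (simp add: indicator_def of_bool_def sum.If_cases Int_def)
    ultimately show ?thesis using True by simp
  qed
  have lm: "q ` A \<in> lmeasurable" if "compact A" for A
    unfolding q_def by (intro lmeasurable_compact compact_frame_coords that)
  have int_ind: "integrable lebesgue (indicator (q ` A) :: _ \<Rightarrow> real)" if "compact A" for A
    using lm[OF that] by (intro integrable_real_indicator) (auto simp: fmeasurable_def)
  have "(\<Sum>F\<in>facets P. facet_area P F * \<bar>u \<bullet> \<nu> F\<bar>) = (\<Sum>F\<in>facets P. \<integral>y. indicator (q ` F) y \<partial>lebesgue)"
    by (intro sum.cong refl) (simp add: areaF)
  also have "\<dots> = (\<integral>y. (\<Sum>F\<in>facets P. indicator (q ` F) y) \<partial>lebesgue)"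
    using int_ind cF by (intro Bochner_Integration.integral_sum[symmetric]) auto
  \<comment> \<open>Integrating the count turns numbers of facets into areas of shadows, with the
    null set \<open>E\<close> ignored.\<close>
  also have "\<dots> = (\<integral>y. 2 * indicator (q ` P) y \<partial>lebesgue)"
  proof (rule integral_cong_AE)
    have "AE y in lebesgue. y \<notin> E"
      using \<open>negligible E\<close> by (intro AE_not_in) (simp add: negligible_iff_null_sets)
    then show "AE y in lebesgue. (\<Sum>F\<in>facets P. indicator (q ` F) y) = 2 * (indicator (q ` P) y :: real)"
      by (rule eventually_mono) (rule count)
  qed (use int_ind cF cP in \<open>auto intro!: borel_measurable_sum borel_measurable_times borel_measurable_integrable\<close>)
  also have "\<dots> = 2 * brightness P u" by (simp add: b q_def)
  finally show ?thesis by (simp add: \<nu>_def)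
qed

lemma (in uniform_direction) variance_brightness_polytope:
  assumes P: "polytope P" and int: "interior P \<noteq> {}"
  shows "variance (\<lambda>x. brightness P (U x)) =
    1/4 * (\<Sum>F\<in>facets P. \<Sum>F'\<in>facets P. facet_area P F * facet_area P F' *
      I2 \<bar>facet_normal P F \<bullet> facet_normal P F'\<bar>) - (surface_area P)\<^sup>2 / 16"
proof -
  let ?A = "facet_area P" and ?n = "facet_normal P"
  have fin: "finite (facets P)" unfolding facets_def by (rule finite_polytope_facets[OF P])
  have n1: "norm (?n F) = 1" if "F \<in> facets P" for F
    using polytope_facet_halfspaces[OF P int] that by metis
  have b: "brightness P (U x) = (\<Sum>F\<in>facets P. ?A F / 2 * \<bar>U x \<bullet> ?n F\<bar>)" if "x \<in> space M" for x
    using brightness_polytope[OF P int norm_direction[OF that]] by (simp add: sum_divide_distrib[symmetric])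
  have "expectation (\<lambda>x. brightness P (U x)) = expectation (\<lambda>x. \<Sum>F\<in>facets P. ?A F / 2 * \<bar>U x \<bullet> ?n F\<bar>)"
    by (intro Bochner_Integration.integral_cong refl b)
  then have "variance (\<lambda>x. brightness P (U x)) = variance (\<lambda>x. \<Sum>F\<in>facets P. ?A F / 2 * \<bar>U x \<bullet> ?n F\<bar>)"
    by (intro Bochner_Integration.integral_cong refl) (simp only: b)
  also have "\<dots> = (\<Sum>F\<in>facets P. \<Sum>F'\<in>facets P. ?A F / 2 * (?A F' / 2) * k2 \<bar>?n F \<bullet> ?n F'\<bar>)"
    by (rule variance_weighted_sum[OF fin n1])
  \<comment> \<open>The two weights 1/2 give the overall factor 1/4 and turn the 1/4 inside
    \<open>k2\<close> into the 1/16 of the squared surface area.\<close>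
  also have "\<dots> = (\<Sum>F\<in>facets P. \<Sum>F'\<in>facets P.
      1/4 * (?A F * ?A F' * I2 \<bar>?n F \<bullet> ?n F'\<bar>) - 1/16 * (?A F * ?A F'))"
    by (intro sum.cong refl) (simp add: k2_def right_diff_distrib)
  also have "\<dots> = 1/4 * (\<Sum>F\<in>facets P. \<Sum>F'\<in>facets P. ?A F * ?A F' * I2 \<bar>?n F \<bullet> ?n F'\<bar>)
      - 1/16 * (\<Sum>F\<in>facets P. \<Sum>F'\<in>facets P. ?A F * ?A F')"
    by (simp only: sum_subtractf sum_distrib_left)
  also have "(\<Sum>F\<in>facets P. \<Sum>F'\<in>facets P. ?A F * ?A F') = (surface_area P)\<^sup>2"
    by (simp only: surface_area_def power2_eq_square sum_product)
  finally show ?thesis by simp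
qed

theorem theorem6p7:
  fixes M :: "'a measure" and U :: "'a \<Rightarrow> real^3"
  assumes "prob_space M" and "uniform_on_sphere M U"
  shows
    "(\<forall>n1\<in>sphere 0 1. \<forall>n2\<in>sphere 0 1.
        prob_space.expectation M (\<lambda>x. \<bar>U x \<bullet> n1\<bar> * \<bar>U x \<bullet> n2\<bar>) = I2 \<bar>n1 \<bullet> n2\<bar>) \<and>
     (\<forall>\<rho>\<in>{0..1}. I2 \<rho> = 2 / (3 * pi) * (sqrt (1 - \<rho>\<^sup>2) + \<rho> * arcsin \<rho>)) \<and>
     (\<forall>\<rho>\<in>{0..1}. (I2 has_real_derivative 2 / (3 * pi) * arcsin \<rho>) (at \<rho> within {0..1})) \<and>
     strict_mono_on {0..1} I2 \<and>
     bij_betw I2 {0..1} {2 / (3 * pi)..1/3} \<and>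
     (\<forall>Z \<mu>. zonoid Z \<and> even_generating_measure Z \<mu> \<longrightarrow>
        prob_space.variance M (\<lambda>x. width Z (U x)) =
          (\<integral>n. (\<integral>n'. k2 \<bar>n \<bullet> n'\<bar> \<partial>\<mu>) \<partial>\<mu>)) \<and>
     (\<forall>K S. convex_body K \<and> surface_area_measure K S \<longrightarrow>
        prob_space.variance M (\<lambda>x. brightness K (U x)) =
          1/4 * (\<integral>n. (\<integral>n'. k2 \<bar>n \<bullet> n'\<bar> \<partial>S) \<partial>S)) \<and>
     (\<forall>P. polytope P \<and> interior P \<noteq> {} \<longrightarrow>
        prob_space.variance M (\<lambda>x. brightness P (U x)) =
          1/4 * (\<Sum>F\<in>facets P. \<Sum>F'\<in>facets P. facet_area P F * facet_area P F' *
                   I2 \<bar>facet_normal P F \<bullet> facet_normal P F'\<bar>) - (surface_area P)\<^sup>2 / 16) \<and>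
     psd_kernel_on unoriented_directions k2_kernel \<and>
     (\<exists>d\<in>unoriented_directions. \<exists>d'\<in>unoriented_directions. k2_kernel d d' < 0) \<and>
     (\<forall>Z. zonoid Z \<and> interior Z \<noteq> {} \<longrightarrow>
        (prob_space.variance M (\<lambda>x. width Z (U x)) = 0 \<longleftrightarrow> (\<exists>c. \<exists>r>0. Z = cball c r))) \<and>
     (\<forall>K. convex_body K \<longrightarrow>
        (prob_space.variance M (\<lambda>x. brightness K (U x)) = 0 \<longleftrightarrow> constant_brightness K))"
proof -
  interpret uniform_direction M U
    using assms by (simp add: uniform_direction_def uniform_direction_axioms_def)
  show ?thesis
  proof (intro conjI)
    show "\<forall>n1\<in>sphere 0 1. \<forall>n2\<in>sphere 0 1. expectation (\<lambda>x. \<bar>U x \<bullet> n1\<bar> * \<bar>U x \<bullet> n2\<bar>) = I2 \<bar>n1 \<bullet> n2\<bar>"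
      by (simp add: expectation_abs_inner_pair)
    show "\<forall>\<rho>\<in>{0..1}. I2 \<rho> = 2 / (3 * pi) * (sqrt (1 - \<rho>\<^sup>2) + \<rho> * arcsin \<rho>)"
      using I2_eq unfolding arcsin_primitive_def by blast
    show "\<forall>\<rho>\<in>{0..1}. (I2 has_real_derivative 2 / (3 * pi) * arcsin \<rho>) (at \<rho> within {0..1})"
      using DERIV_within_I2 by blast
    show "strict_mono_on {0..1} I2" by (rule strict_mono_on_I2)
    show "bij_betw I2 {0..1} {2 / (3 * pi)..1/3}" by (rule bij_betw_I2)
    show "\<forall>Z \<mu>. zonoid Z \<and> even_generating_measure Z \<mu> \<longrightarrow>
        variance (\<lambda>x. width Z (U x)) = (\<integral>n. (\<integral>n'. k2 \<bar>n \<bullet> n'\<bar> \<partial>\<mu>) \<partial>\<mu>)"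
      by (intro allI impI variance_generated) (auto simp: even_generating_measure_def)
    show "\<forall>K S. convex_body K \<and> surface_area_measure K S \<longrightarrow>
        variance (\<lambda>x. brightness K (U x)) = 1/4 * (\<integral>n. (\<integral>n'. k2 \<bar>n \<bullet> n'\<bar> \<partial>S) \<partial>S)"
      using variance_brightness by blast
    show "\<forall>P. polytope P \<and> interior P \<noteq> {} \<longrightarrow>
        variance (\<lambda>x. brightness P (U x)) =
          1/4 * (\<Sum>F\<in>facets P. \<Sum>F'\<in>facets P. facet_area P F * facet_area P F' *
                   I2 \<bar>facet_normal P F \<bullet> facet_normal P F'\<bar>) - (surface_area P)\<^sup>2 / 16"
      using variance_brightness_polytope by blast
    show "psd_kernel_on unoriented_directions k2_kernel" by (rule psd_k2_kernel)
    show "\<exists>d\<in>unoriented_directions. \<exists>d'\<in>unoriented_directions. k2_kernel d d' < 0"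
      by (rule k2_kernel_takes_negative_value)
    show "\<forall>Z. zonoid Z \<and> interior Z \<noteq> {} \<longrightarrow>
        (variance (\<lambda>x. width Z (U x)) = 0 \<longleftrightarrow> (\<exists>c. \<exists>r>0. Z = cball c r))"
      using variance_width_eq_0_iff by blast
    show "\<forall>K. convex_body K \<longrightarrow> (variance (\<lambda>x. brightness K (U x)) = 0 \<longleftrightarrow> constant_brightness K)"
      using variance_brightness_eq_0_iff by blast
  qed
qed

end
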